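(* Let $(\mathcal G_1,e_1)$ and $(\mathcal G_2,e_2)$ be rooted graphs with spectral distributions $\mu$ and $\nu$. Then the free product admits the star-orthogonal decomposition $$\mathcal G_1*\mathcal G_2\cong \mathcal L_1\star\mathcal L_2,$$ where $\mathcal L_1=\mathcal G_1\vdash(\mathcal G_2\vdash(\mathcal G_1\vdash\cdots))$ and $\mathcal L_2=\mathcal G_2\vdash(\mathcal G_1\vdash(\mathcal G_2\vdash\cdots))$ (isomorphism of rooted graphs). If $\mathcal G_1$ and $\mathcal G_2$ are uniformly locally finite, the spectral distribution of $(\mathcal G_1*\mathcal G_2,e)$ is $\mu\boxplus\nu$ and $\mu\boxplus\nu=\text{w-}\lim_{m\to\infty}\big((\mu\vdash_m\nu)\uplus(\nu\vdash_m\mu)\big)$.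
   Context: Graphs: non-oriented, connected, locally finite, simple, nonempty edge set; uniformly locally finite = bounded degrees. Spectral distribution of $(\mathcal G,e)$: probability measure with moments $\langle A^k\delta(e),\delta(e)\rangle$, $A\delta(x)=\sum_{x'\sim x}\delta(x')$. Free product $\mathcal G_1*\mathcal G_2$: vertices the empty word $e$ and alternating words in letters from $V_1\setminus\{e_1\}$, $V_2\setminus\{e_2\}$ (roots identified with the empty word), edges $\{vu,v'u\}$, $\{v,v'\}\in E_1\cup E_2$, $u,vu,v'u$ vertices; root $e$. Star product $\mathcal G\star\mathcal H$: vertex set $(V_{\mathcal G}\times\{e_{\mathcal H}\})\cup(\{e_{\mathcal G}\}\times V_{\mathcal H})$, edges copied from each factor, root $(e_{\mathcal G},e_{\mathcal H})$ (the two graphs glued at their roots). Orthogonal product $\mathcal G\vdash\mathcal H$: vertex set $((V_{\mathcal G}\setminus\{e_{\mathcal G}\})\times V_{\mathcal H})\cup\{(e_{\mathcal G},e_{\mathcal H})\}$, root $(e_{\mathcal G},e_{\mathcal H})$, edges $\{(x,e_{\mathcal H}),(x',e_{\mathcal H})\}$ for $\{x,x'\}\in E_{\mathcal G}$ and $\{(x,y),(x,y')\}$ for $x\ne e_{\mathcal G}$, $\{y,y'\}\in E_{\mathcal H}$. Set $\mathcal G_2\vdash_0\mathcal G_1=\mathcal G_2$, $\mathcal G_1\vdash_0\mathcal G_2=\mathcal G_1$ and $\mathcal G_1\vdash_m\mathcal G_2=\mathcal G_1\vdash(\mathcal G_2\vdash_{m-1}\mathcal G_1)$, symmetrically for $\mathcal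 G_2\vdash_m\mathcal G_1$. Inclusions: $\mathcal H\hookrightarrow\mathcal H\vdash\mathcal K$ via $y\mapsto(y,e_{\mathcal K})$; a root-preserving embedding $j:\mathcal H\to\mathcal H'$ induces $\mathcal G\vdash\mathcal H\to\mathcal G\vdash\mathcal H'$, $(x,y)\mapsto(x,j(y))$; this gives recursively root-preserving embeddings $\mathcal G_1\vdash_m\mathcal G_2\to\mathcal G_1\vdash_{m+1}\mathcal G_2$, and $\mathcal L_1$ (resp. $\mathcal L_2$) is the inductive limit (union) of the chain $(\mathcal G_1\vdash_m\mathcal G_2)_m$ (resp. $(\mathcal G_2\vdash_m\mathcal G_1)_m$). Measures: for compactly supported $\rho$, $G_\rho(z)=\int\frac{d\rho(t)}{z-t}$, $F_\rho=1/G_\rho$, $K_\rho=z-F_\rho$; $\mu\uplus\nu$: $K_{\mu\uplus\nu}=K_\mu+K_\nu$; $\mu\vdash\nu$: $K_{\mu\vdash\nu}(z)=K_\mu(F_\nu(z))$; $\mu\vdash_1\nu=\mu\vdash\nu$, $\mu\vdash_m\nu=\mu\vdash(\nu\vdash_{m-1}\mu)$; $\boxplus$ is the free additive convolution (R-transforms add). *)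

theory Defs
  imports "HOL-Probability.Probability"
begin

section \<open>Rooted graphs\<close>

record 'a rgraph =
  verts :: "'a set"
  edges :: "'a set set"
  base :: 'a

definition nbrs :: "'a rgraph \<Rightarrow> 'a \<Rightarrow> 'a set" where
  "nbrs G x = {y. {x, y} \<in> edges G}"

locale rooted_graph =
  fixes G :: "'a rgraph"
  assumes base_in_verts: "base G \<in> verts G"
    and simple: "\<And>e. e \<in> edges G \<Longrightarrow> \<exists>x y. e = {x, y} \<and> x \<noteq> y \<and> x \<in> verts G \<and> y \<in> verts G"
    and edges_nonempty: "edges G \<noteq> {}"
    and connected: "\<And>x y. x \<in> verts G \<Longrightarrow> y \<in> verts G \<Longrightarrow> (x, y) \<in> {(u, v). {u, v} \<in> edges G}\<^sup>*"
    and locally_finite: "\<And>x. x \<in> verts G \<Longrightarrow> finite (nbrs G x)"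

definition uniformly_locally_finite :: "'a rgraph \<Rightarrow> bool" where
  "uniformly_locally_finite G \<longleftrightarrow> (\<exists>d. \<forall>x\<in>verts G. finite (nbrs G x) \<and> card (nbrs G x) \<le> d)"

definition rooted_iso :: "'a rgraph \<Rightarrow> 'b rgraph \<Rightarrow> bool" where
  "rooted_iso G H \<longleftrightarrow> (\<exists>f. bij_betw f (verts G) (verts H) \<and> f (base G) = base H \<and>
     (\<forall>x\<in>verts G. \<forall>y\<in>verts G. {x, y} \<in> edges G \<longleftrightarrow> {f x, f y} \<in> edges H))"

text \<open>Renaming of vertices; only used with injective maps.\<close>

definition relabel :: "('a \<Rightarrow> 'b) \<Rightarrow> 'a rgraph \<Rightarrow> 'b rgraph" where
  "relabel f G = \<lparr>verts = f ` verts G, edges = (\<lambda>e. f ` e) ` edges G, base = f (base G)\<rparr>"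


section \<open>Products of rooted graphs\<close>

definition star_prod :: "'a rgraph \<Rightarrow> 'b rgraph \<Rightarrow> ('a \<times> 'b) rgraph" where
  "star_prod G H =
    \<lparr>verts = verts G \<times> {base H} \<union> {base G} \<times> verts H,
     edges = {{(x, base H), (x', base H)} | x x'. {x, x'} \<in> edges G} \<union>
             {{(base G, y), (base G, y')} | y y'. {y, y'} \<in> edges H},
     base = (base G, base H)\<rparr>"

definition orth_prod :: "'a rgraph \<Rightarrow> 'b rgraph \<Rightarrow> ('a \<times> 'b) rgraph" where
  "orth_prod G H =
    \<lparr>verts = (verts G - {base G}) \<times> verts H \<union> {(base G, base H)},
     edges = {{(x, base H), (x', base H)} | x x'. {x, x'} \<in> edges G} \<union>
             {{(x, y), (x, y')} | x y y'. x \<in> verts G \<and> x \<noteq> base G \<and> {y, y'} \<in> edges H},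
     base = (base G, base H)\<rparr>"

text \<open>
  Words are lists over the disjoint union of the two alphabets. The maps \<open>letter1\<close>, \<open>letter2\<close>
  turn a vertex into a word of length at most one, identifying the roots with the empty word.
\<close>

definition letter1 :: "'a rgraph \<Rightarrow> 'a \<Rightarrow> ('a + 'b) list" where
  "letter1 G v = (if v = base G then [] else [Inl v])"

definition letter2 :: "'b rgraph \<Rightarrow> 'b \<Rightarrow> ('a + 'b) list" where
  "letter2 G v = (if v = base G then [] else [Inr v])"

definition free_words :: "'a rgraph \<Rightarrow> 'b rgraph \<Rightarrow> ('a + 'b) list set" where
  "free_words G1 G2 =
    {w. set w \<subseteq> Inl ` (verts G1 - {base G1}) \<union> Inr ` (verts G2 - {base G2}) \<and>
        successively (\<lambda>a b. isl a \<noteq> isl b) w}"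

definition free_prod :: "'a rgraph \<Rightarrow> 'b rgraph \<Rightarrow> ('a + 'b) list rgraph" where
  "free_prod G1 G2 =
    \<lparr>verts = free_words G1 G2,
     edges =
       {{letter1 G1 v @ u, letter1 G1 v' @ u} | v v' u. {v, v'} \<in> edges G1 \<and>
          u \<in> free_words G1 G2 \<and> letter1 G1 v @ u \<in> free_words G1 G2 \<and>
          letter1 G1 v' @ u \<in> free_words G1 G2} \<union>
       {{letter2 G2 v @ u, letter2 G2 v' @ u} | v v' u. {v, v'} \<in> edges G2 \<and>
          u \<in> free_words G1 G2 \<and> letter2 G2 v @ u \<in> free_words G1 G2 \<and>
          letter2 G2 v' @ u \<in> free_words G1 G2},
     base = []\<rparr>"


section \<open>Iterated orthogonal products and their inductive limit\<close>

text \<open>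
  The vertex type of an iterated orthogonal product depends on the number of iterations. Both
  graphs are therefore taken over one common vertex type \<open>'c\<close>, and the nested tuple
  \<open>(x\<^sub>0, (x\<^sub>1, (\<dots>, x\<^sub>m)))\<close> is stored as the list \<open>[x\<^sub>0, x\<^sub>1, \<dots>, x\<^sub>m]\<close>; pairing becomes \<open>#\<close>.
\<close>

fun orth_prod_iter :: "nat \<Rightarrow> 'c rgraph \<Rightarrow> 'c rgraph \<Rightarrow> 'c list rgraph" where
  "orth_prod_iter 0 G H = relabel (\<lambda>x. [x]) G"
| "orth_prod_iter (Suc m) G H = relabel (\<lambda>(x, y). x # y) (orth_prod G (orth_prod_iter m H G))"

text \<open>
  The embedding of stage \<open>m\<close> into stage \<open>m + 1\<close>: at the start \<open>x \<mapsto> (x, e\<^sub>H)\<close>, where the second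
  component is the root of \<open>orth_prod_iter 0 H G\<close>, and then \<open>(x, y) \<mapsto> (x, j y)\<close>.
\<close>

fun orth_emb :: "'c rgraph \<Rightarrow> 'c rgraph \<Rightarrow> nat \<Rightarrow> 'c list \<Rightarrow> 'c list" where
  "orth_emb G H 0 xs = hd xs # base (orth_prod_iter 0 H G)"
| "orth_emb G H (Suc m) xs = hd xs # orth_emb H G m (tl xs)"

fun chain_map :: "(nat \<Rightarrow> 'v \<Rightarrow> 'v) \<Rightarrow> nat \<Rightarrow> nat \<Rightarrow> 'v \<Rightarrow> 'v" where
  "chain_map j m 0 x = x"
| "chain_map j m (Suc k) x = j (m + k) (chain_map j m k x)"

text \<open>Elements of the disjoint union of the stages are identified if they agree at a later stage.\<close>

definition limit_rel ::
  "(nat \<Rightarrow> 'v rgraph) \<Rightarrow> (nat \<Rightarrow> 'v \<Rightarrow> 'v) \<Rightarrow> ((nat \<times> 'v) \<times> (nat \<times> 'v)) set" where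
  "limit_rel X j = {((m, x), (n, y)). x \<in> verts (X m) \<and> y \<in> verts (X n) \<and>
     (\<exists>p q. m + p = n + q \<and> chain_map j m p x = chain_map j n q y)}"

definition inductive_limit ::
  "(nat \<Rightarrow> 'v rgraph) \<Rightarrow> (nat \<Rightarrow> 'v \<Rightarrow> 'v) \<Rightarrow> (nat \<times> 'v) set rgraph" where
  "inductive_limit X j =
    \<lparr>verts = (SIGMA m:UNIV. verts (X m)) // limit_rel X j,
     edges = {{limit_rel X j `` {(m, x)}, limit_rel X j `` {(m, y)}} | m x y. {x, y} \<in> edges (X m)},
     base = limit_rel X j `` {(0, base (X 0))}\<rparr>"

definition orth_limit :: "'c rgraph \<Rightarrow> 'c rgraph \<Rightarrow> (nat \<times> 'c list) set rgraph" where
  "orth_limit G H = inductive_limit (\<lambda>m. orth_prod_iter m G H) (orth_emb G H)"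

definition limit1 :: "'a rgraph \<Rightarrow> 'b rgraph \<Rightarrow> (nat \<times> ('a + 'b) list) set rgraph" where
  "limit1 G1 G2 = orth_limit (relabel Inl G1) (relabel Inr G2)"

definition limit2 :: "'a rgraph \<Rightarrow> 'b rgraph \<Rightarrow> (nat \<times> ('a + 'b) list) set rgraph" where
  "limit2 G1 G2 = orth_limit (relabel Inr G2) (relabel Inl G1)"


section \<open>Spectral distributions\<close>

definition delta :: "'a \<Rightarrow> 'a \<Rightarrow> real" where
  "delta x = (\<lambda>y. if y = x then 1 else 0)"

text \<open>The linear extension of \<open>\<delta>(x) \<mapsto> \<Sum>x' \<sim> x. \<delta>(x')\<close>, see \<open>adj_op_delta\<close> below.\<close>

definition adj_op :: "'a rgraph \<Rightarrow> ('a \<Rightarrow> real) \<Rightarrow> ('a \<Rightarrow> real)" where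
  "adj_op G f = (\<lambda>y. \<Sum>x\<in>nbrs G y. f x)"

lemma (in rooted_graph) adj_op_delta:
  "adj_op G (delta x) = (\<lambda>y. \<Sum>x'\<in>nbrs G x. delta x' y)"
proof
  fix y
  have fin: "finite (nbrs G z)" for z
  proof (cases "z \<in> verts G")
    case False
    then have "nbrs G z = {}"
      using simple unfolding nbrs_def by (fastforce simp: doubleton_eq_iff)
    then show ?thesis by simp
  qed (rule locally_finite)
  have "x \<in> nbrs G y \<longleftrightarrow> y \<in> nbrs G x"
    by (simp add: nbrs_def insert_commute)
  then show "adj_op G (delta x) y = (\<Sum>x'\<in>nbrs G x. delta x' y)"
    using fin by (simp add: adj_op_def delta_def)
qed

definition ell2_inner :: "'a rgraph \<Rightarrow> ('a \<Rightarrow> real) \<Rightarrow> ('a \<Rightarrow> real) \<Rightarrow> real" where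
  "ell2_inner G f g = (\<Sum>\<^sub>\<infinity>x\<in>verts G. f x * g x)"

definition spectral_distribution :: "'a rgraph \<Rightarrow> real measure \<Rightarrow> bool" where
  "spectral_distribution G \<mu> \<longleftrightarrow> real_distribution \<mu> \<and>
     (\<forall>k. integrable \<mu> (\<lambda>t. t ^ k) \<and>
          (LINT t|\<mu>. t ^ k) = ell2_inner G ((adj_op G ^^ k) (delta (base G))) (delta (base G)))"


section \<open>Convolutions of compactly supported probability measures\<close>

definition compactly_supported :: "real measure \<Rightarrow> bool" where
  "compactly_supported \<rho> \<longleftrightarrow> real_distribution \<rho> \<and> (\<exists>C. compact C \<and> measure \<rho> C = 1)"

definition cauchy_G :: "real measure \<Rightarrow> complex \<Rightarrow> complex" where
  "cauchy_G \<rho> z = (LINT t|\<rho>. 1 / (z - of_real t))"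

definition recip_F :: "real measure \<Rightarrow> complex \<Rightarrow> complex" where
  "recip_F \<rho> z = 1 / cauchy_G \<rho> z"

definition K_trans :: "real measure \<Rightarrow> complex \<Rightarrow> complex" where
  "K_trans \<rho> z = z - recip_F \<rho> z"

text \<open>
  The defining identities are required on the upper half-plane, where \<open>cauchy_G\<close> has no zeros and
  which \<open>recip_F\<close> maps into itself; there \<open>K_trans\<close> determines the measure.
\<close>

definition boolean_conv :: "real measure \<Rightarrow> real measure \<Rightarrow> real measure" where
  "boolean_conv \<mu> \<nu> = (THE \<rho>. compactly_supported \<rho> \<and>
     (\<forall>z. Im z > 0 \<longrightarrow> K_trans \<rho> z = K_trans \<mu> z + K_trans \<nu> z))"

definition orth_conv :: "real measure \<Rightarrow> real measure \<Rightarrow> real measure" where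
  "orth_conv \<mu> \<nu> = (THE \<rho>. compactly_supported \<rho> \<and>
     (\<forall>z. Im z > 0 \<longrightarrow> K_trans \<rho> z = K_trans \<mu> (recip_F \<nu> z)))"

text \<open>The value at \<open>0\<close> follows the convention for graphs and gives \<open>orth_conv \<mu> \<nu>\<close> at \<open>1\<close>.\<close>

fun orth_conv_iter :: "nat \<Rightarrow> real measure \<Rightarrow> real measure \<Rightarrow> real measure" where
  "orth_conv_iter 0 \<mu> \<nu> = \<mu>"
| "orth_conv_iter (Suc m) \<mu> \<nu> = orth_conv \<mu> (orth_conv_iter m \<nu> \<mu>)"

text \<open>
  \<open>R\<close> is (a representative of the germ at \<open>0\<close> of) the R-transform: \<open>R(z) + 1/z\<close> is the inverse of
  the Cauchy transform near infinity. Analyticity at \<open>0\<close> makes the germ unique.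
\<close>

definition is_R_transform :: "real measure \<Rightarrow> (complex \<Rightarrow> complex) \<Rightarrow> bool" where
  "is_R_transform \<rho> R \<longleftrightarrow> R analytic_on {0} \<and>
     (\<forall>\<^sub>F z in at 0. cauchy_G \<rho> (R z + 1 / z) = z)"

definition free_conv :: "real measure \<Rightarrow> real measure \<Rightarrow> real measure" where
  "free_conv \<mu> \<nu> = (THE \<rho>. compactly_supported \<rho> \<and>
     (\<exists>R\<^sub>1 R\<^sub>2. is_R_transform \<mu> R\<^sub>1 \<and> is_R_transform \<nu> R\<^sub>2 \<and>
        is_R_transform \<rho> (\<lambda>z. R\<^sub>1 z + R\<^sub>2 z)))"

end

(*
  Graph side. Deleting the roots from the tuples that form the vertices of the m-th iterated
  orthogonal product embeds it into the free product, as the subgraph of the words of length at most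
  m + 1 whose last letter comes from the outer factor. The embeddings of the chain become inclusions,
  so the two inductive limits are the sets of words ending in a letter of the first, respectively the
  second, graph; they meet only in the empty word, and every word and every edge lies in one of them.

  Spectral side. For |z| larger than the degree bound, K(z) is the sum over the neighbours of the root
  of the bounded solution v of z v = A v off the root with v(root) = 1. Products of such solutions of the
  factors solve the same problem on star, orthogonal and free products, which yields the identities
  for K and, with s = G(z) as parameter, the additivity of the R-transforms. The measures
  demanded by the definite descriptions exist because they are spectral distributions of graphs, which are
  obtained from the Hausdorff moment problem. Finally, each moment of the star product of the m-th
  stages is a count of closed walks that equals the one of the free product for large m, and convergence
  of moments implies weak convergence since all supports lie in one compact interval.
*)

theory Submission
  imports Defs "HOL-Complex_Analysis.Complex_Analysis"
begin

text \<open>The bound 1 on the normalised solutions is what carries the method to free products: a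
  vertex there is a word of unbounded length, and a product of solutions over its letters stays
  bounded because every factor has modulus at most 1. Boundedness in turn ties the solution to the
  Cauchy transform once |z| exceeds the degree bound d, since iterating z v = A v + alpha delta
  leaves a remainder of order (d / |z|)^n; no Hilbert space or spectral theorem enters. This
  confines the identities to large z. Those for K are continued analytically to the upper
  half-plane, where the definitions demand them; the R-transform is a germ at 0, that is at z =
  infinity, and needs no continuation. Existence of spectral distributions is likewise a matter of
  finite sums: the vectors p(A) delta have finite support, and positivity of d + A and d - A on them
  yields the sign condition of the moment problem. For the weak limit, the degree bounds obtained
  factor by factor grow with m; the common support interval comes from each stage being a subgraph
  of the free product.\<close>

section \<open>Distributions with bounded support\<close>

text \<open>Markov's inequality for t^(2k) bounds the mass beyond any c > C by (C/c)^(2k), which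
  tends to 0; letting c decrease to C along a sequence keeps the exceptional set null.\<close>

lemma (in real_distribution) moments_imp_AE_bounded:
  assumes int: "\<And>k. integrable M (\<lambda>t. t ^ k)"
    and bound: "\<And>k. expectation (\<lambda>t. t ^ (2 * k)) \<le> C ^ (2 * k)" and "C > 0"
  shows "AE t in M. \<bar>t\<bar> \<le> C"
proof -
  have *: "AE t in M. \<bar>t\<bar> < c" if "c > C" for c
  proof -
    have "prob {t. c \<le> \<bar>t\<bar>} \<le> ((C / c)\<^sup>2) ^ k" for k
    proof -
      have "{t. c \<le> \<bar>t\<bar>} \<subseteq> {t \<in> space M. c ^ (2 * k) \<le> t ^ (2 * k)}"
        using that \<open>C > 0\<close> power_mono[of c "\<bar>_\<bar>" "2 * k"] by (auto simp: power_even_abs)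
      then have "prob {t. c \<le> \<bar>t\<bar>} \<le> prob {t \<in> space M. c ^ (2 * k) \<le> t ^ (2 * k)}"
        by (intro finite_measure_mono) auto
      also have "\<dots> \<le> expectation (\<lambda>t. t ^ (2 * k)) / c ^ (2 * k)"
        using that \<open>C > 0\<close> by (intro integral_Markov_inequality_measure[where A = "{}"] int) auto
      also have "\<dots> \<le> C ^ (2 * k) / c ^ (2 * k)"
        using that \<open>C > 0\<close> by (intro divide_right_mono bound) auto
      finally show ?thesis by (simp add: power_divide power_mult)
    qed
    moreover have "(\<lambda>k. ((C / c)\<^sup>2) ^ k) \<longlonglongrightarrow> 0"
      using that \<open>C > 0\<close> by (intro LIMSEQ_power_zero) (simp add: power_less_one_iff abs_square_less_1)
    ultimately have "prob {t. c \<le> \<bar>t\<bar>} \<le> 0"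
      by (intro LIMSEQ_le_const) auto
    then have "prob {t. c \<le> \<bar>t\<bar>} = 0" by (simp add: measure_le_0_iff)
    then show ?thesis
      by (intro AE_I[where N = "{t. c \<le> \<bar>t\<bar>}"]) (auto simp: emeasure_eq_measure)
  qed
  have "AE t in M. \<forall>n. \<bar>t\<bar> < C + 1 / real (Suc n)"
    by (subst AE_all_countable) (auto intro!: *)
  then show ?thesis
  proof eventually_elim
    case (elim t)
    have "(\<lambda>n. C + 1 / real (Suc n)) \<longlonglongrightarrow> C + 0"
      by (intro tendsto_intros LIMSEQ_Suc lim_1_over_n)
    then show ?case
      using elim by (intro LIMSEQ_le_const[of _ C]) (auto intro: less_imp_le)
  qed
qed

abbreviation moment :: "real measure \<Rightarrow> nat \<Rightarrow> real" where
  "moment M k \<equiv> LINT t|M. t ^ k"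

locale bounded_distribution = real_distribution M for M :: "real measure" +
  fixes C :: real
  assumes C_pos: "C > 0" and AE_bounded: "AE t in M. \<bar>t\<bar> \<le> C"
begin

lemma prob_UNIV: "prob UNIV = 1"
  using prob_space unfolding space_eq_univ .

lemma integrable_power [simp, intro]: "integrable M (\<lambda>t. t ^ k)"
proof (rule integrable_const_bound)
  show "AE t in M. norm (t ^ k) \<le> C ^ k"
    using AE_bounded by eventually_elim (auto simp: power_abs intro: power_mono)
qed simp

lemma expectation_abs_power_le: "expectation (\<lambda>t. \<bar>t\<bar> ^ k) \<le> C ^ k"
proof -
  have "AE t in M. \<bar>t\<bar> ^ k \<le> C ^ k"
    using AE_bounded by eventually_elim (auto intro: power_mono)
  moreover have "integrable M (\<lambda>t. \<bar>t\<bar> ^ k)"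
    using integrable_abs[OF integrable_power[of k]] by (simp add: power_abs)
  ultimately have "expectation (\<lambda>t. \<bar>t\<bar> ^ k) \<le> expectation (\<lambda>t. C ^ k)"
    by (intro integral_mono_AE) auto
  then show ?thesis by (simp add: prob_UNIV)
qed

lemma abs_moment_le: "\<bar>moment M k\<bar> \<le> C ^ k"
  using integral_abs_bound[of M "\<lambda>t. t ^ k"] expectation_abs_power_le[of k]
  by (simp add: power_abs)

text \<open>The Taylor remainder of the characteristic function is at most 2 (|t| C)^n / n!, hence
  null for every t. This makes a distribution of bounded support determined by its moments.\<close>

lemma char_sums: "(\<lambda>k. (\<i> * t) ^ k / fact k * moment M k) sums char M t"
proof -
  have bound: "cmod (char M t - (\<Sum>k\<le>n. ((\<i> * t) ^ k / fact k) * moment M k)) \<le> 2 * ((\<bar>t\<bar> * C) ^ n / fact n)" for n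
  proof -
    have "cmod (char M t - (\<Sum>k\<le>n. ((\<i> * t) ^ k / fact k) * moment M k))
        \<le> (2 * \<bar>t\<bar> ^ n / fact n) * expectation (\<lambda>x. \<bar>x\<bar> ^ n)"
      by (rule char_approx1) simp
    also have "\<dots> \<le> (2 * \<bar>t\<bar> ^ n / fact n) * C ^ n"
      by (intro mult_left_mono expectation_abs_power_le) auto
    finally show ?thesis by (simp add: power_mult_distrib)
  qed
  have "(\<lambda>n. 2 * ((\<bar>t\<bar> * C) ^ n / fact n)) \<longlonglongrightarrow> 2 * 0"
    using summable_exp[of "\<bar>t\<bar> * C"]
    by (intro tendsto_intros summable_LIMSEQ_zero) (simp add: field_simps)
  then have "(\<lambda>n. (\<Sum>k\<le>n. ((\<i> * t) ^ k / fact k) * moment M k) - char M t) \<longlonglongrightarrow> 0"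
    unfolding mult_zero_right
    by (rule Lim_null_comparison[OF always_eventually, rotated])
       (intro allI, subst norm_minus_commute, rule bound)
  then have "(\<lambda>n. (\<Sum>k\<le>n. ((\<i> * t) ^ k / fact k) * moment M k)) \<longlonglongrightarrow> char M t"
    by (rule LIM_zero_cancel)
  then show ?thesis by (simp add: sums_def_le)
qed

end

lemma moments_eq_imp_eq:
  assumes "bounded_distribution M C" "bounded_distribution N D" "\<And>k. moment M k = moment N k"
  shows "M = N"
proof -
  interpret M: bounded_distribution M C by fact
  interpret N: bounded_distribution N D by fact
  have "char M t = char N t" for t
    using M.char_sums[of t] N.char_sums[of t] assms(3) by (simp add: sums_unique2)
  then show ?thesis
    by (intro Levy_uniqueness M.real_distribution_axioms N.real_distribution_axioms) auto
qed

text \<open>Since \<open>C\<close> is the same for all \<open>n\<close>, the series of the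
  characteristic functions share the majorant (|t| C)^k / k!, so the limit may be taken termwise;
  Levy's continuity theorem does the rest.\<close>

lemma moments_tendsto_imp_weak_conv:
  assumes "\<And>n. bounded_distribution (M n) C" "bounded_distribution N C"
    and "\<And>k. (\<lambda>n. moment (M n) k) \<longlonglongrightarrow> moment N k"
  shows "weak_conv_m M N"
proof -
  interpret M: bounded_distribution "M n" C for n by fact
  interpret N: bounded_distribution N C by fact
  have "(\<lambda>n. char (M n) t) \<longlonglongrightarrow> char N t" for t
  proof -
    let ?f = "\<lambda>N k. (\<i> * complex_of_real t) ^ k / fact k * complex_of_real (moment N k)"
    have sm: "summable (\<lambda>k. (\<bar>t\<bar> * C) ^ k / fact k)"
      using summable_exp[of "\<bar>t\<bar> * C"] by (simp add: field_simps)
    have "((\<lambda>n. \<Sum>k. ?f (M n) k) \<longlongrightarrow> (\<Sum>k. ?f N k)) sequentially"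
    proof (rule tannerys_theorem[where M = "\<lambda>k. (\<bar>t\<bar> * C) ^ k / fact k", THEN conjunct2, THEN conjunct2])
      show "(\<lambda>n. ?f (M n) k) \<longlonglongrightarrow> ?f N k" for k
        by (intro tendsto_intros assms)
      have "norm (?f (M n) k) \<le> (\<bar>t\<bar> * C) ^ k / fact k" for n k
        using mult_left_mono[OF M.abs_moment_le[of n k], of "\<bar>t\<bar> ^ k / fact k"]
        by (simp add: norm_mult norm_divide norm_power power_mult_distrib)
      then show "\<forall>\<^sub>F (k, n) in at_top \<times>\<^sub>F sequentially. norm (?f (M n) k) \<le> (\<bar>t\<bar> * C) ^ k / fact k"
        by (intro always_eventually) auto
    qed (auto simp: sm)
    then show ?thesis
      using M.char_sums[THEN sums_unique] N.char_sums[THEN sums_unique] by simp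
  qed
  then show ?thesis
    by (intro levy_continuity M.real_distribution_axioms N.real_distribution_axioms)
qed

lemma compactly_supported_iff: "compactly_supported M \<longleftrightarrow> (\<exists>C. bounded_distribution M C)"
proof
  assume "compactly_supported M"
  then obtain S where S: "real_distribution M" "compact S" "measure M S = 1"
    by (auto simp: compactly_supported_def)
  interpret real_distribution M by fact
  obtain C where C: "C > 0" "\<And>x. x \<in> S \<Longrightarrow> \<bar>x\<bar> \<le> C"
    using compact_imp_bounded[OF S(2)] unfolding bounded_pos by auto
  have "AE t in M. t \<in> S"
    using S by (subst prob_eq_1[symmetric]) (auto simp: borel_compact)
  then have "AE t in M. \<bar>t\<bar> \<le> C"
    by eventually_elim (auto intro: C)
  then show "\<exists>C. bounded_distribution M C"
    using C(1) by (intro exI[of _ C]) (unfold_locales, auto)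
next
  assume "\<exists>C. bounded_distribution M C"
  then obtain C where "bounded_distribution M C" ..
  then interpret bounded_distribution M C .
  have "prob {-C..C} = 1"
    using AE_bounded by (subst prob_eq_1) (auto simp: abs_le_iff elim: eventually_mono)
  then show "compactly_supported M"
    by (auto simp: compactly_supported_def intro!: exI[of _ "{-C..C}"] real_distribution_axioms)
qed

section \<open>The Cauchy transform\<close>

lemma upper_half_plane_norm_ge: "Im z \<le> cmod (z - of_real t)"
  using abs_Im_le_cmod[of "z - of_real t"] by simp

context bounded_distribution
begin

text \<open>Integrate the geometric series of 1/(z - t) in t/z termwise; its ratio is at most C /
  |z| < 1 almost everywhere.\<close>

lemma cauchy_G_sums:
  fixes z :: complex
  assumes "norm z > C"
  shows "(\<lambda>k. moment M k / z ^ Suc k) sums cauchy_G M z"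
proof -
  let ?f = "\<lambda>k t. complex_of_real (t ^ k) / z ^ Suc k"
  have z: "z \<noteq> 0" and q: "C / norm z < 1" using assms C_pos by (auto simp: divide_less_eq)
  have int: "integrable M (?f k)" for k
    by (intro integrable_divide_zero integrable_of_real integrable_power)
  have geo: "summable (\<lambda>k. (C / norm z) ^ k * (1 / norm z))"
    using q C_pos by (intro summable_mult2 summable_geometric) auto
  have nrm: "norm (?f k t) \<le> (C / norm z) ^ k * (1 / norm z)" if "\<bar>t\<bar> \<le> C" for k t
    using that power_mono[OF that, of k]
    by (simp add: norm_divide norm_mult norm_power power_divide power_abs divide_right_mono mult.commute)
  have AE_nrm: "AE t in M. norm (?f k t) \<le> (C / norm z) ^ k * (1 / norm z)" for k
    using AE_bounded by eventually_elim (rule nrm)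
  have "(\<lambda>k. integral\<^sup>L M (?f k)) sums (\<integral>t. (\<Sum>k. ?f k t) \<partial>M)"
  proof (rule sums_integral[OF int])
    show "AE t in M. summable (\<lambda>k. norm (?f k t))"
      using AE_bounded
    proof eventually_elim
      case (elim t)
      show ?case
        by (rule summable_comparison_test[OF _ geo]) (use nrm[OF elim] in auto)
    qed
    have "(\<integral>t. norm (?f k t) \<partial>M) \<le> (C / norm z) ^ k * (1 / norm z)" for k
    proof -
      have "(\<integral>t. norm (?f k t) \<partial>M) \<le> (\<integral>t. (C / norm z) ^ k * (1 / norm z) \<partial>M)"
        by (intro integral_mono_AE integrable_norm int AE_nrm) auto
      then show ?thesis by (simp add: prob_UNIV)
    qed
    moreover have "0 \<le> (\<integral>t. norm (?f k t) \<partial>M)" for k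
      by (rule Bochner_Integration.integral_nonneg) (rule norm_ge_zero)
    ultimately show "summable (\<lambda>k. \<integral>t. norm (?f k t) \<partial>M)"
      by (intro summable_comparison_test'[OF geo]) (simp only: real_norm_def abs_of_nonneg)
  qed
  moreover have "integral\<^sup>L M (?f k) = moment M k / z ^ Suc k" for k
    by (simp del: of_real_power)
  moreover have "(\<integral>t. (\<Sum>k. ?f k t) \<partial>M) = cauchy_G M z"
    unfolding cauchy_G_def
  proof (rule integral_cong_AE)
    show "AE t in M. (\<Sum>k. ?f k t) = 1 / (z - of_real t)"
      using AE_bounded
    proof eventually_elim
      case (elim t)
      then have lt: "norm (of_real t / z) < 1"
        using assms z by (simp add: norm_divide)
      have zt: "z - of_real t \<noteq> 0" using elim assms by auto
      have "(\<lambda>k. (of_real t / z) ^ k * (1 / z)) sums (1 / (1 - of_real t / z) * (1 / z))"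
        by (intro sums_mult2 geometric_sums lt)
      also have "(\<lambda>k. (of_real t / z) ^ k * (1 / z)) = (\<lambda>k. ?f k t)"
        by (simp add: fun_eq_iff power_divide)
      also have "1 / (1 - of_real t / z) * (1 / z) = 1 / (z - of_real t)"
        using z zt by (simp add: field_simps)
      finally show ?case by (rule sums_unique[symmetric])
    qed
  qed (intro measurable_finite_borel; measurable)+
  ultimately show ?thesis by (simp only:)
qed

lemma integrable_cauchy_kernel:
  assumes "Im z > 0"
  shows "integrable M (\<lambda>t. 1 / (z - of_real t) ^ k)"
proof (rule integrable_const_bound[where B = "(1 / Im z) ^ k"])
  have "norm (1 / (z - of_real t) ^ k) \<le> (1 / Im z) ^ k" for t
  proof -
    have "1 / norm (z - of_real t) \<le> 1 / Im z"
      using assms by (intro frac_le upper_half_plane_norm_ge) auto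
    then have "(1 / norm (z - of_real t)) ^ k \<le> (1 / Im z) ^ k"
      by (intro power_mono) auto
    then show ?thesis by (simp only: norm_divide norm_power norm_one power_divide power_one)
  qed
  then show "AE t in M. norm (1 / (z - of_real t) ^ k) \<le> (1 / Im z) ^ k" by simp
  have "z - of_real t \<noteq> 0" for t using assms by (auto simp: complex_eq_iff)
  then show "(\<lambda>t. 1 / (z - of_real t) ^ k) \<in> borel_measurable M"
    by (intro measurable_finite_borel borel_measurable_continuous_onI continuous_intros) simp
qed

lemma Im_cauchy_G_neg:
  assumes "Im z > 0"
  shows "Im (cauchy_G M z) < 0"
proof -
  \<comment> \<open>Im (1/(z - t)) = - Im z / |z - t|^2 and |z - t| is at most |z| + C on the
    support. A bound uniform in t keeps the inequality strict after integration.\<close>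
  let ?c = "Im z / (norm z + C)\<^sup>2"
  have int: "integrable M (\<lambda>t. 1 / (z - of_real t))"
    using integrable_cauchy_kernel[OF assms, of 1] by simp
  have "AE t in M. Im (1 / (z - of_real t)) \<le> - ?c"
    using AE_bounded
  proof eventually_elim
    case (elim t)
    have "(norm (z - of_real t))\<^sup>2 \<le> (norm z + C)\<^sup>2"
      using norm_triangle_ineq4[of z "of_real t"] elim by (intro power_mono) auto
    moreover have "0 < (norm (z - of_real t))\<^sup>2"
      using assms upper_half_plane_norm_ge[of z t] by (intro zero_less_power) linarith
    ultimately have "?c \<le> Im z / (norm (z - of_real t))\<^sup>2"
      using assms by (intro frac_le) auto
    then show ?case by (simp add: Im_divide cmod_power2)
  qed
  then have "(\<integral>t. Im (1 / (z - of_real t)) \<partial>M) \<le> (\<integral>t. - ?c \<partial>M)"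
    using int by (intro integral_mono_AE) auto
  also have "(\<integral>t. Im (1 / (z - of_real t)) \<partial>M) = Im (cauchy_G M z)"
    unfolding cauchy_G_def using int by (rule integral_Im)
  also have "(\<integral>t. - ?c \<partial>M) = - ?c" by (simp add: prob_UNIV)
  also have "norm z + C > 0" using C_pos by (intro add_nonneg_pos) auto
  then have "- ?c < 0" using assms by simp
  finally show ?thesis .
qed

text \<open>This is what makes the composition \<open>K_trans \<mu> (recip_F \<nu> z)\<close>
  meaningful on the whole upper half-plane.\<close>

lemma Im_recip_F_pos: "Im z > 0 \<Longrightarrow> Im (recip_F M z) > 0"
  using Im_cauchy_G_neg[of z] unfolding recip_F_def Im_divide
  by (intro divide_pos_pos) (simp_all add: sum_power2_gt_zero_iff)

lemma cauchy_G_nonzero: "Im z > 0 \<Longrightarrow> cauchy_G M z \<noteq> 0"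
  using Im_cauchy_G_neg[of z] by auto

lemma cauchy_G_has_derivative:
  assumes z: "Im z > 0"
  shows "(cauchy_G M has_field_derivative - (\<integral>t. 1 / (z - of_real t)\<^sup>2 \<partial>M)) (at z)"
proof -
  let ?D = "- (\<integral>t. 1 / (z - of_real t)\<^sup>2 \<partial>M)"
  \<comment> \<open>With a = z - t the error of the difference quotient is h / (a^2 (a + h)). Here
    |a| is at least Im z and, for |h| < Im z / 2, |a + h| is at least Im z / 2.\<close>
  let ?B = "2 / Im z ^ 3"
  have bound: "norm ((cauchy_G M (z + h) - cauchy_G M z) / h - ?D) \<le> ?B * norm h"
    if h: "h \<noteq> 0" "norm h < Im z / 2" for h
  proof -
    have zh: "Im (z + h) > Im z / 2" using h abs_Im_le_cmod[of h] z by auto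
    then have zh0: "Im (z + h) > 0" using z by linarith
    have int: "integrable M (\<lambda>t. 1 / (z - of_real t))" "integrable M (\<lambda>t. 1 / (z - of_real t)\<^sup>2)"
      "integrable M (\<lambda>t. 1 / (z + h - of_real t))"
      using integrable_cauchy_kernel[OF z, of 1]
        integrable_cauchy_kernel[OF z, of 2] integrable_cauchy_kernel[OF zh0, of 1]
      by (simp_all only: power_one_right)
    have "(cauchy_G M (z + h) - cauchy_G M z) / h - ?D
        = (\<integral>t. (1 / (z + h - of_real t) - 1 / (z - of_real t)) / h + 1 / (z - of_real t)\<^sup>2 \<partial>M)"
      unfolding cauchy_G_def using int by simp
    also have "norm \<dots> \<le> (\<integral>t. ?B * norm h \<partial>M)"
    proof (rule Bochner_Integration.integral_norm_bound_integral)
      show "integrable M (\<lambda>t. (1 / (z + h - of_real t) - 1 / (z - of_real t)) / h + 1 / (z - of_real t)\<^sup>2)"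
        by (intro Bochner_Integration.integrable_add Bochner_Integration.integrable_diff
            integrable_divide_zero int)
      fix t
      let ?a = "z - of_real t"
      have a: "Im z \<le> norm ?a" and ah: "Im z / 2 \<le> norm (?a + h)"
        using upper_half_plane_norm_ge[of z t] upper_half_plane_norm_ge[of "z + h" t] zh
        unfolding diff_add_eq by linarith+
      have a0: "?a \<noteq> 0" and ah0: "?a + h \<noteq> 0" using a ah z by auto
      have "(1 / (z + h - of_real t) - 1 / ?a) / h + 1 / ?a\<^sup>2 = (1 / (?a + h) - 1 / ?a) / h + 1 / ?a\<^sup>2"
        by (simp add: algebra_simps)
      also have "\<dots> = h / (?a\<^sup>2 * (?a + h))"
      proof -
        have "1 / (?a + h) - 1 / ?a = - h / (?a * (?a + h))"
          using a0 ah0 by (simp add: divide_simps)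
        then have "(1 / (?a + h) - 1 / ?a) / h = - 1 / (?a * (?a + h))"
          using h(1) by simp
        moreover have "- 1 / (?a * (?a + h)) + 1 / ?a\<^sup>2 = h / (?a\<^sup>2 * (?a + h))"
          using a0 ah0 by (simp add: divide_simps power2_eq_square) (simp add: algebra_simps)?
        ultimately show ?thesis by simp
      qed
      also have "norm \<dots> \<le> norm h / ((Im z)\<^sup>2 * (Im z / 2))"
        unfolding norm_divide norm_mult norm_power
        using z a ah by (intro frac_le mult_mono power_mono) auto
      also have "\<dots> = ?B * norm h" by (simp add: power2_eq_square power3_eq_cube)
      finally show "norm ((1 / (z + h - of_real t) - 1 / ?a) / h + 1 / ?a\<^sup>2) \<le> ?B * norm h" .
    qed simp
    finally show ?thesis by (simp add: prob_UNIV)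
  qed
  have "((\<lambda>h. (cauchy_G M (z + h) - cauchy_G M z) / h - ?D) \<longlongrightarrow> 0) (at 0)"
  proof (rule Lim_null_comparison)
    show "\<forall>\<^sub>F h in at 0. norm ((cauchy_G M (z + h) - cauchy_G M z) / h - ?D) \<le> ?B * norm h"
      unfolding eventually_at using z bound by (intro exI[of _ "Im z / 2"]) auto
    show "((\<lambda>h. ?B * norm h) \<longlongrightarrow> 0) (at 0)"
      by (rule tendsto_eq_rhs[OF tendsto_mult[OF tendsto_const tendsto_norm[OF tendsto_ident_at]]]) simp
  qed
  then show ?thesis
    unfolding DERIV_def by (rule LIM_zero_cancel)
qed

lemma cauchy_G_holomorphic: "cauchy_G M holomorphic_on {z. Im z > 0}"
proof (intro holomorphic_onI, rule field_differentiable_at_within)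
  fix z assume "z \<in> {z. Im z > 0}"
  then show "cauchy_G M field_differentiable at z"
    unfolding field_differentiable_def using cauchy_G_has_derivative[of z] by blast
qed

lemma recip_F_holomorphic: "recip_F M holomorphic_on {z. Im z > 0}"
  unfolding recip_F_def by (intro holomorphic_intros cauchy_G_holomorphic) (auto dest: cauchy_G_nonzero)

lemma K_trans_holomorphic: "K_trans M holomorphic_on {z. Im z > 0}"
  unfolding K_trans_def by (intro holomorphic_intros recip_F_holomorphic)

end

text \<open>The identity theorem, in the form that extends relations proved by resolvents, hence
  only for large |z|, to all points where the convolutions are specified.\<close>

lemma holomorphic_eq_upper_half_plane:
  assumes "f holomorphic_on {z. Im z > 0}" "g holomorphic_on {z. Im z > 0}"
    and eq: "\<And>z. Im z > 0 \<Longrightarrow> norm z > D \<Longrightarrow> f z = g z" and "Im w > 0"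
  shows "f w = g w"
proof -
  define y where "y = Complex 0 (\<bar>D\<bar> + 1)"
  have "f w - g w = 0"
  proof (rule analytic_continuation[where S = "{z. Im z > 0}" and U = "{z. Im z > 0} \<inter> - cball 0 D" and f = "\<lambda>z. f z - g z"])
    show "(\<lambda>z. f z - g z) holomorphic_on {z. Im z > 0}"
      by (intro holomorphic_intros assms)
    show "open {z. Im z > 0}" by (simp add: open_halfspace_Im_gt)
    show "connected {z. Im z > 0}" by (simp add: convex_halfspace_Im_gt convex_connected)
    have op: "open ({z. Im z > 0} \<inter> - cball 0 D)"
      by (intro open_Int) (auto simp: open_halfspace_Im_gt)
    have y: "y \<in> {z. Im z > 0} \<inter> - cball 0 D"
      by (auto simp: y_def cmod_def)
    then show "y \<in> {z. Im z > 0}" by simp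
    show "y islimpt {z. Im z > 0} \<inter> - cball 0 D"
      using y by (intro interior_limit_point) (simp only: interior_open[OF op])
    fix z assume "z \<in> {z. Im z > 0} \<inter> - cball 0 D"
    then show "f z - g z = 0" using eq[of z] by auto
  qed (use \<open>Im w > 0\<close> in auto)
  then show ?thesis by simp
qed

section \<open>The R-transform\<close>

definition moment_fps :: "real measure \<Rightarrow> complex fps" where
  "moment_fps M = Abs_fps (\<lambda>k. of_real (moment M k))"

lemma filterlim_add_inverse_at_0:
  fixes R :: "complex \<Rightarrow> complex"
  assumes "isCont R 0"
  shows "filterlim (\<lambda>s. R s + 1 / s) at_infinity (at 0)"
proof -
  have "filterlim (\<lambda>s::complex. 1 / s) at_infinity (at 0)"
    using filterlim_inverse_at_infinity[where 'a = complex]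
    unfolding inverse_eq_divide[abs_def] .
  then show ?thesis
    using assms by (intro tendsto_add_filterlim_at_infinity) (auto simp: isCont_def)
qed

text \<open>The map s to 1/(R(s) + 1/s) is the inverse branch of s = G(1/t). Its limit is taken in
  the punctured filter, so that properties of G(1/t) valid for small nonzero t can be pulled back to
  s.\<close>

lemma filterlim_inverse_add_inverse_at_0:
  fixes R :: "complex \<Rightarrow> complex"
  assumes "isCont R 0"
  shows "filterlim (\<lambda>s. 1 / (R s + 1 / s)) (at 0) (at 0)"
  using filterlim_add_inverse_at_0[OF assms]
  unfolding inverse_eq_divide[symmetric] filterlim_inverse_at_iff .

context bounded_distribution
begin

lemma fps_conv_radius_moment_fps: "fps_conv_radius (moment_fps M) \<ge> ereal (1 / C)"
  unfolding fps_conv_radius_def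
proof (rule conv_radius_geI_ex')
  fix r :: real assume r: "0 < r" "ereal r < ereal (1 / C)"
  have "norm (fps_nth (moment_fps M) k * of_real r ^ k) \<le> (C * r) ^ k" for k
    using r mult_right_mono[OF abs_moment_le[of k], of "r ^ k"]
    by (simp add: moment_fps_def norm_mult norm_power power_mult_distrib)
  moreover have "summable (\<lambda>k. (C * r) ^ k)"
    using r C_pos by (intro summable_geometric) (simp add: field_simps)
  ultimately show "summable (\<lambda>k. fps_nth (moment_fps M) k * of_real r ^ k)"
    by (rule summable_comparison_test'[of "\<lambda>k. (C * r) ^ k" 0, rotated])
qed

lemma less_fps_conv_radius_moment_fps:
  assumes "norm t < 1 / C"
  shows "ereal (norm t) < fps_conv_radius (moment_fps M)"
  by (rule less_le_trans[OF _ fps_conv_radius_moment_fps]) (use assms in simp)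

lemma cauchy_G_inverse:
  assumes "t \<noteq> 0" "norm t < 1 / C"
  shows "cauchy_G M (1 / t) = t * eval_fps (moment_fps M) t"
proof -
  have "(\<lambda>k. t * (fps_nth (moment_fps M) k * t ^ k)) sums (t * eval_fps (moment_fps M) t)"
    by (intro sums_mult sums_eval_fps less_fps_conv_radius_moment_fps assms)
  moreover have "(\<lambda>k. moment M k / (1 / t) ^ Suc k) sums cauchy_G M (1 / t)"
    using assms C_pos by (intro cauchy_G_sums) (simp add: norm_divide field_simps)
  moreover have "(\<lambda>k. moment M k / (1 / t) ^ Suc k) = (\<lambda>k. t * (fps_nth (moment_fps M) k * t ^ k))"
    by (simp add: moment_fps_def fun_eq_iff power_divide field_simps)
  ultimately show ?thesis by (simp add: sums_unique2)
qed

lemma eventually_cauchy_G_inverse: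
  "\<forall>\<^sub>F t in at 0. cauchy_G M (1 / t) = t * eval_fps (moment_fps M) t"
  unfolding eventually_at using C_pos
  by (intro exI[of _ "1 / C"]) (auto intro!: cauchy_G_inverse)

text \<open>The derivative of t m(t) at 0 is m(0), the total mass 1. The radius stays below 1/C so
  that the series represents \<open>cauchy_G\<close> on the ball.\<close>

lemma cauchy_germ_locally_injective:
  obtains r where "r > 0" "r \<le> 1 / C"
    "inj_on (\<lambda>t. t * eval_fps (moment_fps M) t) (ball 0 r)"
    "(\<lambda>t. t * eval_fps (moment_fps M) t) holomorphic_on ball 0 r"
proof -
  let ?\<phi> = "\<lambda>t. t * eval_fps (moment_fps M) t"
  have sub: "ball (0::complex) (1 / C) \<subseteq> eball 0 (fps_conv_radius (moment_fps M))"
    by (auto simp: in_eball_iff intro: less_fps_conv_radius_moment_fps)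
  have hol: "eval_fps (moment_fps M) holomorphic_on ball 0 (1 / C)"
    by (intro holomorphic_on_eval_fps sub)
  have hol\<phi>: "?\<phi> holomorphic_on ball 0 (1 / C)"
    by (intro holomorphic_intros hol)
  have "(eval_fps (moment_fps M) has_field_derivative deriv (eval_fps (moment_fps M)) 0) (at 0)"
    using hol C_pos by (intro holomorphic_derivI[of _ "ball 0 (1 / C)"]) auto
  from DERIV_mult[OF DERIV_ident this] have "deriv ?\<phi> 0 = 1"
    by (intro DERIV_imp_deriv) (simp add: eval_fps_at_0 moment_fps_def prob_UNIV)
  then have nz: "deriv ?\<phi> 0 \<noteq> 0" by simp
  have "(0::complex) \<in> ball 0 (1 / C)" using C_pos by simp
  then obtain r where r: "r > 0" "ball 0 r \<subseteq> ball (0::complex) (1 / C)" "inj_on ?\<phi> (ball 0 r)"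
    by (rule has_complex_derivative_locally_injective[OF hol\<phi> _ open_ball nz])
  have "r \<le> 1 / C" using r(1,2) C_pos by (simp add: ball_subset_ball_iff)
  moreover have "?\<phi> holomorphic_on ball 0 r" using hol\<phi> r(2) by (rule holomorphic_on_subset)
  ultimately show thesis by (rule that[OF r(1) _ r(3)])
qed

lemma moment_fps_decompose: "moment_fps M = 1 + fps_X * fps_shift 1 (moment_fps M)"
  by (rule fps_ext) (auto simp: moment_fps_def prob_UNIV split: nat.splits)

text \<open>With \<open>\<phi>(t) = G(1/t) = t m(t)\<close> and \<open>m(t) = 1 + t n(t)\<close>, the R-transform is
  \<open>R = (n / m) \<circ> \<phi>\<^sup>-\<^sup>1\<close>.\<close>

lemma ex_R_transform: "\<exists>R. is_R_transform M R"
proof -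
  let ?m = "eval_fps (moment_fps M)" and ?n = "eval_fps (fps_shift 1 (moment_fps M))"
  let ?\<phi> = "\<lambda>t. t * ?m t"
  obtain r where r: "r > 0" "r \<le> 1 / C" "inj_on ?\<phi> (ball 0 r)" "?\<phi> holomorphic_on ball 0 r"
    by (rule cauchy_germ_locally_injective)
  obtain g where g: "g holomorphic_on (?\<phi> ` ball 0 r)" "\<And>t. t \<in> ball 0 r \<Longrightarrow> g (?\<phi> t) = t"
    using holomorphic_has_inverse[OF r(4) open_ball r(3)] by blast
  have rad: "norm t < fps_conv_radius (moment_fps M)" if "norm t < r" for t
    using that r(2) by (intro less_fps_conv_radius_moment_fps) simp
  have m: "?m t = 1 + t * ?n t" if "norm t < r" for t
    using rad[OF that] by (subst moment_fps_decompose) (simp add: eval_fps_add eval_fps_mult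
      fps_conv_radius_mult order.strict_trans2[OF _ fps_conv_radius_mult])
  have opn: "open (?\<phi> ` ball 0 r)"
    by (rule open_mapping_thm3[OF r(4) open_ball r(3)])
  have zero: "0 \<in> ?\<phi> ` ball 0 r"
    using r(1) by (intro image_eqI[of _ _ 0]) auto
  have gr: "norm (g s) < r" "g s * ?m (g s) = s" if "s \<in> ?\<phi> ` ball 0 r" for s
    using that g(2) by auto
  have sub: "ball (0::complex) r \<subseteq> eball 0 (fps_conv_radius (moment_fps M))"
    by (auto simp: in_eball_iff intro: rad)
  \<comment> \<open>At s = 0 the value is m(0) = 1; elsewhere m(g(s)) is a factor of s.\<close>
  have mg: "?m (g s) \<noteq> 0" if "s \<in> ?\<phi> ` ball 0 r" for s
  proof (cases "s = 0")
    case True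
    then have "g s = 0" using g(2)[of 0] r(1) by simp
    then show ?thesis by (simp add: eval_fps_at_0 moment_fps_def prob_UNIV)
  qed (use gr(2)[OF that] in auto)
  define R where "R s = ?n (g s) / ?m (g s)" for s
  have comp: "(\<lambda>s. eval_fps F (g s)) holomorphic_on (?\<phi> ` ball 0 r)"
    if "fps_conv_radius F = fps_conv_radius (moment_fps M)" for F
  proof -
    have "g ` ?\<phi> ` ball 0 r \<subseteq> ball 0 r"
      using gr(1) by (simp add: image_subset_iff)
    from holomorphic_on_compose_gen[OF g(1) holomorphic_on_eval_fps this, of F] sub that
    show ?thesis unfolding o_def by (simp only:)
  qed
  have "R holomorphic_on (?\<phi> ` ball 0 r)"
    unfolding R_def using mg by (intro holomorphic_intros comp) auto
  then have "R analytic_on {0}"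
    using opn zero by (auto simp: analytic_at)
  moreover have "\<forall>\<^sub>F s in at 0. cauchy_G M (R s + 1 / s) = s"
    using eventually_at_in_open[OF opn zero]
  proof eventually_elim
    case (elim s)
    then have s: "s \<in> ?\<phi> ` ball 0 r" "s \<noteq> 0" by auto
    let ?t = "g s"
    have t: "?t \<noteq> 0" "norm ?t < r" "s = ?t * ?m ?t" using gr[OF s(1)] s(2) by auto
    \<comment> \<open>The choice of R is explained by this computation: R(s) + 1/s has to be 1/t for
      the t with s = t m(t), and 1 + t n(t) = m(t).\<close>
    have "R s + 1 / s = ?n ?t / ?m ?t + 1 / (?t * ?m ?t)"
      using t(3) by (simp add: R_def)
    also have "\<dots> = (1 + ?t * ?n ?t) / (?t * ?m ?t)"
      using t(1) mg[OF s(1)] by (simp add: field_simps)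
    also have "\<dots> = 1 / ?t"
      using m[OF t(2)] mg[OF s(1)] by simp
    finally show ?case
      using cauchy_G_inverse[OF t(1)] t r(2) by simp
  qed
  ultimately show ?thesis by (auto simp: is_R_transform_def)
qed

text \<open>For either representative, 1/(R(s) + 1/s) eventually lies in the ball where t m(t) is
  injective and is mapped to s there.\<close>

lemma R_transform_unique:
  assumes "is_R_transform M R" "is_R_transform M R'"
  shows "\<forall>\<^sub>F s in at 0. R s = R' s"
proof -
  let ?\<phi> = "\<lambda>t. t * eval_fps (moment_fps M) t"
  obtain r where r: "r > 0" "r \<le> 1 / C" "inj_on ?\<phi> (ball 0 r)"
    by (rule cauchy_germ_locally_injective)
  have *: "\<forall>\<^sub>F s in at 0. 1 / (R s + 1 / s) \<in> ball 0 r \<and> ?\<phi> (1 / (R s + 1 / s)) = s"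
    if "is_R_transform M R" for R
  proof -
    have lim: "filterlim (\<lambda>s. 1 / (R s + 1 / s)) (at 0) (at 0)"
      using that unfolding is_R_transform_def
      by (intro filterlim_inverse_add_inverse_at_0) (auto intro: analytic_at_imp_isCont)
    have "\<forall>\<^sub>F t in at 0. t \<in> ball 0 r \<and> cauchy_G M (1 / t) = ?\<phi> t"
      using r(1) eventually_cauchy_G_inverse
      by (intro eventually_conj eventually_at_in_open') auto
    from eventually_compose_filterlim[OF this lim] show ?thesis
      using that unfolding is_R_transform_def by (auto elim: eventually_elim2)
  qed
  have "\<forall>\<^sub>F s in at (0::complex). s \<noteq> 0" by (simp add: eventually_at_filter)
  then show ?thesis
    using *[OF assms(1)] *[OF assms(2)]
  proof eventually_elim
    case (elim s)
    then have "1 / (R s + 1 / s) = 1 / (R' s + 1 / s)"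
      using inj_onD[OF r(3)] by metis
    then show ?case by simp
  qed
qed

end

section \<open>Uniqueness of the convolutions\<close>

text \<open>Agreement at points accumulating at t = 0 is enough for the identity theorem, and then
  the moments agree. The weak hypothesis fits both applications: points on a curve through the upper
  half-plane, and points parametrised by an R-transform.\<close>

lemma bounded_distribution_eqI:
  assumes "bounded_distribution M C" "bounded_distribution N D"
    and freq: "\<exists>\<^sub>F t in at 0. cauchy_G M (1 / t) = cauchy_G N (1 / t)"
  shows "M = N"
proof -
  interpret M: bounded_distribution M C by fact
  interpret N: bounded_distribution N D by fact
  define r where "r = min (1 / C) (1 / D)"
  have r: "r > 0" using M.C_pos N.C_pos by (simp add: r_def)
  have rad: "ereal (norm t) < fps_conv_radius (moment_fps M)" "ereal (norm t) < fps_conv_radius (moment_fps N)"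
    if "norm t < r" for t
    using that by (auto simp: r_def intro: M.less_fps_conv_radius_moment_fps N.less_fps_conv_radius_moment_fps)
  let ?U = "{t \<in> ball 0 r. eval_fps (moment_fps M) t = eval_fps (moment_fps N) t}"
  have "\<forall>\<^sub>F t in at (0::complex). t \<noteq> 0 \<and> t \<in> ball 0 r"
    using r eventually_at_in_open[of "ball 0 r" "0::complex"] by (auto elim: eventually_mono)
  then have ev: "\<forall>\<^sub>F t in at 0. cauchy_G M (1 / t) = cauchy_G N (1 / t) \<longrightarrow> t \<in> ?U"
    using M.eventually_cauchy_G_inverse N.eventually_cauchy_G_inverse
    by eventually_elim auto
  have "0 islimpt ?U"
    unfolding islimpt_conv_frequently_at using frequently_mp[OF ev freq] .
  have "eval_fps (moment_fps M) t - eval_fps (moment_fps N) t = 0" if "t \<in> ball 0 r" for t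
  proof (rule analytic_continuation[where S = "ball 0 r" and U = ?U and \<xi> = 0
        and f = "\<lambda>t. eval_fps (moment_fps M) t - eval_fps (moment_fps N) t"])
    show "(\<lambda>t. eval_fps (moment_fps M) t - eval_fps (moment_fps N) t) holomorphic_on ball 0 r"
      by (intro holomorphic_intros) (auto simp: in_eball_iff intro: rad)
  qed (use \<open>0 islimpt ?U\<close> r that in auto)
  then have "\<forall>\<^sub>F t in nhds 0. eval_fps (moment_fps M) t = eval_fps (moment_fps N) t"
    using eventually_nhds_in_open[of "ball 0 r" "0::complex"] r by (auto elim: eventually_mono)
  then have "moment_fps M = moment_fps N"
    using rad[of 0] r by (intro eval_fps_eqD) (simp_all add: zero_ereal_def)
  then show ?thesis
    by (intro moments_eq_imp_eq[OF assms(1,2)]) (simp add: moment_fps_def fps_eq_iff)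
qed

text \<open>Both Cauchy transforms take the value s at the same point R(s) + 1/s, whose reciprocal
  tends to 0 without vanishing; eventual disagreement near 0 would therefore contradict itself after
  substitution.\<close>

lemma R_transform_determines_distribution:
  assumes "bounded_distribution M C" "bounded_distribution N D"
    and "is_R_transform M R" "is_R_transform N R'" "\<forall>\<^sub>F s in at 0. R s = R' s"
  shows "M = N"
proof (rule bounded_distribution_eqI[OF assms(1,2)])
  have lim: "filterlim (\<lambda>s. 1 / (R s + 1 / s)) (at 0) (at 0)"
    using assms(3) unfolding is_R_transform_def
    by (intro filterlim_inverse_add_inverse_at_0) (auto intro: analytic_at_imp_isCont)
  have "\<forall>\<^sub>F s in at 0. cauchy_G M (R s + 1 / s) = s" "\<forall>\<^sub>F s in at 0. cauchy_G N (R' s + 1 / s) = s"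
    using assms(3,4) by (auto simp: is_R_transform_def)
  with assms(5) have ev: "\<forall>\<^sub>F s in at 0. cauchy_G M (R s + 1 / s) = cauchy_G N (R s + 1 / s)"
    by eventually_elim auto
  show "\<exists>\<^sub>F t in at 0. cauchy_G M (1 / t) = cauchy_G N (1 / t)"
    unfolding frequently_def
  proof
    assume "\<forall>\<^sub>F t in at 0. cauchy_G M (1 / t) \<noteq> cauchy_G N (1 / t)"
    from eventually_compose_filterlim[OF this lim] ev have "\<forall>\<^sub>F s in at (0::complex). False"
      by eventually_elim simp
    then show False by simp
  qed
qed

lemma K_trans_determines_distribution:
  assumes "bounded_distribution M C" "bounded_distribution N D"
    and eq: "\<And>z. Im z > 0 \<Longrightarrow> K_trans M z = K_trans N z"
  shows "M = N"
proof (rule bounded_distribution_eqI[OF assms(1,2)])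
  interpret M: bounded_distribution M C by fact
  interpret N: bounded_distribution N D by fact
  have G: "cauchy_G M z = cauchy_G N z" if "Im z > 0" for z
    using eq[OF that] by (simp add: K_trans_def recip_F_def)
  show "\<exists>\<^sub>F t in at 0. cauchy_G M (1 / t) = cauchy_G N (1 / t)"
    unfolding frequently_def
  proof
    assume "\<forall>\<^sub>F t in at 0. cauchy_G M (1 / t) \<noteq> cauchy_G N (1 / t)"
    then obtain d where d: "d > 0" "\<And>t. t \<noteq> 0 \<Longrightarrow> dist t 0 < d \<Longrightarrow> cauchy_G M (1 / t) \<noteq> cauchy_G N (1 / t)"
      by (auto simp: eventually_at)
    \<comment> \<open>Its reciprocal is 2i/d, a point of the upper half-plane.\<close>
    let ?t = "Complex 0 (- d / 2)"
    have "cauchy_G M (1 / ?t) \<noteq> cauchy_G N (1 / ?t)"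
      using d(1) by (intro d(2)) (auto simp: complex_eq_iff cmod_def)
    moreover have "Im (1 / ?t) > 0"
      using d(1) by (simp add: Im_divide field_simps power2_eq_square)
    ultimately show False using G by blast
  qed
qed

lemma boolean_conv_eqI:
  assumes "bounded_distribution \<rho> D"
    and "\<And>z. Im z > 0 \<Longrightarrow> K_trans \<rho> z = K_trans \<mu> z + K_trans \<nu> z"
  shows "boolean_conv \<mu> \<nu> = \<rho>"
  unfolding boolean_conv_def
proof (rule the_equality)
  fix \<rho>' assume "compactly_supported \<rho>' \<and> (\<forall>z. Im z > 0 \<longrightarrow> K_trans \<rho>' z = K_trans \<mu> z + K_trans \<nu> z)"
  then show "\<rho>' = \<rho>"
    using assms by (auto simp: compactly_supported_iff intro: K_trans_determines_distribution)
qed (use assms in \<open>auto simp: compactly_supported_iff\<close>)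

lemma orth_conv_eqI:
  assumes "bounded_distribution \<rho> D"
    and "\<And>z. Im z > 0 \<Longrightarrow> K_trans \<rho> z = K_trans \<mu> (recip_F \<nu> z)"
  shows "orth_conv \<mu> \<nu> = \<rho>"
  unfolding orth_conv_def
proof (rule the_equality)
  fix \<rho>' assume "compactly_supported \<rho>' \<and> (\<forall>z. Im z > 0 \<longrightarrow> K_trans \<rho>' z = K_trans \<mu> (recip_F \<nu> z))"
  then show "\<rho>' = \<rho>"
    using assms by (auto simp: compactly_supported_iff intro: K_trans_determines_distribution)
qed (use assms in \<open>auto simp: compactly_supported_iff\<close>)

text \<open>A competitor in the definite description may come with other representatives of the
  R-transforms of the factors; these agree with the given ones near 0, which suffices.\<close>

lemma free_conv_eqI:
  assumes \<mu>: "bounded_distribution \<mu> C" "is_R_transform \<mu> R1"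
    and \<nu>: "bounded_distribution \<nu> D" "is_R_transform \<nu> R2"
    and \<rho>: "bounded_distribution \<rho> E" "is_R_transform \<rho> (\<lambda>s. R1 s + R2 s)"
  shows "free_conv \<mu> \<nu> = \<rho>"
  unfolding free_conv_def
proof (rule the_equality)
  fix \<rho>' assume "compactly_supported \<rho>' \<and> (\<exists>R\<^sub>1 R\<^sub>2. is_R_transform \<mu> R\<^sub>1 \<and> is_R_transform \<nu> R\<^sub>2 \<and>
        is_R_transform \<rho>' (\<lambda>z. R\<^sub>1 z + R\<^sub>2 z))"
  then obtain E' R1' R2' where \<rho>': "bounded_distribution \<rho>' E'" "is_R_transform \<rho>' (\<lambda>s. R1' s + R2' s)"
    and R': "is_R_transform \<mu> R1'" "is_R_transform \<nu> R2'"
    by (auto simp: compactly_supported_iff)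
  have "\<forall>\<^sub>F s in at 0. R1' s + R2' s = R1 s + R2 s"
    using bounded_distribution.R_transform_unique[OF \<mu>(1) R'(1) \<mu>(2)]
      bounded_distribution.R_transform_unique[OF \<nu>(1) R'(2) \<nu>(2)]
    by eventually_elim simp
  then show "\<rho>' = \<rho>"
    by (rule R_transform_determines_distribution[OF \<rho>'(1) \<rho>(1) \<rho>'(2) \<rho>(2)])
qed (use assms in \<open>auto simp: compactly_supported_iff\<close>)

section \<open>The Hausdorff moment problem\<close>

text \<open>The factorial moments of the binomial distribution: C(n,j) C(j,k) = C(n,k) C(n-k,j-k),
  and the remaining sum is a power of x + (1 - x). It is stated over a ring because x will be the
  polynomial variable.\<close>

lemma sum_bernstein_binomial:
  fixes x :: "'a :: comm_ring_1"
  assumes "k \<le> n"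
  shows "(\<Sum>j\<le>n. of_nat ((n choose j) * (j choose k)) * (x ^ j * (1 - x) ^ (n - j))) = of_nat (n choose k) * x ^ k"
proof -
  have "(\<Sum>j\<le>n. of_nat ((n choose j) * (j choose k)) * (x ^ j * (1 - x) ^ (n - j)))
      = (\<Sum>j=k..n. of_nat ((n choose j) * (j choose k)) * (x ^ j * (1 - x) ^ (n - j)))"
    by (rule sum.mono_neutral_right) (auto simp: binomial_eq_0 not_le)
  also have "\<dots> = (\<Sum>i\<le>n - k. of_nat (n choose k) * x ^ k * (of_nat (n - k choose i) * x ^ i * (1 - x) ^ (n - k - i)))"
    unfolding sum.atLeastAtMost_shift_0[OF assms] atMost_atLeast0
  proof (rule sum.cong[OF refl])
    fix i assume "i \<in> {0..n - k}"
    then have "(n choose (k + i)) * (k + i choose k) = (n choose k) * (n - k choose i)"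
      using choose_mult[of k "k + i" n] assms by simp
    then show "((\<lambda>j. of_nat ((n choose j) * (j choose k)) * (x ^ j * (1 - x) ^ (n - j))) \<circ> (+) k) i
        = of_nat (n choose k) * x ^ k * (of_nat (n - k choose i) * x ^ i * (1 - x) ^ (n - k - i))"
      by (simp add: power_add algebra_simps del: of_nat_mult) (simp add: algebra_simps)?
  qed
  also have "\<dots> = of_nat (n choose k) * x ^ k * (x + (1 - x)) ^ (n - k)"
    unfolding binomial_ring[of x "1 - x"] by (simp add: sum_distrib_left)
  finally show ?thesis by simp
qed

text \<open>Compares ordinary with factorial moments. The ratio is the product of (j - i)/(n - i)
  over i < k, and products of factors of modulus at most 1 differ by at most the sum of the factor
  differences.\<close>

lemma power_minus_binomial_ratio_le:
  assumes "j \<le> n" "2 * k \<le> n" "k < n"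
  shows "\<bar>(real j / real n) ^ k - real (j choose k) / real (n choose k)\<bar> \<le> real k * (real k / (real n - real k))"
proof -
  have "real (j choose k) / real (n choose k) = (\<Prod>i<k. (real j - real i) / (real n - real i))"
    by (simp add: binomial_gbinomial gbinomial_prod_rev prod_dividef lessThan_atLeast0)
  then have "\<bar>(real j / real n) ^ k - real (j choose k) / real (n choose k)\<bar>
      = norm ((\<Prod>i<k. real j / real n) - (\<Prod>i<k. (real j - real i) / (real n - real i)))"
    by simp
  also have "\<dots> \<le> (\<Sum>i<k. norm (real j / real n - (real j - real i) / (real n - real i)))"
  proof (rule norm_prod_diff)
    fix i assume "i \<in> {..<k}"
    \<comment> \<open>For j < i the numerator is negative; \<open>2 * k \<le> n\<close> keeps its
      modulus below n - i even then.\<close>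
    then have "2 * real i \<le> real n" "real i < real n" using assms by auto
    moreover have "0 \<le> real j" "real j \<le> real n" using assms by auto
    ultimately have "\<bar>real j - real i\<bar> \<le> \<bar>real n - real i\<bar>" by linarith
    then show "norm ((real j - real i) / (real n - real i)) \<le> 1"
      using \<open>real i < real n\<close> by simp
  qed (use assms in auto)
  also have "\<dots> \<le> (\<Sum>i<k. real k / (real n - real k))"
  proof (rule sum_mono)
    fix i assume "i \<in> {..<k}"
    then have i: "real i \<le> real k" "real i < real n" using assms by auto
    have n: "real n > 0" "real n - real k > 0" "real j \<le> real n" using assms by auto
    have "real j / real n - (real j - real i) / (real n - real i)
        = (real i / (real n - real i)) * ((real n - real j) / real n)"
      using i n by (simp add: field_simps)
    also have "norm \<dots> \<le> (real k / (real n - real k)) * 1"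
      unfolding norm_mult using i n by (intro mult_mono) (auto intro!: frac_le)
    finally show "norm (real j / real n - (real j - real i) / (real n - real i)) \<le> real k / (real n - real k)"
      by simp
  qed
  finally show ?thesis by simp
qed

text \<open>Positivity of \<open>L\<close> on X^j (1 - X)^l turns the Bernstein basis into
  probability weights at the points j/n. A weak limit of these discrete distributions is the measure
  sought.\<close>

theorem hausdorff_moment_problem:
  fixes L :: "real poly \<Rightarrow> real"
  assumes L_add: "\<And>p q. L (p + q) = L p + L q"
    and L_smult: "\<And>c p. L (smult c p) = c * L p"
    and L_1: "L 1 = 1"
    and L_nonneg: "\<And>j l. 0 \<le> L ([:0, 1:] ^ j * [:1, - 1:] ^ l)"
  obtains M where "real_distribution M" "AE t in M. 0 \<le> t \<and> t \<le> 1"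
    "\<And>k. moment M k = L ([:0, 1:] ^ k)"
proof -
  let ?X = "[:0, 1:] :: real poly"
  have L_0: "L 0 = 0" using L_smult[of 0 0] by simp
  have L_sum: "L (sum f A) = (\<Sum>i\<in>A. L (f i))" for f :: "nat \<Rightarrow> real poly" and A
    by (induction A rule: infinite_finite_induct) (auto simp: L_0 L_add)
  have L_of_nat: "L (of_nat m * p) = real m * L p" for m p
    using L_smult[of "real m" p] by (simp add: of_nat_poly)
  \<comment> \<open>Bernstein weights of degree n, extended by 0 to a mass function on all naturals.
    Applied to the identity above, \<open>L\<close> shows that their total is
    \<open>L 1\<close>.\<close>
  define w where "w n j = (if j \<le> n then real (n choose j) * L (?X ^ j * (1 - ?X) ^ (n - j)) else 0)" for n j
  have one_minus: "1 - ?X = [:1, - 1:]" by (simp add: one_pCons)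
  have w_nonneg: "w n j \<ge> 0" for n j
    using L_nonneg[of j "n - j"] unfolding w_def one_minus by simp
  have w_binomial: "(\<Sum>j\<le>n. w n j * real (j choose k)) = real (n choose k) * L (?X ^ k)" if "k \<le> n" for n k
  proof -
    have "(\<Sum>j\<le>n. w n j * real (j choose k)) = L (\<Sum>j\<le>n. of_nat ((n choose j) * (j choose k)) * (?X ^ j * (1 - ?X) ^ (n - j)))"
      unfolding L_sum L_of_nat by (intro sum.cong) (auto simp: w_def)
    also have "\<dots> = real (n choose k) * L (?X ^ k)"
      unfolding sum_bernstein_binomial[OF that] L_of_nat ..
    finally show ?thesis .
  qed
  have w_sum: "(\<Sum>j\<le>n. w n j) = 1" for n
    using w_binomial[of 0 n] by (simp add: L_1)
  define p where "p n = embed_pmf (w n)" for n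
  have pmf_p: "pmf (p n) j = w n j" for n j
    unfolding p_def
  proof (rule pmf_embed_pmf[OF w_nonneg])
    have "(\<integral>\<^sup>+j. ennreal (w n j) \<partial>count_space UNIV) = (\<Sum>j\<le>n. ennreal (w n j))"
      by (rule nn_integral_count_space'[of "{..n}"]) (auto simp: w_def)
    then show "(\<integral>\<^sup>+j. ennreal (w n j) \<partial>count_space UNIV) = 1"
      by (simp add: sum_ennreal w_nonneg w_sum)
  qed
  \<comment> \<open>For n = 0 the only atom is 0/0 = 0, so every \<open>D n\<close> lives on
    [0, 1].\<close>
  define D where "D n = distr (measure_pmf (p n)) borel (\<lambda>j. real j / real n)" for n
  have D_dist: "real_distribution (D n)" for n
    unfolding D_def by (intro prob_space.real_distribution_distr measure_pmf.prob_space_axioms) auto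
  have D_int: "(\<integral>t. f t \<partial>D n) = (\<Sum>j\<le>n. f (real j / real n) * w n j)"
    if [measurable]: "f \<in> borel_measurable borel" for f :: "real \<Rightarrow> real" and n
  proof -
    have "(\<integral>t. f t \<partial>D n) = (\<integral>j. f (real j / real n) \<partial>measure_pmf (p n))"
      unfolding D_def by (subst integral_distr) auto
    also have "\<dots> = (\<Sum>j\<le>n. f (real j / real n) * pmf (p n) j)"
      by (rule integral_measure_pmf_real) (auto simp: set_pmf_iff pmf_p w_def split: if_splits)
    finally show ?thesis by (simp only: pmf_p)
  qed
  \<comment> \<open>\<open>tight\<close> speaks of intervals open on the left, so the left end must
    lie strictly below the possible atom at 0.\<close>
  have D_meas: "measure (D n) {- 1<..1} = 1" for n
  proof -
    interpret real_distribution "D n" by fact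
    have "prob {- 1<..1} = (\<integral>t. indicator {- 1<..1} t \<partial>D n)" by simp
    also have "\<dots> = (\<Sum>j\<le>n. w n j)"
      by (subst D_int) (auto intro!: sum.cong simp: indicator_def divide_le_eq_1 intro: less_le_trans[of _ 0])
    finally show ?thesis by (simp add: w_sum)
  qed
  have "tight D"
    unfolding tight_def
  proof (intro conjI allI impI)
    fix \<epsilon> :: real assume "\<epsilon> > 0"
    then show "\<exists>a b. a < b \<and> (\<forall>n. measure (D n) {a<..b} > 1 - \<epsilon>)"
      by (rule_tac x = "- 1" in exI, rule_tac x = 1 in exI) (simp add: D_meas)
  qed (rule D_dist)
  from tight_imp_convergent_subsubsequence[OF this strict_mono_id] obtain r M
    where r: "strict_mono r" and M: "real_distribution M" and "weak_conv_m (D \<circ> id \<circ> r) M"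
    by auto
  then have conv: "weak_conv_m (\<lambda>n. D (r n)) M" by (simp add: o_def)
  interpret M: real_distribution M by fact
  \<comment> \<open>Clamping to [0, 1] makes the powers bounded continuous test functions without
    changing them on the atoms.\<close>
  define c where "c t = max 0 (min 1 t)" for t :: real
  have c_meas [measurable]: "c \<in> borel_measurable borel" unfolding c_def[abs_def] by measurable
  have c_cont: "isCont c t" for t unfolding c_def[abs_def] by (intro continuous_intros)
  have c_id: "c (real j / real n) = real j / real n" if "j \<le> n" for j n
  proof -
    have "real j / real n \<le> 1" using that by (cases "n = 0") auto
    then show ?thesis by (simp add: c_def)
  qed
  have lim: "(\<lambda>n. \<integral>t. f t \<partial>D (r n)) \<longlonglongrightarrow> (\<integral>t. f t \<partial>M)"
    if "\<And>t. isCont f t" "\<And>t. norm (f t) \<le> 1" for f :: "real \<Rightarrow> real"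
    using that by (intro weak_conv_imp_integral_bdd_continuous_conv[OF D_dist M conv])
  \<comment> \<open>The truncated distance from [0, 1] is an admissible test function that vanishes
    at every atom, so the limit measure is carried by [0, 1].\<close>
  have "(\<integral>t. min 1 \<bar>t - c t\<bar> \<partial>M) = 0"
  proof (rule LIMSEQ_unique)
    show "(\<lambda>n. \<integral>t. min 1 \<bar>t - c t\<bar> \<partial>D (r n)) \<longlonglongrightarrow> (\<integral>t. min 1 \<bar>t - c t\<bar> \<partial>M)"
      by (intro lim continuous_intros c_cont) auto
    have "(\<integral>t. min 1 \<bar>t - c t\<bar> \<partial>D (r n)) = 0" for n
      by (subst D_int) (auto intro!: sum.neutral simp: c_id)
    then show "(\<lambda>n. \<integral>t. min 1 \<bar>t - c t\<bar> \<partial>D (r n)) \<longlonglongrightarrow> 0" by simp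
  qed
  moreover have "integrable M (\<lambda>t. min 1 \<bar>t - c t\<bar>)"
    by (rule M.integrable_const_bound[where B = 1]) auto
  ultimately have "AE t in M. min 1 \<bar>t - c t\<bar> = 0"
    by (subst (asm) integral_nonneg_eq_0_iff_AE) auto
  then have AE_c: "AE t in M. c t = t"
    by eventually_elim (auto simp: min_def split: if_splits)
  have c_bounds: "0 \<le> c t" "c t \<le> 1" for t by (auto simp: c_def)
  have mom: "moment M k = L (?X ^ k)" for k
  proof -
    let ?e = "\<lambda>n. real k * (real k / (real (r n) - real k))"
    have "moment M k = (\<integral>t. c t ^ k \<partial>M)"
      using AE_c by (intro integral_cong_AE) (auto elim: eventually_mono)
    have "(\<lambda>n. (\<integral>t. c t ^ k \<partial>D (r n)) - L (?X ^ k)) \<longlonglongrightarrow> 0"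
    proof (rule Lim_null_comparison)
      have "norm ((\<integral>t. c t ^ k \<partial>D n) - L (?X ^ k)) \<le> real k * (real k / (real n - real k))"
        if n: "2 * k < n" for n
      proof -
        \<comment> \<open>The discrete distributions reproduce \<open>L\<close> exactly on the
          normalised binomials C(j,k)/C(n,k); the only error comes from replacing these by
          (j/n)^k.\<close>
        have "L (?X ^ k) = (\<Sum>j\<le>n. w n j * (real (j choose k) / real (n choose k)))"
          using w_binomial[of k n] n by (simp add: sum_divide_distrib[symmetric] field_simps)
        moreover have "(\<integral>t. c t ^ k \<partial>D n) = (\<Sum>j\<le>n. w n j * (real j / real n) ^ k)"
          by (subst D_int) (auto intro!: sum.cong simp: c_id)
        ultimately have "norm ((\<integral>t. c t ^ k \<partial>D n) - L (?X ^ k))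
            = norm (\<Sum>j\<le>n. w n j * ((real j / real n) ^ k - real (j choose k) / real (n choose k)))"
          by (simp add: sum_subtractf right_diff_distrib)
        also have "\<dots> \<le> (\<Sum>j\<le>n. w n j * (real k * (real k / (real n - real k))))"
        proof (rule sum_norm_le)
          fix j assume "j \<in> {..n}"
          then have "\<bar>(real j / real n) ^ k - real (j choose k) / real (n choose k)\<bar>
              \<le> real k * (real k / (real n - real k))"
            using n by (intro power_minus_binomial_ratio_le) auto
          then show "norm (w n j * ((real j / real n) ^ k - real (j choose k) / real (n choose k)))
              \<le> w n j * (real k * (real k / (real n - real k)))"
            unfolding real_norm_def abs_mult abs_of_nonneg[OF w_nonneg] by (rule mult_left_mono[OF _ w_nonneg])
        qed
        also have "\<dots> = real k * (real k / (real n - real k))"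
          unfolding sum_distrib_right[symmetric] w_sum by simp
        finally show ?thesis .
      qed
      moreover have "\<forall>\<^sub>F n in sequentially. 2 * k < r n"
        by (rule eventually_compose_filterlim[OF eventually_gt_at_top filterlim_subseq[OF r]])
      ultimately show "\<forall>\<^sub>F n in sequentially. norm ((\<integral>t. c t ^ k \<partial>D (r n)) - L (?X ^ k)) \<le> ?e n"
        by (auto elim: eventually_mono)
      have "filterlim (\<lambda>n. - real k + real (r n)) at_top sequentially"
        by (intro filterlim_tendsto_add_at_top[OF tendsto_const]
            filterlim_compose[OF filterlim_real_sequentially filterlim_subseq[OF r]])
      then have "(\<lambda>n. real k * (real k / (- real k + real (r n)))) \<longlonglongrightarrow> real k * 0"
        by (intro tendsto_mult tendsto_const tendsto_divide_0[OF tendsto_const] filterlim_at_top_imp_at_infinity)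
      then show "?e \<longlonglongrightarrow> 0" by simp
    qed
    then have "(\<lambda>n. \<integral>t. c t ^ k \<partial>D (r n)) \<longlonglongrightarrow> L (?X ^ k)" by (rule LIM_zero_cancel)
    moreover have "(\<lambda>n. \<integral>t. c t ^ k \<partial>D (r n)) \<longlonglongrightarrow> (\<integral>t. c t ^ k \<partial>M)"
      using c_bounds by (intro lim continuous_intros c_cont) (auto simp: power_le_one)
    ultimately show ?thesis
      using \<open>moment M k = _\<close> LIMSEQ_unique by simp
  qed
  have "AE t in M. 0 \<le> t \<and> t \<le> 1"
    using AE_c by eventually_elim (metis c_bounds)
  from that[OF M this mom] show thesis .
qed

section \<open>Spectral distributions of graphs of bounded degree\<close>

text \<open>The bound \<open>d\<close> serves as norm bound of the adjacency operator and as support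
  bound of the spectral distribution; positivity is demanded because
  \<open>bounded_distribution\<close> needs a positive radius and the passage to [0, 1] divides by
  2d.\<close>

locale bounded_degree_graph =
  fixes G :: "'a rgraph" and d :: nat
  assumes base_in_verts: "base G \<in> verts G"
    and edgeD: "{x, y} \<in> edges G \<Longrightarrow> x \<in> verts G \<and> y \<in> verts G \<and> x \<noteq> y"
    and degree: "x \<in> verts G \<Longrightarrow> finite (nbrs G x) \<and> card (nbrs G x) \<le> d"
    and degree_pos: "d > 0"

text \<open>The value at x counts the walks of length k between the root and x.\<close>

abbreviation root_walks :: "'a rgraph \<Rightarrow> nat \<Rightarrow> 'a \<Rightarrow> real" where
  "root_walks G k \<equiv> (adj_op G ^^ k) (delta (base G))"

lemma in_nbrs_sym: "x \<in> nbrs G y \<longleftrightarrow> y \<in> nbrs G x"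
  by (simp add: nbrs_def insert_commute)

lemma adj_op_apply: "adj_op G f x = (\<Sum>y\<in>nbrs G x. f y)"
  by (simp add: adj_op_def)

context bounded_degree_graph
begin

lemma nbrs_in_verts: "y \<in> nbrs G x \<Longrightarrow> y \<in> verts G"
  using edgeD by (auto simp: nbrs_def)

lemma nbrs_in_verts': "y \<in> nbrs G x \<Longrightarrow> x \<in> verts G"
  using edgeD by (auto simp: nbrs_def)

lemma not_in_nbrs_self: "x \<notin> nbrs G x"
  using edgeD[of x x] by (auto simp: nbrs_def)

lemma finite_nbrs [simp, intro]: "finite (nbrs G x)"
  using degree nbrs_in_verts' by (cases "nbrs G x = {}") auto

lemma card_nbrs_le: "card (nbrs G x) \<le> d"
  using degree nbrs_in_verts' by (cases "nbrs G x = {}") auto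

lemma norm_sum_nbrs_le:
  fixes f :: "'a \<Rightarrow> 'b :: real_normed_vector"
  assumes "\<And>y. y \<in> verts G \<Longrightarrow> norm (f y) \<le> B" "B \<ge> 0"
  shows "norm (\<Sum>y\<in>nbrs G x. f y) \<le> real d * B"
proof -
  have "norm (\<Sum>y\<in>nbrs G x. f y) \<le> (\<Sum>y\<in>nbrs G x. B)"
    using assms(1) nbrs_in_verts by (intro sum_norm_le) auto
  also have "\<dots> \<le> real d * B"
    using card_nbrs_le[of x] assms(2) by (simp add: mult_right_mono)
  finally show ?thesis .
qed

lemma abs_root_walks_le: "\<bar>root_walks G k x\<bar> \<le> real d ^ k"
proof (induction k arbitrary: x)
  case (Suc k)
  have "\<bar>\<Sum>y\<in>nbrs G x. root_walks G k y\<bar> \<le> real d * real d ^ k"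
    using norm_sum_nbrs_le[of "root_walks G k" "real d ^ k" x] Suc by simp
  then show ?case by (simp add: adj_op_apply[of G "root_walks G k"])
qed (simp add: delta_def)

lemma spectral_distribution_iff:
  "spectral_distribution G \<mu> \<longleftrightarrow> real_distribution \<mu> \<and>
    (\<forall>k. integrable \<mu> (\<lambda>t. t ^ k) \<and> moment \<mu> k = root_walks G k (base G))"
proof -
  have "ell2_inner G f (delta (base G)) = f (base G)" for f
  proof -
    have "ell2_inner G f (delta (base G)) = (\<Sum>\<^sub>\<infinity>x\<in>{base G}. f x * delta (base G) x)"
      unfolding ell2_inner_def using base_in_verts by (intro infsum_cong_neutral) (auto simp: delta_def)
    then show ?thesis by (simp add: delta_def)
  qed
  then show ?thesis by (simp add: spectral_distribution_def)
qed

text \<open>There are at most d^k walks of length k from the root to any given vertex, so the even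
  moments force the support into [-d, d].\<close>

lemma spectral_distribution_bounded:
  assumes "spectral_distribution G \<mu>"
  shows "bounded_distribution \<mu> d"
proof -
  interpret real_distribution \<mu> using assms by (simp add: spectral_distribution_iff)
  have "AE t in \<mu>. \<bar>t\<bar> \<le> real d"
    using assms abs_root_walks_le[of _ "base G"] degree_pos
    by (intro moments_imp_AE_bounded) (auto simp: spectral_distribution_iff abs_le_iff)
  then show ?thesis by unfold_locales (use degree_pos in auto)
qed

text \<open>This is p(A) delta at the root vector, evaluated at x. At the root it is the moment
  functional applied to p.\<close>

definition poly_adj :: "real poly \<Rightarrow> 'a \<Rightarrow> real" where
  "poly_adj p x = (\<Sum>i\<le>degree p. coeff p i * root_walks G i x)"

lemma poly_adj_eq: "degree p \<le> N \<Longrightarrow> poly_adj p x = (\<Sum>i\<le>N. coeff p i * root_walks G i x)"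
  unfolding poly_adj_def by (rule sum.mono_neutral_left) (auto simp: coeff_eq_0)

lemma poly_adj_0 [simp]: "poly_adj 0 x = 0"
  by (simp add: poly_adj_def)

lemma poly_adj_add: "poly_adj (p + q) x = poly_adj p x + poly_adj q x"
proof -
  let ?N = "max (degree p) (degree q)"
  show ?thesis
    using poly_adj_eq[of p ?N x] poly_adj_eq[of q ?N x] poly_adj_eq[of "p + q" ?N x] degree_add_le_max[of p q]
    by (simp add: sum.distrib distrib_right)
qed

lemma poly_adj_smult: "poly_adj (smult c p) x = c * poly_adj p x"
  using poly_adj_eq[of "smult c p" "degree p" x] degree_smult_le[of c p]
  by (simp add: poly_adj_def[of p] sum_distrib_left mult.assoc)

lemma poly_adj_pCons: "poly_adj (pCons a p) x = a * delta (base G) x + adj_op G (poly_adj p) x"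
proof -
  have "poly_adj (pCons a p) x = (\<Sum>i\<le>Suc (degree p). coeff (pCons a p) i * root_walks G i x)"
    by (rule poly_adj_eq) (rule degree_pCons_le)
  also have "\<dots> = a * delta (base G) x + (\<Sum>i\<le>degree p. coeff p i * root_walks G (Suc i) x)"
    by (simp add: sum.atMost_Suc_shift del: sum.atMost_Suc)
  also have "(\<Sum>i\<le>degree p. coeff p i * root_walks G (Suc i) x) = adj_op G (poly_adj p) x"
    by (simp add: adj_op_apply poly_adj_def sum_distrib_left) (rule sum.swap)
  finally show ?thesis .
qed

lemma poly_adj_root: "poly_adj ([:0, 1:] ^ k) (base G) = root_walks G k (base G)"
proof -
  have "poly_adj ([:0, 1:] ^ k) = root_walks G k"
    by (induction k) (simp_all add: fun_eq_iff poly_adj_pCons adj_op_apply one_pCons)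
  then show ?thesis by simp
qed

text \<open>p(A) delta is supported in the ball of radius deg p. All inner products below are
  therefore finite sums.\<close>

primrec root_ball :: "nat \<Rightarrow> 'a set" where
  "root_ball 0 = {base G}"
| "root_ball (Suc n) = root_ball n \<union> (\<Union>x\<in>root_ball n. nbrs G x)"

lemma finite_root_ball: "finite (root_ball n)"
  by (induction n) auto

lemma root_ball_mono: "m \<le> n \<Longrightarrow> root_ball m \<subseteq> root_ball n"
  by (rule lift_Suc_mono_le[of root_ball]) auto

lemma root_walks_eq_0: "x \<notin> root_ball k \<Longrightarrow> root_walks G k x = 0"
proof (induction k arbitrary: x)
  case (Suc k)
  then show ?case
    by (auto simp: adj_op_apply in_nbrs_sym intro!: sum.neutral)
qed (simp add: delta_def)

lemma poly_adj_eq_0: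
  assumes "degree p \<le> N" "x \<notin> root_ball N"
  shows "poly_adj p x = 0"
  unfolding poly_adj_def
proof (rule sum.neutral, intro ballI)
  fix i assume "i \<in> {..degree p}"
  then have "x \<notin> root_ball i" using assms root_ball_mono[of i N] by auto
  then show "coeff p i * root_walks G i x = 0" by (simp add: root_walks_eq_0)
qed

lemma adj_op_eq_sum:
  assumes "finite S" "\<And>x. x \<notin> S \<Longrightarrow> f x = 0"
  shows "adj_op G f x = (\<Sum>y\<in>S. if y \<in> nbrs G x then f y else 0)"
proof -
  have "(\<Sum>y\<in>S. if y \<in> nbrs G x then f y else 0) = sum f (S \<inter> nbrs G x)"
    using assms(1) by (simp add: sum.inter_restrict)
  also have "\<dots> = sum f (nbrs G x)"
    using assms(2) by (intro sum.mono_neutral_left) auto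
  finally show ?thesis by (simp add: adj_op_apply)
qed

text \<open>The image under the adjacency operator may leave \<open>S\<close>, but there the other
  function vanishes, so summing over \<open>S\<close> gives the full inner product.\<close>

lemma adj_op_symmetric:
  assumes "finite S" "\<And>x. x \<notin> S \<Longrightarrow> f x = 0" "\<And>x. x \<notin> S \<Longrightarrow> g x = 0"
  shows "(\<Sum>x\<in>S. f x * adj_op G g x) = (\<Sum>x\<in>S. adj_op G f x * g x)"
proof -
  have f: "adj_op G f x = (\<Sum>y\<in>S. if y \<in> nbrs G x then f y else 0)" for x
    by (rule adj_op_eq_sum[OF assms(1)]) (rule assms(2))
  have g: "adj_op G g x = (\<Sum>y\<in>S. if y \<in> nbrs G x then g y else 0)" for x
    by (rule adj_op_eq_sum[OF assms(1)]) (rule assms(3))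
  have "(\<Sum>x\<in>S. f x * adj_op G g x) = (\<Sum>x\<in>S. \<Sum>y\<in>S. if y \<in> nbrs G x then f x * g y else 0)"
    unfolding g sum_distrib_left by (intro sum.cong) auto
  also have "\<dots> = (\<Sum>y\<in>S. \<Sum>x\<in>S. if x \<in> nbrs G y then f x * g y else 0)"
    by (subst sum.swap) (simp add: in_nbrs_sym)
  also have "\<dots> = (\<Sum>x\<in>S. adj_op G f x * g x)"
    unfolding f sum_distrib_right by (intro sum.cong) auto
  finally show ?thesis .
qed

text \<open>Estimate each product over an adjacent pair by half the sum of squares. By symmetry of
  adjacency both halves contribute equally, and every vertex is counted at most d times.\<close>

lemma abs_sum_adj_op_le:
  assumes "finite S" "\<And>x. x \<notin> S \<Longrightarrow> f x = 0"
  shows "\<bar>\<Sum>x\<in>S. f x * adj_op G f x\<bar> \<le> real d * (\<Sum>x\<in>S. f x * f x)"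
proof -
  let ?n = "\<lambda>x y a. if y \<in> nbrs G x then a else (0::real)"
  have row: "(\<Sum>x\<in>S. \<Sum>y\<in>S. ?n x y ((f x)\<^sup>2)) \<le> real d * (\<Sum>x\<in>S. f x * f x)"
  proof -
    have "(\<Sum>y\<in>S. ?n x y ((f x)\<^sup>2)) \<le> real d * (f x * f x)" for x
    proof -
      have "(\<Sum>y\<in>S. ?n x y ((f x)\<^sup>2)) = real (card (S \<inter> nbrs G x)) * (f x)\<^sup>2"
        using assms(1) by (simp add: sum.inter_restrict[symmetric])
      also have "\<dots> \<le> real d * (f x)\<^sup>2"
        using card_mono[OF finite_nbrs, of "S \<inter> nbrs G x" x] card_nbrs_le[of x]
        by (intro mult_right_mono) auto
      finally show ?thesis by (simp add: power2_eq_square)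
    qed
    then show ?thesis unfolding sum_distrib_left by (intro sum_mono)
  qed
  have col: "(\<Sum>x\<in>S. \<Sum>y\<in>S. ?n x y ((f y)\<^sup>2)) = (\<Sum>x\<in>S. \<Sum>y\<in>S. ?n x y ((f x)\<^sup>2))"
    by (subst sum.swap) (simp add: in_nbrs_sym)
  have f: "adj_op G f x = (\<Sum>y\<in>S. if y \<in> nbrs G x then f y else 0)" for x
    by (rule adj_op_eq_sum[OF assms(1)]) (rule assms(2))
  have "(\<Sum>x\<in>S. f x * adj_op G f x) = (\<Sum>x\<in>S. \<Sum>y\<in>S. ?n x y (f x * f y))"
    unfolding f sum_distrib_left by (intro sum.cong) auto
  also have "\<bar>\<dots>\<bar> \<le> (\<Sum>x\<in>S. \<Sum>y\<in>S. \<bar>?n x y (f x * f y)\<bar>)"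
    by (rule order.trans[OF sum_abs sum_mono]) (rule sum_abs)
  also have "\<dots> \<le> (\<Sum>x\<in>S. \<Sum>y\<in>S. (?n x y ((f x)\<^sup>2) + ?n x y ((f y)\<^sup>2)) / 2)"
  proof (intro sum_mono)
    fix x y
    have "2 * \<bar>f x * f y\<bar> \<le> (f x)\<^sup>2 + (f y)\<^sup>2"
      using zero_le_power2[of "\<bar>f x\<bar> - \<bar>f y\<bar>"] by (simp add: power2_diff abs_mult)
    then show "\<bar>?n x y (f x * f y)\<bar> \<le> (?n x y ((f x)\<^sup>2) + ?n x y ((f y)\<^sup>2)) / 2"
      by simp
  qed
  also have "\<dots> = (\<Sum>x\<in>S. \<Sum>y\<in>S. ?n x y ((f x)\<^sup>2))"
    unfolding sum_divide_distrib[symmetric] sum.distrib col by simp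
  finally show ?thesis using row by linarith
qed

text \<open>Symmetry of A moves its powers one at a time from one side of the inner product to the
  other; N is large enough for the ball to contain both supports throughout.\<close>

lemma poly_adj_mult:
  assumes "degree p + degree q \<le> N"
  shows "poly_adj (p * q) (base G) = (\<Sum>x\<in>root_ball N. poly_adj p x * poly_adj q x)"
  using assms
proof (induction p arbitrary: q)
  case (pCons a p)
  have base: "base G \<in> root_ball N" using root_ball_mono[of 0 N] by auto
  have dq: "degree q \<le> N" using pCons.prems by simp
  have dp: "degree p \<le> N" using pCons.prems by (cases "p = 0") auto
  \<comment> \<open>The factor X taken from the first polynomial goes to the second, so the sum of
    degrees is kept. For p = 0 nothing is taken off, and that case is trivial anyway.\<close>
  have IH: "poly_adj (p * pCons 0 q) (base G) = (\<Sum>x\<in>root_ball N. poly_adj p x * poly_adj (pCons 0 q) x)"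
  proof (cases "p = 0")
    case False
    then show ?thesis
      using pCons.prems degree_pCons_le[of 0 q] by (intro pCons.IH) simp
  qed simp
  have "pCons a p * q = smult a q + p * pCons 0 q"
    by simp
  then have "poly_adj (pCons a p * q) (base G) = a * poly_adj q (base G)
      + (\<Sum>x\<in>root_ball N. poly_adj p x * adj_op G (poly_adj q) x)"
    by (simp only: poly_adj_add poly_adj_smult IH) (simp add: poly_adj_pCons)
  also have "(\<Sum>x\<in>root_ball N. poly_adj p x * adj_op G (poly_adj q) x)
      = (\<Sum>x\<in>root_ball N. adj_op G (poly_adj p) x * poly_adj q x)"
    by (intro adj_op_symmetric finite_root_ball poly_adj_eq_0[OF dp] poly_adj_eq_0[OF dq])
  also have "a * poly_adj q (base G) = (\<Sum>x\<in>root_ball N. a * delta (base G) x * poly_adj q x)"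
    using base finite_root_ball by (simp add: delta_def sum.delta' if_distrib if_distribR cong: if_cong)
  finally show ?case
    by (simp add: poly_adj_pCons sum.distrib distrib_right)
qed simp

lemma poly_adj_square_nonneg: "0 \<le> poly_adj (q * q) (base G)"
  by (subst poly_adj_mult[OF order.refl]) (simp add: sum_nonneg)

text \<open>The operators d + A and d - A are positive, by the bound on the quadratic form.\<close>

lemma poly_adj_linear_square_nonneg:
  assumes "\<bar>b\<bar> \<le> 1"
  shows "0 \<le> poly_adj ([:real d, b:] * (q * q)) (base G)"
proof -
  let ?N = "degree ([:real d, b:] * q) + degree q"
  have "[:real d, b:] * q = smult d q + smult b (pCons 0 q)" by simp
  then have F: "poly_adj ([:real d, b:] * q) x = real d * poly_adj q x + b * adj_op G (poly_adj q) x" for x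
    by (simp only: poly_adj_add poly_adj_smult) (simp add: poly_adj_pCons)
  have "poly_adj (([:real d, b:] * q) * q) (base G)
      = (\<Sum>x\<in>root_ball ?N. poly_adj ([:real d, b:] * q) x * poly_adj q x)"
    by (rule poly_adj_mult) simp
  also have "\<dots> = real d * (\<Sum>x\<in>root_ball ?N. poly_adj q x * poly_adj q x)
      + b * (\<Sum>x\<in>root_ball ?N. poly_adj q x * adj_op G (poly_adj q) x)"
    unfolding F sum_distrib_left sum.distrib[symmetric] by (intro sum.cong) (auto simp: algebra_simps)
  finally have eq: "poly_adj (([:real d, b:] * q) * q) (base G) = real d * (\<Sum>x\<in>root_ball ?N. poly_adj q x * poly_adj q x)
      + b * (\<Sum>x\<in>root_ball ?N. poly_adj q x * adj_op G (poly_adj q) x)" .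
  have "\<bar>b * (\<Sum>x\<in>root_ball ?N. poly_adj q x * adj_op G (poly_adj q) x)\<bar>
      \<le> 1 * (real d * (\<Sum>x\<in>root_ball ?N. poly_adj q x * poly_adj q x))"
    unfolding abs_mult using assms
    by (intro mult_mono abs_sum_adj_op_le finite_root_ball poly_adj_eq_0[of q ?N]) auto
  then show ?thesis using eq unfolding mult.assoc by linarith
qed

text \<open>Even parts of the exponents combine to a square, leaving a factor 1, u, v or u v. Only u
  v needs an argument beyond the previous two lemmas.\<close>

lemma poly_adj_bernstein_nonneg:
  assumes u: "u = smult c [:real d, 1:]" and v: "v = smult c [:real d, - 1:]" and "c > 0" "u + v = 1"
  shows "0 \<le> poly_adj (u ^ j * v ^ l) (base G)"
proof -
  have uq: "0 \<le> poly_adj (u * (q * q)) (base G)" for q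
    using poly_adj_linear_square_nonneg[of 1 q] \<open>c > 0\<close>
    unfolding u mult_smult_left poly_adj_smult by simp
  have vq: "0 \<le> poly_adj (v * (q * q)) (base G)" for q
    using poly_adj_linear_square_nonneg[of "- 1" q] \<open>c > 0\<close>
    unfolding v mult_smult_left poly_adj_smult by simp
  obtain a e where j: "j = 2 * a + e" "e = 0 \<or> e = 1"
    by (metis mod_mult_div_eq add.commute not_mod_2_eq_0_eq_1)
  obtain b f where l: "l = 2 * b + f" "f = 0 \<or> f = 1"
    by (metis mod_mult_div_eq add.commute not_mod_2_eq_0_eq_1)
  define q where "q = u ^ a * v ^ b"
  have eq: "u ^ j * v ^ l = u ^ e * v ^ f * (q * q)"
    by (simp add: j l q_def power_add power_mult power2_eq_square power_mult_distrib algebra_simps)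
  consider "e = 0" "f = 0" | "e = 1" "f = 0" | "e = 0" "f = 1" | "e = 1" "f = 1"
    using j(2) l(2) by blast
  then show ?thesis
  proof cases
    case 4
    \<comment> \<open>Multiplying by u + v = 1 splits u v q^2 into u (v q)^2 + v (u q)^2, a sum of
      terms already known to be nonnegative.\<close>
    have "u ^ j * v ^ l = u * v * (q * q) * (u + v)" by (simp add: eq 4 \<open>u + v = 1\<close>)
    also have "\<dots> = u * ((v * q) * (v * q)) + v * ((u * q) * (u * q))" by (simp add: algebra_simps)
    finally show ?thesis using uq[of "v * q"] vq[of "u * q"] by (simp only: poly_adj_add)
  qed (use uq[of q] vq[of q] poly_adj_square_nonneg[of q] eq in \<open>simp_all\<close>)
qed

text \<open>The affine substitution \<open>t = 2 d s - d\<close> transports the Hausdorff moment problem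
  from \<open>[0, 1]\<close> to \<open>[-d, d]\<close>.\<close>

theorem ex_spectral_distribution: "\<exists>\<mu>. spectral_distribution G \<mu>"
proof -
  \<comment> \<open>With this constant u is (t + d)/(2d), mapping [-d, d] onto [0, 1], and v is its
    complement 1 - u.\<close>
  define c where "c = 1 / (2 * real d)"
  define u where "u = smult c [:real d, 1:]"
  define v where "v = smult c [:real d, - 1:]"
  define L where "L p = poly_adj (pcompose p u) (base G)" for p
  have d: "real d > 0" using degree_pos by simp
  have uv: "u + v = 1" using d by (simp add: u_def v_def c_def one_pCons)
  have L_add: "L (p + q) = L p + L q" for p q
    by (simp add: L_def pcompose_add poly_adj_add)
  have L_smult: "L (smult a p) = a * L p" for a p
    by (simp add: L_def pcompose_smult poly_adj_smult)
  have pc1: "pcompose 1 u = 1" by (simp add: one_pCons)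
  have L_1: "L 1 = 1"
    using poly_adj_root[of 0] by (simp add: L_def delta_def pc1)
  have pcompose_power: "pcompose (p ^ k) u = pcompose p u ^ k" for p k
    by (induction k) (simp_all add: pc1 pcompose_mult)
  have pcu: "pcompose [:0, 1:] u = u" "pcompose [:1, - 1:] u = v"
    using uv by (simp_all add: pcompose_pCons algebra_simps one_pCons[symmetric] pc1)
  have L_nonneg: "0 \<le> L ([:0, 1:] ^ j * [:1, - 1:] ^ l)" for j l
    unfolding L_def pcompose_mult pcompose_power pcu
    by (rule poly_adj_bernstein_nonneg[OF u_def v_def _ uv]) (use d in \<open>simp add: c_def\<close>)
  obtain M where M: "real_distribution M" and supp: "AE t in M. 0 \<le> t \<and> t \<le> 1"
    and mom: "\<And>k. moment M k = L ([:0, 1:] ^ k)"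
    using hausdorff_moment_problem[OF L_add L_smult L_1 L_nonneg] by blast
  interpret M: real_distribution M by fact
  interpret M: bounded_distribution M 1
    using supp by unfold_locales (auto elim: eventually_mono)
  have poly_sum: "poly p t = (\<Sum>i\<le>degree p. coeff p i * t ^ i)" for p and t :: real
    by (rule poly_altdef)
  have int_poly: "integrable M (poly p)" "(\<integral>t. poly p t \<partial>M) = L p" for p
  proof -
    show "integrable M (poly p)"
      unfolding poly_sum[abs_def] by (intro Bochner_Integration.integrable_sum integrable_mult_right) simp
    have L_sum: "L (sum f A) = (\<Sum>i\<in>A. L (f i))" if "finite A" for f :: "nat \<Rightarrow> real poly" and A
      using that L_smult[of 0 0] by (induction A) (auto simp: L_add)
    have "L p = L (\<Sum>i\<le>degree p. smult (coeff p i) ([:0, 1:] ^ i))"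
      using poly_as_sum_of_monoms[of p] by (simp add: monom_altdef)
    also have "\<dots> = (\<Sum>i\<le>degree p. coeff p i * moment M i)"
      by (simp add: L_sum L_smult mom)
    finally show "(\<integral>t. poly p t \<partial>M) = L p"
      unfolding poly_sum by (subst Bochner_Integration.integral_sum) simp_all
  qed
  let ?h = "\<lambda>s. 2 * real d * s - real d"
  have pow: "?h s ^ k = poly ([:- real d, 2 * real d:] ^ k) s" for s k
    by (simp add: algebra_simps)
  \<comment> \<open>The push-forward map \<open>?h\<close> inverts u, so the substitution in
    \<open>L\<close> is undone and plain powers of A remain.\<close>
  have comp: "pcompose [:- real d, 2 * real d:] u = [:0, 1:]"
    using d by (simp add: pcompose_pCons u_def c_def)
  have "spectral_distribution G (distr M borel ?h)"
    unfolding spectral_distribution_iff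
  proof (intro conjI allI)
    show "real_distribution (distr M borel ?h)"
      by (intro M.real_distribution_distr) simp
    show "integrable (distr M borel ?h) (\<lambda>t. t ^ k)" for k
      by (subst integrable_distr_eq) (simp_all only: pow int_poly(1), simp_all)
    show "moment (distr M borel ?h) k = root_walks G k (base G)" for k
      by (subst integral_distr) (simp_all only: pow int_poly(2) L_def pcompose_power comp poly_adj_root, simp_all)
  qed
  then show ?thesis ..
qed

end

section \<open>Normalised resolvents\<close>

text \<open>The solutions of \<open>(z - A) v = \<alpha> \<delta>\<^sub>e\<close> normalised by \<open>v(e) = 1\<close>; then \<open>\<alpha> = F(z)\<close>, so the
  K-transform is the sum of \<open>v\<close> over the neighbours of the root. This linear description is what
  makes the products of graphs tractable: their solutions are products of those of the factors.\<close>

definition resolvent_sol :: "'a rgraph \<Rightarrow> complex \<Rightarrow> ('a \<Rightarrow> complex) \<Rightarrow> bool" where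
  "resolvent_sol G z v \<longleftrightarrow> v (base G) = 1 \<and> (\<forall>x\<in>verts G. norm (v x) \<le> 1) \<and>
     (\<forall>x\<in>verts G. x \<noteq> base G \<longrightarrow> (\<Sum>y\<in>nbrs G x. v y) = z * v x)"

context bounded_degree_graph
begin

lemma cauchy_G_sums_root_walks:
  assumes "spectral_distribution G \<mu>" "norm z > real d"
  shows "(\<lambda>k. complex_of_real (root_walks G k (base G)) / z ^ Suc k) sums cauchy_G \<mu> z"
  using bounded_distribution.cauchy_G_sums[OF spectral_distribution_bounded[OF assms(1)] assms(2)] assms(1)
  by (simp add: spectral_distribution_iff)

text \<open>With alpha the defect of the equation at the root, z T^n v = alpha A^n delta + T^(n+1) v
  on the vertices. Telescoping gives alpha times the partial sums of G(z), with remainder at most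
  (d/|z|)^n because v is bounded. The product form of the conclusion also excludes a zero of either
  factor.\<close>

lemma resolvent_sol_cauchy_G:
  assumes \<mu>: "spectral_distribution G \<mu>" and z: "norm z > real d" and v: "resolvent_sol G z v"
  shows "cauchy_G \<mu> z * (z - (\<Sum>y\<in>nbrs G (base G). v y)) = 1"
proof -
  define \<alpha> where "\<alpha> = z - (\<Sum>y\<in>nbrs G (base G). v y)"
  define T where "T f x = (\<Sum>y\<in>nbrs G x. f y)" for f :: "'a \<Rightarrow> complex" and x
  have z0: "z \<noteq> 0" using z by auto
  have step: "z * (T ^^ n) v x = \<alpha> * root_walks G n x + (T ^^ Suc n) v x" if "x \<in> verts G" for n x
    using that
  proof (induction n arbitrary: x)
    case 0
    then show ?case
      using v by (auto simp: resolvent_sol_def T_def \<alpha>_def delta_def)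
  next
    case (Suc n)
    have "z * (T ^^ Suc n) v x = (\<Sum>y\<in>nbrs G x. z * (T ^^ n) v y)"
      by (simp add: T_def sum_distrib_left)
    also have "\<dots> = (\<Sum>y\<in>nbrs G x. \<alpha> * root_walks G n y + (T ^^ Suc n) v y)"
      using Suc.IH nbrs_in_verts by (intro sum.cong) auto
    also have "\<dots> = \<alpha> * (\<Sum>y\<in>nbrs G x. complex_of_real (root_walks G n y)) + T ((T ^^ Suc n) v) x"
      by (simp only: T_def[of "(T ^^ Suc n) v"] sum.distrib sum_distrib_left)
    also have "(\<Sum>y\<in>nbrs G x. complex_of_real (root_walks G n y)) = root_walks G (Suc n) x"
      by (simp add: adj_op_apply[of G "root_walks G n"])
    finally show ?case by simp
  qed
  have T_bound: "norm ((T ^^ n) v x) \<le> real d ^ n" if "x \<in> verts G" for n x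
    using that
  proof (induction n arbitrary: x)
    case 0
    then show ?case using v by (simp add: resolvent_sol_def)
  next
    case (Suc n)
    show ?case
      using norm_sum_nbrs_le[of "(T ^^ n) v" "real d ^ n" x] Suc.IH by (simp add: T_def[of "(T ^^ n) v"])
  qed
  have expand: "1 = \<alpha> * (\<Sum>k<n. complex_of_real (root_walks G k (base G)) / z ^ Suc k) + (T ^^ n) v (base G) / z ^ n" for n
  proof (induction n)
    case 0
    then show ?case using v by (simp add: resolvent_sol_def)
  next
    case (Suc n)
    have "(T ^^ n) v (base G) / z ^ n = (z * (T ^^ n) v (base G)) / z ^ Suc n"
      using z0 by simp
    also have "\<dots> = \<alpha> * (complex_of_real (root_walks G n (base G)) / z ^ Suc n) + (T ^^ Suc n) v (base G) / z ^ Suc n"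
      unfolding step[OF base_in_verts] by (simp only: add_divide_distrib times_divide_eq_right)
    finally show ?case
      using Suc by (simp only: sum.lessThan_Suc distrib_left) (simp only: add.assoc)
  qed
  have "(\<lambda>n. (T ^^ n) v (base G) / z ^ n) \<longlonglongrightarrow> 0"
  proof (rule Lim_null_comparison)
    show "\<forall>\<^sub>F n in sequentially. norm ((T ^^ n) v (base G) / z ^ n) \<le> (real d / norm z) ^ n"
      using T_bound[OF base_in_verts]
      by (intro always_eventually allI) (simp add: norm_divide norm_power power_divide divide_right_mono)
    show "(\<lambda>n. (real d / norm z) ^ n) \<longlonglongrightarrow> 0"
      using z by (intro LIMSEQ_power_zero) (simp add: divide_less_eq)
  qed
  moreover have "(\<lambda>n. \<alpha> * (\<Sum>k<n. complex_of_real (root_walks G k (base G)) / z ^ Suc k)) \<longlonglongrightarrow> \<alpha> * cauchy_G \<mu> z"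
    using cauchy_G_sums_root_walks[OF \<mu> z] unfolding sums_def by (intro tendsto_mult tendsto_const)
  ultimately have "(\<lambda>n. \<alpha> * (\<Sum>k<n. complex_of_real (root_walks G k (base G)) / z ^ Suc k)
      + (T ^^ n) v (base G) / z ^ n) \<longlonglongrightarrow> \<alpha> * cauchy_G \<mu> z + 0"
    by (intro tendsto_add)
  then have "(\<lambda>n::nat. 1) \<longlonglongrightarrow> \<alpha> * cauchy_G \<mu> z"
    unfolding expand[symmetric] by simp
  then have "\<alpha> * cauchy_G \<mu> z = 1" by (simp add: LIMSEQ_const_iff)
  then show ?thesis by (simp add: \<alpha>_def mult.commute)
qed

lemma resolvent_sol_K_trans:
  assumes "spectral_distribution G \<mu>" "norm z > real d" "resolvent_sol G z v"
  shows "K_trans \<mu> z = (\<Sum>y\<in>nbrs G (base G). v y)"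
proof -
  let ?s = "\<Sum>y\<in>nbrs G (base G). v y"
  have "cauchy_G \<mu> z * (z - ?s) = 1" by (rule resolvent_sol_cauchy_G[OF assms])
  then have "1 / cauchy_G \<mu> z = z - ?s" by (auto simp: divide_eq_eq mult.commute)
  then show ?thesis by (simp add: K_trans_def recip_F_def)
qed

text \<open>The Neumann series of (z - A)^(-1) delta, divided by its value G(z) at the root. The
  nonvanishing of G(z) comes from the upper half-plane in one application and from G(z) = s with s
  nonzero in the other.\<close>

lemma ex_resolvent_sol:
  assumes \<mu>: "spectral_distribution G \<mu>" and z: "norm z > real d" and nz: "cauchy_G \<mu> z \<noteq> 0"
  obtains v where "resolvent_sol G z v"
proof -
  define g where "g x = (\<Sum>k. complex_of_real (root_walks G k x) / z ^ Suc k)" for x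
  define v where "v x = g x / g (base G)" for x
  have z0: "z \<noteq> 0" using z by auto
  let ?q = "real d / norm z"
  have q: "0 \<le> ?q" "?q < 1" using z by (auto simp: divide_less_eq)
  have geo: "(\<lambda>k. ?q ^ k * (1 / norm z)) sums (1 / (1 - ?q) * (1 / norm z))"
    using q by (intro sums_mult2 geometric_sums) simp
  have bound: "norm (complex_of_real (root_walks G k x) / z ^ Suc k) \<le> ?q ^ k * (1 / norm z)" for k x
    using abs_root_walks_le[of k x]
    by (simp add: norm_divide norm_mult norm_power power_divide divide_right_mono mult.commute)
  have sm: "summable (\<lambda>k. complex_of_real (root_walks G k x) / z ^ Suc k)" for x
    by (rule summable_comparison_test'[OF sums_summable[OF geo]]) (rule bound)
  have g_base: "g (base G) = cauchy_G \<mu> z"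
    unfolding g_def by (rule sums_unique[OF cauchy_G_sums_root_walks[OF \<mu> z], symmetric])
  have g_eq: "(\<Sum>y\<in>nbrs G x. g y) = z * g x - delta (base G) x" for x
  proof -
    have "(\<Sum>y\<in>nbrs G x. g y) = (\<Sum>k. \<Sum>y\<in>nbrs G x. complex_of_real (root_walks G k y) / z ^ Suc k)"
      unfolding g_def by (rule suminf_sum[symmetric]) (rule sm)
    also have "\<dots> = (\<Sum>k. z * (complex_of_real (root_walks G (Suc k) x) / z ^ Suc (Suc k)))"
      using z0 by (intro suminf_cong)
        (simp add: adj_op_apply[of G "root_walks G _"] sum_divide_distrib[symmetric])
    also have "\<dots> = z * (\<Sum>k. complex_of_real (root_walks G (Suc k) x) / z ^ Suc (Suc k))"
      using summable_Suc_iff[THEN iffD2, OF sm[of x]] by (intro suminf_mult)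
    also have "(\<Sum>k. complex_of_real (root_walks G (Suc k) x) / z ^ Suc (Suc k)) = g x - delta (base G) x / z"
      using suminf_split_head[OF sm[of x]] by (simp add: g_def)
    finally show ?thesis using z0 by (simp add: right_diff_distrib)
  qed
  have v_base: "v (base G) = 1" using nz by (simp add: v_def g_base)
  have v_eq: "(\<Sum>y\<in>nbrs G x. v y) = z * v x" if "x \<noteq> base G" for x
    using g_eq[of x] that by (simp add: v_def sum_divide_distrib[symmetric] delta_def)
  define B where "B = 1 / (1 - ?q) * (1 / norm z) / norm (g (base G))"
  \<comment> \<open>A maximum principle: \<open>B\<close> is a crude bound from the geometric
    series, and since off the root |v(x)| is at most d/|z| times a bound for the neighbours, each
    round shrinks the excess over 1 by a factor below 1.\<close>
  have v_bound: "norm (v x) \<le> max 1 (?q ^ n * B)" for x n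
  proof (induction n arbitrary: x)
    case 0
    have "norm (g x) \<le> (\<Sum>k. ?q ^ k * (1 / norm z))"
      unfolding g_def by (rule norm_suminf_le[OF bound sums_summable[OF geo]])
    then have "norm (g x) \<le> 1 / (1 - ?q) * (1 / norm z)"
      using sums_unique[OF geo] by simp
    then have "norm (v x) \<le> B"
      unfolding v_def B_def norm_divide by (rule divide_right_mono) simp
    then show ?case by simp
  next
    case (Suc n)
    show ?case
    proof (cases "x = base G")
      case False
      have "norm z * norm (v x) \<le> real d * max 1 (?q ^ n * B)"
        using norm_sum_nbrs_le[of v "max 1 (?q ^ n * B)" x] Suc.IH
        unfolding v_eq[OF False] norm_mult by (simp add: le_max_iff_disj)
      then have "norm (v x) \<le> ?q * max 1 (?q ^ n * B)"
        using z0 by (simp add: field_simps)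
      also have "\<dots> = max ?q (?q ^ Suc n * B)"
        using q by (simp only: max_mult_distrib_left) simp
      also have "\<dots> \<le> max 1 (?q ^ Suc n * B)"
        using q by (intro max.mono) auto
      finally show ?thesis .
    qed (simp add: v_base)
  qed
  have "norm (v x) \<le> 1" for x
  proof (rule ccontr)
    assume "\<not> norm (v x) \<le> 1"
    then have "norm (v x) \<le> ?q ^ n * B" for n
      using v_bound[of x n] by simp
    moreover have "(\<lambda>n. ?q ^ n * B) \<longlonglongrightarrow> 0 * B"
      using q by (intro tendsto_mult tendsto_const LIMSEQ_power_zero) simp
    ultimately have "norm (v x) \<le> 0 * B"
      by (intro LIMSEQ_le_const) auto
    then show False using \<open>\<not> norm (v x) \<le> 1\<close> by simp
  qed
  then have "resolvent_sol G z v"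
    using v_base v_eq by (simp add: resolvent_sol_def)
  then show thesis by (rule that)
qed

text \<open>K is a sum of at most d values of modulus at most 1. This keeps F(z) = z - K(z) large
  enough to be fed into the resolvent of another graph.\<close>

lemma norm_K_trans_le:
  assumes "spectral_distribution G \<mu>" "norm z > real d" "Im z > 0"
  shows "norm (K_trans \<mu> z) \<le> real d"
proof -
  interpret bounded_distribution \<mu> d by (rule spectral_distribution_bounded) fact
  obtain v where v: "resolvent_sol G z v"
    by (rule ex_resolvent_sol[OF assms(1,2) cauchy_G_nonzero[OF assms(3)]])
  have "norm (\<Sum>y\<in>nbrs G (base G). v y) \<le> real d * 1"
    using v by (intro norm_sum_nbrs_le) (auto simp: resolvent_sol_def)
  then show ?thesis by (simp add: resolvent_sol_K_trans[OF assms(1,2) v])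
qed

end

section \<open>Star and orthogonal products\<close>

lemma bounded_degree_graphI:
  assumes "rooted_graph G" "uniformly_locally_finite G"
  obtains d where "bounded_degree_graph G d"
proof -
  interpret rooted_graph G by fact
  obtain d where d: "\<And>x. x \<in> verts G \<Longrightarrow> finite (nbrs G x) \<and> card (nbrs G x) \<le> d"
    using assms(2) by (auto simp: uniformly_locally_finite_def)
  \<comment> \<open>The successor only secures positivity of the bound.\<close>
  have "bounded_degree_graph G (Suc d)"
  proof
    show "x \<in> verts G \<and> y \<in> verts G \<and> x \<noteq> y" if "{x, y} \<in> edges G" for x y
      using simple[OF that] by (auto simp: doubleton_eq_iff)
    show "finite (nbrs G x) \<and> card (nbrs G x) \<le> Suc d" if "x \<in> verts G" for x
      using d[OF that] by auto
  qed (auto simp: base_in_verts)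
  then show thesis by (rule that)
qed

lemma bounded_degree_graph_subgraph:
  assumes "bounded_degree_graph G d" "base H = base G" "base H \<in> verts H" "edges H \<subseteq> edges G"
    and "\<And>x y. {x, y} \<in> edges H \<Longrightarrow> x \<in> verts H"
  shows "bounded_degree_graph H d"
proof -
  interpret bounded_degree_graph G d by fact
  have "nbrs H x \<subseteq> nbrs G x" for x using assms(4) by (auto simp: nbrs_def)
  then have "finite (nbrs H x) \<and> card (nbrs H x) \<le> d" for x
    using card_mono[of "nbrs G x" "nbrs H x"] card_nbrs_le[of x] finite_subset[of "nbrs H x" "nbrs G x"]
    by fastforce
  moreover have "x \<in> verts H \<and> y \<in> verts H \<and> x \<noteq> y" if "{x, y} \<in> edges H" for x y
    using assms(5)[of x y] assms(5)[of y x] edgeD[of x y] assms(4) that by (auto simp: insert_commute)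
  ultimately show ?thesis
    by unfold_locales (use assms(3) degree_pos in auto)
qed

section \<open>Isomorphism and relabelling invariance of spectral distributions\<close>

definition is_rooted_iso :: "('a \<Rightarrow> 'b) \<Rightarrow> 'a rgraph \<Rightarrow> 'b rgraph \<Rightarrow> bool" where
  "is_rooted_iso f G H \<longleftrightarrow> bij_betw f (verts G) (verts H) \<and> f (base G) = base H \<and>
     (\<forall>x\<in>verts G. \<forall>y\<in>verts G. {x, y} \<in> edges G \<longleftrightarrow> {f x, f y} \<in> edges H)"

lemma is_rooted_iso_inj_on: "is_rooted_iso f G H \<Longrightarrow> inj_on f (verts G)"
  by (simp add: is_rooted_iso_def bij_betw_def)

lemma (in bounded_degree_graph) nbrs_subset_verts: "nbrs G x \<subseteq> verts G"
  using nbrs_in_verts by blast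

lemma rooted_iso_iff: "rooted_iso G H \<longleftrightarrow> (\<exists>f. is_rooted_iso f G H)"
  by (simp add: rooted_iso_def is_rooted_iso_def)

lemma is_rooted_iso_nbrs:
  assumes iso: "is_rooted_iso f G H" and x: "x \<in> verts G"
    and G: "\<And>x y. {x, y} \<in> edges G \<Longrightarrow> y \<in> verts G"
    and H: "\<And>x y. {x, y} \<in> edges H \<Longrightarrow> y \<in> verts H"
  shows "nbrs H (f x) = f ` nbrs G x"
proof (intro equalityI subsetI)
  fix q assume q: "q \<in> nbrs H (f x)"
  then have "{f x, q} \<in> edges H" by (simp add: nbrs_def)
  then have "q \<in> f ` verts G"
    using H iso by (auto simp: is_rooted_iso_def bij_betw_def)
  then obtain y where y: "y \<in> verts G" "q = f y" by blast
  with q iso x have "y \<in> nbrs G x" by (simp add: nbrs_def is_rooted_iso_def)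
  then show "q \<in> f ` nbrs G x" using y by blast
next
  fix q assume "q \<in> f ` nbrs G x"
  then obtain y where y: "{x, y} \<in> edges G" "q = f y" by (auto simp: nbrs_def)
  then have "{f x, f y} \<in> edges H" using G[OF y(1)] iso x by (simp add: is_rooted_iso_def)
  then show "q \<in> nbrs H (f x)" by (simp add: nbrs_def y(2))
qed

lemma root_walks_iso:
  assumes iso: "is_rooted_iso f G H" and G: "bounded_degree_graph G d" and H: "bounded_degree_graph H d'"
    and "x \<in> verts G"
  shows "root_walks H k (f x) = root_walks G k x"
  using assms(4)
proof (induction k arbitrary: x)
  interpret G: bounded_degree_graph G d by fact
  have inj: "inj_on f (verts G)" by (rule is_rooted_iso_inj_on[OF iso])
  {
    case 0
    have "f (base G) = base H" using iso by (simp add: is_rooted_iso_def)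
    then show ?case
      using inj_on_eq_iff[OF inj 0 G.base_in_verts] by (simp add: delta_def)
  next
    case (Suc k)
    interpret H: bounded_degree_graph H d' by fact
    have "nbrs H (f x) = f ` nbrs G x"
      using G.edgeD H.edgeD by (intro is_rooted_iso_nbrs[OF iso Suc.prems]) blast+
    moreover have "inj_on f (nbrs G x)"
      by (rule inj_on_subset[OF inj G.nbrs_subset_verts])
    ultimately have "(\<Sum>y\<in>nbrs H (f x). root_walks H k y) = (\<Sum>y\<in>nbrs G x. root_walks H k (f y))"
      by (simp add: sum.reindex)
    also have "\<dots> = (\<Sum>y\<in>nbrs G x. root_walks G k y)"
      by (intro sum.cong refl Suc.IH) (rule G.nbrs_in_verts)
    finally show ?case
      by (simp add: adj_op_apply[of H "root_walks H k"] adj_op_apply[of G "root_walks G k"])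
  }
qed

lemma spectral_distribution_iso:
  assumes iso: "is_rooted_iso f G H" and G: "bounded_degree_graph G d" and H: "bounded_degree_graph H d'"
  shows "spectral_distribution G \<mu> \<longleftrightarrow> spectral_distribution H \<mu>"
proof -
  have "root_walks H k (base H) = root_walks G k (base G)" for k
    using root_walks_iso[OF assms bounded_degree_graph.base_in_verts[OF G]] iso by (simp add: is_rooted_iso_def)
  then show ?thesis
    by (simp add: bounded_degree_graph.spectral_distribution_iff[OF G] bounded_degree_graph.spectral_distribution_iff[OF H])
qed

lemma image_doubleton_mem_iff:
  assumes inj: "inj_on f V" and E: "\<And>e. e \<in> E \<Longrightarrow> e \<subseteq> V" and "x \<in> V" "y \<in> V"
  shows "{f x, f y} \<in> (`) f ` E \<longleftrightarrow> {x, y} \<in> E"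
proof -
  have "f ` {x, y} \<in> (`) f ` E \<longleftrightarrow> {x, y} \<in> E"
    by (rule inj_on_image_mem_iff[OF inj_on_image_Pow[OF inj]]) (use assms(3,4) E in blast)+
  then show ?thesis by simp
qed

text \<open>Stronger than \<open>edgeD\<close> on the shape of edges: that axiom constrains only
  sets written as doubletons, whereas here every edge is one, so that edge sets can be treated as
  images of each other.\<close>

definition simple_edges :: "'a rgraph \<Rightarrow> bool" where
  "simple_edges G \<longleftrightarrow> (\<forall>e\<in>edges G. \<exists>x y. e = {x, y} \<and> x \<noteq> y \<and> x \<in> verts G \<and> y \<in> verts G)"

lemma simple_edges_subset: "simple_edges G \<Longrightarrow> e \<in> edges G \<Longrightarrow> e \<subseteq> verts G"
  by (auto simp: simple_edges_def)

lemma is_rooted_iso_relabel: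
  assumes "inj_on f (verts G)" "simple_edges G"
  shows "is_rooted_iso f G (relabel f G)"
proof -
  have "{f x, f y} \<in> (`) f ` edges G \<longleftrightarrow> {x, y} \<in> edges G" if "x \<in> verts G" "y \<in> verts G" for x y
    by (rule image_doubleton_mem_iff[OF assms(1) simple_edges_subset[OF assms(2)] that])
  then show ?thesis
    using assms(1) by (simp add: is_rooted_iso_def relabel_def bij_betw_def)
qed

lemma simple_edges_relabel:
  assumes "inj_on f (verts G)" "simple_edges G"
  shows "simple_edges (relabel f G)"
  unfolding simple_edges_def
proof
  fix e assume "e \<in> edges (relabel f G)"
  then obtain e' where e': "e' \<in> edges G" "e = f ` e'" by (auto simp: relabel_def)
  then obtain x y where xy: "e' = {x, y}" "x \<noteq> y" "x \<in> verts G" "y \<in> verts G"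
    using assms(2) by (auto simp: simple_edges_def)
  show "\<exists>x y. e = {x, y} \<and> x \<noteq> y \<and> x \<in> verts (relabel f G) \<and> y \<in> verts (relabel f G)"
    using xy inj_on_eq_iff[OF assms(1) xy(3,4)] e'(2)
    by (intro exI[of _ "f x"] exI[of _ "f y"]) (simp add: relabel_def)
qed

lemma bounded_degree_graph_relabel:
  assumes inj: "inj_on f (verts G)" and G: "bounded_degree_graph G d" and simple: "simple_edges G"
  shows "bounded_degree_graph (relabel f G) d"
proof -
  interpret bounded_degree_graph G d by fact
  have iso: "is_rooted_iso f G (relabel f G)" by (rule is_rooted_iso_relabel[OF inj simple])
  have edge: "x \<in> verts (relabel f G) \<and> y \<in> verts (relabel f G) \<and> x \<noteq> y"
    if "{x, y} \<in> edges (relabel f G)" for x y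
    using simple_edges_relabel[OF inj simple] that by (fastforce simp: simple_edges_def doubleton_eq_iff)
  have deg: "finite (nbrs (relabel f G) q) \<and> card (nbrs (relabel f G) q) \<le> d" if q: "q \<in> verts (relabel f G)" for q
  proof -
    obtain x where x: "x \<in> verts G" "q = f x" using q by (auto simp: relabel_def)
    have "nbrs (relabel f G) q = f ` nbrs G x"
      unfolding x(2) using edgeD edge by (intro is_rooted_iso_nbrs[OF iso x(1)]) blast+
    then show ?thesis
      using card_image_le[OF finite_nbrs, of f x] card_nbrs_le[of x] by auto
  qed
  have "base (relabel f G) \<in> verts (relabel f G)" using base_in_verts by (simp add: relabel_def)
  then show ?thesis
    by unfold_locales (assumption, erule edge, erule deg, rule degree_pos)
qed

lemma spectral_distribution_relabel:
  assumes "inj_on f (verts G)" "bounded_degree_graph G d" "simple_edges G"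
  shows "spectral_distribution (relabel f G) \<mu> \<longleftrightarrow> spectral_distribution G \<mu>"
  using spectral_distribution_iso[OF is_rooted_iso_relabel[OF assms(1,3)] assms(2)
      bounded_degree_graph_relabel[OF assms]] by blast

section \<open>Neighbourhoods, resolvents and K-transforms of star and orthogonal products\<close>

lemma base_star_prod [simp]: "base (star_prod G H) = (base G, base H)"
  and base_orth_prod [simp]: "base (orth_prod G H) = (base G, base H)"
  by (simp_all add: star_prod_def orth_prod_def)

lemma simple_edges_orth_prod:
  assumes "simple_edges G" "simple_edges H" "base H \<in> verts H"
  shows "simple_edges (orth_prod G H)"
  unfolding simple_edges_def
proof
  fix e assume "e \<in> edges (orth_prod G H)"
  then consider x x' where "e = {(x, base H), (x', base H)}" "{x, x'} \<in> edges G"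
    | x y y' where "e = {(x, y), (x, y')}" "x \<in> verts G" "x \<noteq> base G" "{y, y'} \<in> edges H"
    by (auto simp: orth_prod_def)
  then show "\<exists>x y. e = {x, y} \<and> x \<noteq> y \<and> x \<in> verts (orth_prod G H) \<and> y \<in> verts (orth_prod G H)"
  proof cases
    case 1
    then have "x \<noteq> x'" "x \<in> verts G" "x' \<in> verts G"
      using assms(1) by (fastforce simp: simple_edges_def doubleton_eq_iff)+
    then show ?thesis using 1 assms(3) by (intro exI[of _ "(x, base H)"] exI[of _ "(x', base H)"]) (auto simp: orth_prod_def)
  next
    case 2
    then have "y \<noteq> y'" "y \<in> verts H" "y' \<in> verts H"
      using assms(2) by (fastforce simp: simple_edges_def doubleton_eq_iff)+
    then show ?thesis using 2 by (intro exI[of _ "(x, y)"] exI[of _ "(x, y')"]) (auto simp: orth_prod_def)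
  qed
qed

lemma doubleton_mem_edges_orth_prod:
  "{(x, y), (x', y')} \<in> edges (orth_prod G H) \<longleftrightarrow> y = base H \<and> y' = base H \<and> {x, x'} \<in> edges G \<or>
     x \<in> verts G \<and> x \<noteq> base G \<and> x' = x \<and> {y, y'} \<in> edges H" (is "?L \<longleftrightarrow> ?R")
proof
  assume ?L then show ?R by (auto simp: orth_prod_def doubleton_eq_iff insert_commute)
next
  assume ?R then show ?L unfolding orth_prod_def by simp blast
qed

lemma doubleton_mem_edges_star_prod:
  "{(x, y), (x', y')} \<in> edges (star_prod G H) \<longleftrightarrow> y = base H \<and> y' = base H \<and> {x, x'} \<in> edges G \<or>
     x = base G \<and> x' = base G \<and> {y, y'} \<in> edges H" (is "?L \<longleftrightarrow> ?R")
proof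
  assume ?L then show ?R by (auto simp: star_prod_def doubleton_eq_iff insert_commute)
next
  assume ?R then show ?L unfolding star_prod_def by simp blast
qed

lemma nbrs_orth_prod:
  "nbrs (orth_prod G H) (x, y) = (if y = base H then (\<lambda>x'. (x', base H)) ` nbrs G x else {}) \<union>
     (if x \<in> verts G \<and> x \<noteq> base G then Pair x ` nbrs H y else {})"
  unfolding nbrs_def set_eq_iff by (simp add: split_paired_all doubleton_mem_edges_orth_prod image_iff) blast

lemma nbrs_star_prod:
  "nbrs (star_prod G H) (x, y) = (if y = base H then (\<lambda>x'. (x', base H)) ` nbrs G x else {}) \<union>
     (if x = base G then Pair x ` nbrs H y else {})"
  unfolding nbrs_def set_eq_iff by (simp add: split_paired_all doubleton_mem_edges_star_prod image_iff) blast

locale two_graphs = G: bounded_degree_graph G d + H: bounded_degree_graph H d'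
  for G :: "'a rgraph" and d and H :: "'b rgraph" and d'
begin

text \<open>Serves both products through the conditions \<open>P\<close> and \<open>Q\<close>. The
  two parts are disjoint because a step in the first graph changes the first coordinate.\<close>

lemma product_nbrs_sum:
  fixes f :: "'a \<times> 'b \<Rightarrow> 'c :: comm_monoid_add"
  shows "(\<Sum>q\<in>(if P then (\<lambda>x'. (x', b)) ` nbrs G x else {}) \<union> (if Q then Pair x ` nbrs H y else {}). f q)
    = (if P then \<Sum>x'\<in>nbrs G x. f (x', b) else 0) + (if Q then \<Sum>y'\<in>nbrs H y. f (x, y') else 0)"
proof -
  have "(\<lambda>x'. (x', b)) ` nbrs G x \<inter> Pair x ` nbrs H y = {}"
    using G.not_in_nbrs_self by auto
  then show ?thesis
    by (subst sum.union_disjoint) (auto simp: sum.reindex inj_on_def)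
qed

lemma product_nbrs_finite_card:
  "finite ((if P then (\<lambda>x'. (x', b)) ` nbrs G x else {}) \<union> (if Q then Pair x ` nbrs H y else {})) \<and>
   card ((if P then (\<lambda>x'. (x', b)) ` nbrs G x else {}) \<union> (if Q then Pair x ` nbrs H y else {})) \<le> d + d'"
  (is "finite (?A \<union> ?B) \<and> _")
proof -
  have "card ?A \<le> d" "card ?B \<le> d'"
    using card_image_le[OF G.finite_nbrs, of "\<lambda>x'. (x', b)" x] G.card_nbrs_le[of x]
      card_image_le[OF H.finite_nbrs, of "Pair x" y] H.card_nbrs_le[of y] by auto
  then show ?thesis using card_Un_le[of ?A ?B] by auto
qed

lemma bounded_degree_graph_orth_prod: "bounded_degree_graph (orth_prod G H) (d + d')"
proof
  show "base (orth_prod G H) \<in> verts (orth_prod G H)" by (simp add: orth_prod_def)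
  fix p q assume "{p, q} \<in> edges (orth_prod G H)"
  then consider x x' where "p = (x, base H)" "q = (x', base H)" "{x, x'} \<in> edges G"
    | x y y' where "p = (x, y)" "q = (x, y')" "x \<in> verts G" "x \<noteq> base G" "{y, y'} \<in> edges H"
    by (auto simp: orth_prod_def doubleton_eq_iff insert_commute)
  then show "p \<in> verts (orth_prod G H) \<and> q \<in> verts (orth_prod G H) \<and> p \<noteq> q"
  proof cases
    case 1
    then show ?thesis using G.edgeD[OF 1(3)] H.base_in_verts by (simp add: orth_prod_def)
  next
    case 2
    then show ?thesis using H.edgeD[OF 2(5)] by (simp add: orth_prod_def)
  qed
next
  fix p show "finite (nbrs (orth_prod G H) p) \<and> card (nbrs (orth_prod G H) p) \<le> d + d'"
    using product_nbrs_finite_card by (cases p) (simp only: nbrs_orth_prod)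
qed (use G.degree_pos in simp)

lemma bounded_degree_graph_star_prod: "bounded_degree_graph (star_prod G H) (d + d')"
proof
  show "base (star_prod G H) \<in> verts (star_prod G H)" using G.base_in_verts by (simp add: star_prod_def)
  fix p q assume "{p, q} \<in> edges (star_prod G H)"
  then consider x x' where "p = (x, base H)" "q = (x', base H)" "{x, x'} \<in> edges G"
    | y y' where "p = (base G, y)" "q = (base G, y')" "{y, y'} \<in> edges H"
    by (auto simp: star_prod_def doubleton_eq_iff insert_commute)
  then show "p \<in> verts (star_prod G H) \<and> q \<in> verts (star_prod G H) \<and> p \<noteq> q"
  proof cases
    case 1
    then show ?thesis using G.edgeD[OF 1(3)] by (simp add: star_prod_def)
  next
    case 2
    then show ?thesis using H.edgeD[OF 2(3)] by (simp add: star_prod_def)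
  qed
next
  fix p show "finite (nbrs (star_prod G H) p) \<and> card (nbrs (star_prod G H) p) \<le> d + d'"
    using product_nbrs_finite_card by (cases p) (simp only: nbrs_star_prod)
qed (use G.degree_pos in simp)

text \<open>At (x, e) with x off the root, the attached copy of \<open>H\<close> contributes K(z)
  u(x) for its own K, and the copy of \<open>G\<close> contributes w u(x); these add up to z u(x)
  exactly when w is the reciprocal Cauchy transform of \<open>H\<close> at z. Deeper inside a copy
  of \<open>H\<close> the factor u(x) is constant.\<close>

lemma resolvent_sol_orth_prod:
  assumes u: "resolvent_sol G w u" and v: "resolvent_sol H z v"
    and w: "w = z - (\<Sum>y\<in>nbrs H (base H). v y)"
  shows "resolvent_sol (orth_prod G H) z (\<lambda>(x, y). u x * v y)"
proof -
  have u1: "u (base G) = 1" and v1: "v (base H) = 1" using u v by (auto simp: resolvent_sol_def)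
  have "(\<Sum>q\<in>nbrs (orth_prod G H) (x, y). case q of (x, y) \<Rightarrow> u x * v y) = z * (u x * v y)"
    if "(x, y) \<in> verts (orth_prod G H)" "(x, y) \<noteq> base (orth_prod G H)" for x y
  proof -
    have xy: "x \<in> verts G" "x \<noteq> base G" "y \<in> verts H"
      using that H.base_in_verts by (auto simp: orth_prod_def)
    have "(\<Sum>x'\<in>nbrs G x. u x') = w * u x" using u xy by (simp add: resolvent_sol_def)
    moreover have "(\<Sum>y'\<in>nbrs H y. v y') = z * v y" if "y \<noteq> base H"
      using v xy that by (simp add: resolvent_sol_def)
    ultimately show ?thesis
      unfolding nbrs_orth_prod product_nbrs_sum using xy
      by (auto simp: v1 w sum_distrib_left[symmetric] sum_distrib_right[symmetric] algebra_simps)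
  qed
  moreover have "norm (u x * v y) \<le> 1" if "(x, y) \<in> verts (orth_prod G H)" for x y
    using that u v G.base_in_verts H.base_in_verts
    by (auto simp: orth_prod_def resolvent_sol_def norm_mult intro: mult_le_one)
  ultimately show ?thesis
    by (auto simp: resolvent_sol_def u1 v1)
qed

text \<open>On either copy the other factor is 1, and off the common root only edges of that copy
  occur.\<close>

lemma resolvent_sol_star_prod:
  assumes u: "resolvent_sol G z u" and v: "resolvent_sol H z v"
  shows "resolvent_sol (star_prod G H) z (\<lambda>(x, y). u x * v y)"
proof -
  have u1: "u (base G) = 1" and v1: "v (base H) = 1" using u v by (auto simp: resolvent_sol_def)
  have "(\<Sum>q\<in>nbrs (star_prod G H) (x, y). case q of (x, y) \<Rightarrow> u x * v y) = z * (u x * v y)"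
    if "(x, y) \<in> verts (star_prod G H)" "(x, y) \<noteq> base (star_prod G H)" for x y
    using that u v unfolding nbrs_star_prod product_nbrs_sum
    by (auto simp: u1 v1 star_prod_def resolvent_sol_def)
  moreover have "norm (u x * v y) \<le> 1" if "(x, y) \<in> verts (star_prod G H)" for x y
    using that u v by (auto simp: star_prod_def resolvent_sol_def u1 v1)
  ultimately show ?thesis
    by (auto simp: resolvent_sol_def u1 v1)
qed

lemma K_trans_orth_prod:
  assumes \<mu>: "spectral_distribution G \<mu>" and \<nu>: "spectral_distribution H \<nu>"
    and \<rho>: "spectral_distribution (orth_prod G H) \<rho>" and "Im z > 0"
  shows "K_trans \<rho> z = K_trans \<mu> (recip_F \<nu> z)"
proof -
  interpret \<mu>: bounded_distribution \<mu> d by (rule G.spectral_distribution_bounded) fact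
  interpret \<nu>: bounded_distribution \<nu> d' by (rule H.spectral_distribution_bounded) fact
  interpret P: bounded_degree_graph "orth_prod G H" "d + d'" by (rule bounded_degree_graph_orth_prod)
  interpret \<rho>: bounded_distribution \<rho> "real (d + d')" by (rule P.spectral_distribution_bounded) fact
  show ?thesis
  proof (rule holomorphic_eq_upper_half_plane[where f = "K_trans \<rho>" and g = "\<lambda>z. K_trans \<mu> (recip_F \<nu> z)"])
    show "K_trans \<rho> holomorphic_on {z. Im z > 0}" by (rule \<rho>.K_trans_holomorphic)
    show "(\<lambda>z. K_trans \<mu> (recip_F \<nu> z)) holomorphic_on {z. Im z > 0}"
      using holomorphic_on_compose_gen[OF \<nu>.recip_F_holomorphic \<mu>.K_trans_holomorphic] \<nu>.Im_recip_F_pos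
      by (auto simp: o_def)
  next
    fix z assume z: "Im z > 0" "norm z > real (d + d')"
    let ?w = "recip_F \<nu> z"
    have z': "norm z > real d'" using z(2) by simp
    have w0: "Im ?w > 0" by (rule \<nu>.Im_recip_F_pos[OF z(1)])
    have "norm (K_trans \<nu> z) \<le> real d'" by (rule H.norm_K_trans_le[OF \<nu> z' z(1)])
    \<comment> \<open>From |z| > d + d' and |K(z)| at most d'; hence the threshold d + d' also makes
      the subordinated point admissible for \<open>G\<close>.\<close>
    then have w: "norm ?w > real d"
      using z(2) norm_triangle_ineq2[of z "K_trans \<nu> z"] by (simp add: K_trans_def)
    obtain v where v: "resolvent_sol H z v"
      by (rule H.ex_resolvent_sol[OF \<nu> z' \<nu>.cauchy_G_nonzero[OF z(1)]])
    have w_eq: "?w = z - (\<Sum>y\<in>nbrs H (base H). v y)"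
      unfolding H.resolvent_sol_K_trans[OF \<nu> z' v, symmetric] by (simp add: K_trans_def)
    obtain u where u: "resolvent_sol G ?w u"
      by (rule G.ex_resolvent_sol[OF \<mu> w \<mu>.cauchy_G_nonzero[OF w0]])
    have "K_trans \<rho> z = (\<Sum>q\<in>nbrs (orth_prod G H) (base G, base H). case q of (x, y) \<Rightarrow> u x * v y)"
      using P.resolvent_sol_K_trans[OF \<rho> z(2) resolvent_sol_orth_prod[OF u v w_eq]] by simp
    \<comment> \<open>No copy of \<open>H\<close> is attached at the root, so only the neighbours in
      \<open>G\<close> remain, each with second factor 1.\<close>
    also have "\<dots> = (\<Sum>x\<in>nbrs G (base G). u x)"
      unfolding nbrs_orth_prod product_nbrs_sum using v by (simp add: resolvent_sol_def)
    also have "\<dots> = K_trans \<mu> ?w"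
      by (rule G.resolvent_sol_K_trans[OF \<mu> w u, symmetric])
    finally show "K_trans \<rho> z = K_trans \<mu> ?w" .
  qed fact
qed

lemma K_trans_star_prod:
  assumes \<mu>: "spectral_distribution G \<mu>" and \<nu>: "spectral_distribution H \<nu>"
    and \<rho>: "spectral_distribution (star_prod G H) \<rho>" and "Im z > 0"
  shows "K_trans \<rho> z = K_trans \<mu> z + K_trans \<nu> z"
proof -
  interpret \<mu>: bounded_distribution \<mu> d by (rule G.spectral_distribution_bounded) fact
  interpret \<nu>: bounded_distribution \<nu> d' by (rule H.spectral_distribution_bounded) fact
  interpret P: bounded_degree_graph "star_prod G H" "d + d'" by (rule bounded_degree_graph_star_prod)
  interpret \<rho>: bounded_distribution \<rho> "real (d + d')" by (rule P.spectral_distribution_bounded) fact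
  show ?thesis
  proof (rule holomorphic_eq_upper_half_plane[where f = "K_trans \<rho>" and g = "\<lambda>z. K_trans \<mu> z + K_trans \<nu> z"])
    show "K_trans \<rho> holomorphic_on {z. Im z > 0}" by (rule \<rho>.K_trans_holomorphic)
    show "(\<lambda>z. K_trans \<mu> z + K_trans \<nu> z) holomorphic_on {z. Im z > 0}"
      by (intro holomorphic_intros \<mu>.K_trans_holomorphic \<nu>.K_trans_holomorphic)
  next
    fix z assume z: "Im z > 0" "norm z > real (d + d')"
    have z': "norm z > real d" "norm z > real d'" using z(2) by simp_all
    obtain u where u: "resolvent_sol G z u"
      by (rule G.ex_resolvent_sol[OF \<mu> z'(1) \<mu>.cauchy_G_nonzero[OF z(1)]])
    obtain v where v: "resolvent_sol H z v"
      by (rule H.ex_resolvent_sol[OF \<nu> z'(2) \<nu>.cauchy_G_nonzero[OF z(1)]])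
    have "K_trans \<rho> z = (\<Sum>q\<in>nbrs (star_prod G H) (base G, base H). case q of (x, y) \<Rightarrow> u x * v y)"
      using P.resolvent_sol_K_trans[OF \<rho> z(2) resolvent_sol_star_prod[OF u v]] by simp
    also have "\<dots> = (\<Sum>x\<in>nbrs G (base G). u x) + (\<Sum>y\<in>nbrs H (base H). v y)"
      unfolding nbrs_star_prod product_nbrs_sum using u v by (simp add: resolvent_sol_def)
    also have "\<dots> = K_trans \<mu> z + K_trans \<nu> z"
      using G.resolvent_sol_K_trans[OF \<mu> z'(1) u] H.resolvent_sol_K_trans[OF \<nu> z'(2) v] by simp
    finally show "K_trans \<rho> z = K_trans \<mu> z + K_trans \<nu> z" .
  qed fact
qed

lemma spectral_distribution_orth_prod:
  assumes "spectral_distribution G \<mu>" "spectral_distribution H \<nu>"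
  shows "spectral_distribution (orth_prod G H) (orth_conv \<mu> \<nu>)"
proof -
  interpret P: bounded_degree_graph "orth_prod G H" "d + d'" by (rule bounded_degree_graph_orth_prod)
  obtain \<rho> where \<rho>: "spectral_distribution (orth_prod G H) \<rho>" using P.ex_spectral_distribution ..
  have "orth_conv \<mu> \<nu> = \<rho>"
    by (rule orth_conv_eqI[OF P.spectral_distribution_bounded[OF \<rho>] K_trans_orth_prod[OF assms \<rho>]])
  then show ?thesis using \<rho> by simp
qed

lemma spectral_distribution_star_prod:
  assumes "spectral_distribution G \<mu>" "spectral_distribution H \<nu>"
  shows "spectral_distribution (star_prod G H) (boolean_conv \<mu> \<nu>)"
proof -
  interpret P: bounded_degree_graph "star_prod G H" "d + d'" by (rule bounded_degree_graph_star_prod)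
  obtain \<rho> where \<rho>: "spectral_distribution (star_prod G H) \<rho>" using P.ex_spectral_distribution ..
  have "boolean_conv \<mu> \<nu> = \<rho>"
    by (rule boolean_conv_eqI[OF P.spectral_distribution_bounded[OF \<rho>] K_trans_star_prod[OF assms \<rho>]])
  then show ?thesis using \<rho> by simp
qed

end

section \<open>Free products\<close>

text \<open>One of the two alphabets of a free product: \<open>\<iota>\<close> embeds the vertices of \<open>G\<close> into the
  letters and \<open>W\<close> is the set of all words. Every word is uniquely a vertex of a copy of \<open>G\<close>,
  with \<open>first w\<close> the vertex and \<open>rest w\<close> the word by which the copy is indexed.\<close>

locale word_component =
  fixes \<iota> :: "'a \<Rightarrow> 'c" and G :: "'a rgraph" and W :: "'c list set"
  assumes inj_letter: "inj \<iota>"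
    and Cons_mem_iff: "\<iota> a # u \<in> W \<longleftrightarrow> a \<in> verts G \<and> a \<noteq> base G \<and> u \<in> W \<and> (u = [] \<or> hd u \<notin> range \<iota>)"
    and base_vertex: "base G \<in> verts G"
    and edge_verts: "{x, y} \<in> edges G \<Longrightarrow> x \<in> verts G \<and> y \<in> verts G \<and> x \<noteq> y"
begin

definition letter :: "'a \<Rightarrow> 'c list" where
  "letter v = (if v = base G then [] else [\<iota> v])"

definition first :: "'c list \<Rightarrow> 'a" where
  "first w = (if w \<noteq> [] \<and> hd w \<in> range \<iota> then inv \<iota> (hd w) else base G)"

definition rest :: "'c list \<Rightarrow> 'c list" where
  "rest w = (if w \<noteq> [] \<and> hd w \<in> range \<iota> then tl w else w)"

definition word_edges :: "'c list set set" where
  "word_edges = {{letter v @ u, letter v' @ u} | v v' u. {v, v'} \<in> edges G \<and>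
     u \<in> W \<and> letter v @ u \<in> W \<and> letter v' @ u \<in> W}"

lemma letter_inject: "letter v = letter v' \<longleftrightarrow> v = v'"
  using inj_letter by (auto simp: letter_def inj_eq)

lemma first_rest_letter:
  "u = [] \<or> hd u \<notin> range \<iota> \<Longrightarrow> first (letter v @ u) = v \<and> rest (letter v @ u) = u"
  using inj_letter by (auto simp: letter_def first_def rest_def)

lemma word_decomposition:
  assumes "w \<in> W"
  shows "letter (first w) @ rest w = w" "first w \<in> verts G" "rest w \<in> W" "rest w = [] \<or> hd (rest w) \<notin> range \<iota>"
proof -
  have "letter (first w) @ rest w = w \<and> first w \<in> verts G \<and> rest w \<in> W \<and> (rest w = [] \<or> hd (rest w) \<notin> range \<iota>)"
  proof (cases "w \<noteq> [] \<and> hd w \<in> range \<iota>")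
    case True
    then obtain a u where w: "w = \<iota> a # u" by (cases w) auto
    then have "first w = a" "rest w = u" using inj_letter by (auto simp: first_def rest_def)
    moreover have "a \<in> verts G" "a \<noteq> base G" "u \<in> W" "u = [] \<or> hd u \<notin> range \<iota>"
      using assms unfolding w Cons_mem_iff by simp_all
    ultimately show ?thesis by (simp add: letter_def w)
  next
    case False
    then have "first w = base G" "rest w = w" by (auto simp: first_def rest_def)
    then show ?thesis using False assms base_vertex by (auto simp: letter_def)
  qed
  then show "letter (first w) @ rest w = w" "first w \<in> verts G" "rest w \<in> W" "rest w = [] \<or> hd (rest w) \<notin> range \<iota>"
    by blast+
qed

lemma letter_append_mem:
  assumes "v \<in> verts G" "u \<in> W" "u = [] \<or> hd u \<notin> range \<iota>"
  shows "letter v @ u \<in> W"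
  using assms by (auto simp: letter_def Cons_mem_iff)

lemma word_edges_iff:
  "{w, q} \<in> word_edges \<longleftrightarrow> w \<in> W \<and> q \<in> (\<lambda>v. letter v @ rest w) ` nbrs G (first w)"
proof
  assume "{w, q} \<in> word_edges"
  then obtain v v' u where e: "w = letter v @ u" "q = letter v' @ u" "{v, v'} \<in> edges G" "u \<in> W" "w \<in> W" "q \<in> W"
    unfolding word_edges_def by (auto simp: doubleton_eq_iff insert_commute)
  then have "u = [] \<or> hd u \<notin> range \<iota>"
    using edge_verts[OF e(3)] by (auto simp: letter_def Cons_mem_iff split: if_splits)
  from first_rest_letter[OF this, of v] e show "w \<in> W \<and> q \<in> (\<lambda>v. letter v @ rest w) ` nbrs G (first w)"
    by (auto simp: nbrs_def)
next
  assume "w \<in> W \<and> q \<in> (\<lambda>v. letter v @ rest w) ` nbrs G (first w)"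
  then obtain v' where w: "w \<in> W" and v': "{first w, v'} \<in> edges G" "q = letter v' @ rest w"
    by (auto simp: nbrs_def)
  note d = word_decomposition[OF w]
  have "q \<in> W" unfolding v' using edge_verts[OF v'(1)] d(3,4) by (intro letter_append_mem) auto
  then show "{w, q} \<in> word_edges"
    unfolding word_edges_def mem_Collect_eq using d(1,3) w v'
    by (intro exI[of _ "rest w"] exI[of _ v'] exI[of _ "first w"]) simp
qed

text \<open>The two ends of an edge differ, so at least one of them contributes a letter, and
  membership of that word forces \<open>u\<close> not to begin in the same alphabet.\<close>

lemma word_edges_eq: "word_edges = {{letter v @ u, letter v' @ u} | v v' u. {v, v'} \<in> edges G \<and>
    u \<in> W \<and> (u = [] \<or> hd u \<notin> range \<iota>)}"
proof -
  have "letter v @ u \<in> W \<and> letter v' @ u \<in> W \<longleftrightarrow> u = [] \<or> hd u \<notin> range \<iota>"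
    if "{v, v'} \<in> edges G" "u \<in> W" for v v' u
    using edge_verts[OF that(1)] that(2) by (auto simp: letter_def Cons_mem_iff)
  then have "{v, v'} \<in> edges G \<and> u \<in> W \<and> letter v @ u \<in> W \<and> letter v' @ u \<in> W \<longleftrightarrow>
      {v, v'} \<in> edges G \<and> u \<in> W \<and> (u = [] \<or> hd u \<notin> range \<iota>)" for v v' u
    by blast
  then show ?thesis unfolding word_edges_def by (simp only:)
qed

text \<open>Inside its copy of \<open>G\<close> a word is off the root exactly when it begins with a
  letter of \<open>G\<close>: then the resolvent equation gives the factor z, otherwise the
  neighbours of the root give K. The factor of \<open>rest w\<close> is common to the copy.\<close>

lemma sum_word_nbrs:
  fixes V :: "'c list \<Rightarrow> complex"
  assumes V: "\<And>v u. V (letter v @ u) = f v * V u" and f: "resolvent_sol G z f" and w: "w \<in> W"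
  shows "(\<Sum>q\<in>(\<lambda>v. letter v @ rest w) ` nbrs G (first w). V q)
    = (if w \<noteq> [] \<and> hd w \<in> range \<iota> then z else \<Sum>v\<in>nbrs G (base G). f v) * V w"
proof -
  note d = word_decomposition[OF w]
  have "(\<Sum>q\<in>(\<lambda>v. letter v @ rest w) ` nbrs G (first w). V q) = (\<Sum>v\<in>nbrs G (first w). f v) * V (rest w)"
    by (subst sum.reindex) (auto simp: inj_on_def letter_inject V sum_distrib_right)
  moreover have "V w = f (first w) * V (rest w)"
    using V[of "first w" "rest w"] d(1) by simp
  moreover have "first w \<noteq> base G" if "w \<noteq> [] \<and> hd w \<in> range \<iota>"
  proof
    assume "first w = base G"
    then have "rest w = w" using d(1) by (simp add: letter_def)
    then show False using that d(4) by auto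
  qed
  moreover have "first w = base G" if "\<not> (w \<noteq> [] \<and> hd w \<in> range \<iota>)"
    using that by (auto simp: first_def)
  ultimately show ?thesis
    using f d(2) by (auto simp: resolvent_sol_def)
qed

end

lemma free_words_Nil: "[] \<in> free_words G1 G2"
  by (simp add: free_words_def)

lemma free_words_Cons: "x # u \<in> free_words G1 G2 \<longleftrightarrow>
    (case x of Inl a \<Rightarrow> a \<in> verts G1 \<and> a \<noteq> base G1 | Inr b \<Rightarrow> b \<in> verts G2 \<and> b \<noteq> base G2) \<and>
    u \<in> free_words G1 G2 \<and> (u = [] \<or> isl x \<noteq> isl (hd u))"
  by (cases u) (auto simp: free_words_def split: sum.splits)

lemma range_Inl_iff: "x \<in> range Inl \<longleftrightarrow> isl x" and range_Inr_iff: "x \<in> range Inr \<longleftrightarrow> \<not> isl x"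
  by (cases x; auto)+

locale word_pair =
  fixes G :: "'a rgraph" and H :: "'b rgraph"
  assumes base_vertices: "base G \<in> verts G" "base H \<in> verts H"
    and edges_left: "{x, x'} \<in> edges G \<Longrightarrow> x \<in> verts G \<and> x' \<in> verts G \<and> x \<noteq> x'"
    and edges_right: "{y, y'} \<in> edges H \<Longrightarrow> y \<in> verts H \<and> y' \<in> verts H \<and> y \<noteq> y'"
begin

sublocale L: word_component Inl G "free_words G H"
  by unfold_locales (auto simp: free_words_Cons range_Inl_iff base_vertices dest: edges_left)

sublocale R: word_component Inr H "free_words G H"
  by unfold_locales (auto simp: free_words_Cons range_Inr_iff base_vertices dest: edges_right)

lemma edges_free_prod: "edges (free_prod G H) = L.word_edges \<union> R.word_edges"
  unfolding free_prod_def L.word_edges_def R.word_edges_def L.letter_def R.letter_def letter1_def letter2_def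
  by simp

end

section \<open>Neighbourhoods and resolvents of the free product\<close>

context two_graphs
begin

sublocale word_pair G H
  by unfold_locales (auto simp: G.base_in_verts H.base_in_verts dest: G.edgeD H.edgeD)

lemma nbrs_free_prod: "nbrs (free_prod G H) w = (if w \<in> free_words G H
    then (\<lambda>v. L.letter v @ L.rest w) ` nbrs G (L.first w) \<union> (\<lambda>v. R.letter v @ R.rest w) ` nbrs H (R.first w) else {})"
  by (auto simp: nbrs_def edges_free_prod L.word_edges_iff[unfolded nbrs_def] R.word_edges_iff[unfolded nbrs_def])

text \<open>A nonempty word is the root of its copy of the alphabet it does not begin with, so
  neighbours there are longer by one, while those in the other copy are not longer. For the empty
  word the first letters differ.\<close>

lemma free_nbrs_disjoint:
  "(\<lambda>v. L.letter v @ L.rest w) ` nbrs G (L.first w) \<inter> (\<lambda>v. R.letter v @ R.rest w) ` nbrs H (R.first w) = {}"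
proof -
  have False if eq: "L.letter a @ L.rest w = R.letter b @ R.rest w"
    and ab: "a \<in> nbrs G (L.first w)" "b \<in> nbrs H (R.first w)" for a b
  proof (cases "w \<noteq> [] \<and> isl (hd w)")
    case True
    then have "R.first w = base H" "R.rest w = w" "L.rest w = tl w"
      by (auto simp: R.first_def R.rest_def L.rest_def range_Inl_iff range_Inr_iff)
    moreover from this have "b \<noteq> base H" using ab(2) H.not_in_nbrs_self by auto
    ultimately have "length (L.letter a @ tl w) = Suc (length w)"
      using eq by (simp add: R.letter_def)
    then show False using True by (cases w) (auto simp: L.letter_def split: if_splits)
  next
    case False
    then have "L.first w = base G" "L.rest w = w"
      by (auto simp: L.first_def L.rest_def range_Inl_iff)
    moreover from this have "a \<noteq> base G" using ab(1) G.not_in_nbrs_self by auto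
    ultimately have w': "Inl a # w = R.letter b @ R.rest w"
      using eq by (simp add: L.letter_def)
    show False
    proof (cases "w = []")
      case True
      then show False using w' by (auto simp: R.letter_def R.rest_def split: if_splits)
    next
      case nonempty: False
      with False have "R.rest w = tl w" by (simp add: R.rest_def range_Inr_iff)
      then have "length (R.letter b @ tl w) = Suc (length w)"
        using arg_cong[OF w', of length] by simp
      then show False using nonempty by (cases w) (auto simp: R.letter_def split: if_splits)
    qed
  qed
  then show ?thesis by blast
qed

lemma bounded_degree_graph_free_prod: "bounded_degree_graph (free_prod G H) (d + d')"
proof
  show "base (free_prod G H) \<in> verts (free_prod G H)" by (simp add: free_prod_def free_words_Nil)
next
  fix w q assume e: "{w, q} \<in> edges (free_prod G H)"
  then have "w \<in> free_words G H" "q \<in> free_words G H"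
    using L.word_edges_iff[of w q] L.word_edges_iff[of q w] R.word_edges_iff[of w q] R.word_edges_iff[of q w]
    by (auto simp: edges_free_prod insert_commute)
  moreover have "w \<noteq> q"
  proof
    assume "w = q"
    with e consider "{w, w} \<in> L.word_edges" | "{w, w} \<in> R.word_edges" by (auto simp: edges_free_prod)
    then show False
    proof cases
      case 1
      then obtain v where v: "v \<in> nbrs G (L.first w)" "w = L.letter v @ L.rest w" "w \<in> free_words G H"
        unfolding L.word_edges_iff by blast
      from L.word_decomposition(1)[OF v(3)] v(2) have "L.letter (L.first w) @ L.rest w = L.letter v @ L.rest w" by simp
      then show False using v(1) G.not_in_nbrs_self by (simp add: L.letter_inject)
    next
      case 2
      then obtain v where v: "v \<in> nbrs H (R.first w)" "w = R.letter v @ R.rest w" "w \<in> free_words G H"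
        unfolding R.word_edges_iff by blast
      from R.word_decomposition(1)[OF v(3)] v(2) have "R.letter (R.first w) @ R.rest w = R.letter v @ R.rest w" by simp
      then show False using v(1) H.not_in_nbrs_self by (simp add: R.letter_inject)
    qed
  qed
  ultimately show "w \<in> verts (free_prod G H) \<and> q \<in> verts (free_prod G H) \<and> w \<noteq> q"
    by (simp add: free_prod_def)
next
  fix w
  let ?A = "(\<lambda>v. L.letter v @ L.rest w) ` nbrs G (L.first w)" and ?B = "(\<lambda>v. R.letter v @ R.rest w) ` nbrs H (R.first w)"
  have "finite (?A \<union> ?B)" by simp
  moreover have "card ?A \<le> d"
    using card_image_le[OF G.finite_nbrs] G.card_nbrs_le by (rule order.trans)
  moreover have "card ?B \<le> d'"
    using card_image_le[OF H.finite_nbrs] H.card_nbrs_le by (rule order.trans)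
  moreover have "card (?A \<union> ?B) \<le> card ?A + card ?B" by (rule card_Un_le)
  ultimately show "finite (nbrs (free_prod G H) w) \<and> card (nbrs (free_prod G H) w) \<le> d + d'"
    by (auto simp: nbrs_free_prod)
qed (use G.degree_pos in simp)

text \<open>At a word beginning with a letter of \<open>G\<close>, its own copy contributes z1 and
  the copy of \<open>H\<close> rooted there contributes K of \<open>H\<close>, and symmetrically.
  The hypotheses on \<open>z1\<close> and \<open>z2\<close> are thus the subordination equations,
  and at the empty word both K-values add.\<close>

lemma resolvent_sol_free_prod:
  assumes f: "resolvent_sol G z1 f" and g: "resolvent_sol H z2 g"
    and z: "z1 + (\<Sum>y\<in>nbrs H (base H). g y) = z" "(\<Sum>x\<in>nbrs G (base G). f x) + z2 = z"
  defines "V \<equiv> \<lambda>w. prod_list (map (case_sum f g) w)"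
  shows "resolvent_sol (free_prod G H) z V"
    and "(\<Sum>w\<in>nbrs (free_prod G H) (base (free_prod G H)). V w)
      = (\<Sum>x\<in>nbrs G (base G). f x) + (\<Sum>y\<in>nbrs H (base H). g y)"
proof -
  have f1: "f (base G) = 1" and g1: "g (base H) = 1" using f g by (auto simp: resolvent_sol_def)
  have VL: "V (L.letter v @ u) = f v * V u" and VR: "V (R.letter v' @ u) = g v' * V u" for v v' u
    by (simp_all add: V_def L.letter_def R.letter_def f1 g1)
  have sum: "(\<Sum>q\<in>nbrs (free_prod G H) w. V q)
      = (if w \<noteq> [] \<and> isl (hd w) then z1 else \<Sum>x\<in>nbrs G (base G). f x) * V w
      + (if w \<noteq> [] \<and> \<not> isl (hd w) then z2 else \<Sum>y\<in>nbrs H (base H). g y) * V w"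
    if w: "w \<in> free_words G H" for w
  proof -
    have "(\<Sum>q\<in>nbrs (free_prod G H) w. V q) = (\<Sum>q\<in>(\<lambda>v. L.letter v @ L.rest w) ` nbrs G (L.first w). V q)
        + (\<Sum>q\<in>(\<lambda>v. R.letter v @ R.rest w) ` nbrs H (R.first w). V q)"
      using w free_nbrs_disjoint by (simp add: nbrs_free_prod sum.union_disjoint)
    then show ?thesis
      by (simp only: L.sum_word_nbrs[where V = V, OF VL f w] R.sum_word_nbrs[where V = V, OF VR g w] range_Inl_iff range_Inr_iff)
  qed
  have base: "base (free_prod G H) = []" by (simp add: free_prod_def)
  show "(\<Sum>w\<in>nbrs (free_prod G H) (base (free_prod G H)). V w)
      = (\<Sum>x\<in>nbrs G (base G). f x) + (\<Sum>y\<in>nbrs H (base H). g y)"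
    unfolding base sum[OF free_words_Nil] by (simp add: V_def)
  have "norm (V w) \<le> 1" if "w \<in> free_words G H" for w
    using that
  proof (induction w)
    case (Cons x w)
    then have "norm (case_sum f g x) \<le> 1"
      using f g by (auto simp: free_words_Cons resolvent_sol_def split: sum.splits)
    moreover have "norm (V w) \<le> 1" using Cons by (simp add: free_words_Cons)
    ultimately show ?case by (simp add: V_def norm_mult mult_le_one)
  qed (simp add: V_def)
  moreover have "(\<Sum>q\<in>nbrs (free_prod G H) w. V q) = z * V w" if "w \<in> free_words G H" "w \<noteq> []" for w
    unfolding sum[OF that(1)] using that(2) z
    by (cases "isl (hd w)") (simp_all add: distrib_right[symmetric])
  ultimately show "resolvent_sol (free_prod G H) z V"
    by (simp add: resolvent_sol_def base) (simp add: free_prod_def V_def)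
qed

text \<open>With \<open>s = G(z)\<close> as a parameter, the subordination functions of the free product are
  \<open>R\<^sub>1(s) + 1/s\<close> and \<open>R\<^sub>2(s) + 1/s\<close>.\<close>

lemma is_R_transform_free_prod:
  assumes \<mu>: "spectral_distribution G \<mu>" "is_R_transform \<mu> R1"
    and \<nu>: "spectral_distribution H \<nu>" "is_R_transform \<nu> R2"
    and \<rho>: "spectral_distribution (free_prod G H) \<rho>"
  shows "is_R_transform \<rho> (\<lambda>s. R1 s + R2 s)"
proof -
  interpret P: bounded_degree_graph "free_prod G H" "d + d'" by (rule bounded_degree_graph_free_prod)
  have an: "R1 analytic_on {0}" "R2 analytic_on {0}" using \<mu>(2) \<nu>(2) by (auto simp: is_R_transform_def)
  then have an12: "(\<lambda>s. R1 s + R2 s) analytic_on {0}" by (intro analytic_intros)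
  \<comment> \<open>For s near 0 all three arguments lie beyond the degree bounds, where the
    resolvent lemmas apply.\<close>
  have large: "\<forall>\<^sub>F s in at 0. norm (R s + 1 / s) > D" if "R analytic_on {0}" for R :: "complex \<Rightarrow> complex" and D
    using filterlim_at_infinity_imp_norm_at_top[OF filterlim_add_inverse_at_0[OF analytic_at_imp_isCont]] that
    by (auto simp: filterlim_at_top_dense)
  have ev: "\<forall>\<^sub>F s in at 0. cauchy_G \<mu> (R1 s + 1 / s) = s" "\<forall>\<^sub>F s in at 0. cauchy_G \<nu> (R2 s + 1 / s) = s"
    using \<mu>(2) \<nu>(2) by (auto simp: is_R_transform_def)
  have "\<forall>\<^sub>F s in at (0::complex). s \<noteq> 0" by (simp add: eventually_at_filter)
  then have "\<forall>\<^sub>F s in at 0. cauchy_G \<rho> (R1 s + R2 s + 1 / s) = s"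
    using ev large[OF an(1), of d] large[OF an(2), of d'] large[OF an12, of "d + d'"]
  proof eventually_elim
    case (elim s)
    obtain f where f: "resolvent_sol G (R1 s + 1 / s) f"
      by (rule G.ex_resolvent_sol[OF \<mu>(1) elim(4)]) (use elim in auto)
    obtain g where g: "resolvent_sol H (R2 s + 1 / s) g"
      by (rule H.ex_resolvent_sol[OF \<nu>(1) elim(5)]) (use elim in auto)
    \<comment> \<open>The Cauchy transform of each factor is s at its point, so K there is (R(s) +
      1/s) - 1/s; this also makes the subordination equations automatic.\<close>
    have K: "(\<Sum>x\<in>nbrs G (base G). f x) = R1 s" "(\<Sum>y\<in>nbrs H (base H). g y) = R2 s"
      using G.resolvent_sol_K_trans[OF \<mu>(1) elim(4) f] H.resolvent_sol_K_trans[OF \<nu>(1) elim(5) g] elim(2,3)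
      by (simp_all add: K_trans_def recip_F_def)
    have z: "R1 s + 1 / s + (\<Sum>y\<in>nbrs H (base H). g y) = R1 s + R2 s + 1 / s"
      "(\<Sum>x\<in>nbrs G (base G). f x) + (R2 s + 1 / s) = R1 s + R2 s + 1 / s"
      by (simp_all add: K)
    have "cauchy_G \<rho> (R1 s + R2 s + 1 / s) * (R1 s + R2 s + 1 / s - (R1 s + R2 s)) = 1"
      using P.resolvent_sol_cauchy_G[OF \<rho> elim(6) resolvent_sol_free_prod(1)[OF f g z]]
      unfolding resolvent_sol_free_prod(2)[OF f g z] K .
    then show ?case using elim(1) by (simp add: field_simps)
  qed
  then show ?thesis using an12 by (simp add: is_R_transform_def)
qed

lemma spectral_distribution_free_prod:
  assumes \<mu>: "spectral_distribution G \<mu>" and \<nu>: "spectral_distribution H \<nu>"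
  shows "spectral_distribution (free_prod G H) (free_conv \<mu> \<nu>)"
proof -
  interpret \<mu>: bounded_distribution \<mu> d by (rule G.spectral_distribution_bounded) fact
  interpret \<nu>: bounded_distribution \<nu> d' by (rule H.spectral_distribution_bounded) fact
  interpret P: bounded_degree_graph "free_prod G H" "d + d'" by (rule bounded_degree_graph_free_prod)
  obtain \<rho> where \<rho>: "spectral_distribution (free_prod G H) \<rho>" using P.ex_spectral_distribution ..
  obtain R1 R2 where R: "is_R_transform \<mu> R1" "is_R_transform \<nu> R2"
    using \<mu>.ex_R_transform \<nu>.ex_R_transform by blast
  have "free_conv \<mu> \<nu> = \<rho>"
    by (rule free_conv_eqI[OF \<mu>.bounded_distribution_axioms R(1) \<nu>.bounded_distribution_axioms R(2)
        P.spectral_distribution_bounded[OF \<rho>] is_R_transform_free_prod[OF \<mu> R(1) \<nu> R(2) \<rho>]])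
  then show ?thesis using \<rho> by simp
qed

end

section \<open>Gluing and inductive limits\<close>

lemma simple_edges_rooted_graph:
  assumes "rooted_graph G" shows "simple_edges G" "base G \<in> verts G"
  using rooted_graph.simple[OF assms] rooted_graph.base_in_verts[OF assms] by (auto simp: simple_edges_def)

lemma simple_edgesD:
  assumes "simple_edges G" "{x, y} \<in> edges G"
  shows "x \<in> verts G" "y \<in> verts G" "x \<noteq> y"
  using assms by (fastforce simp: simple_edges_def doubleton_eq_iff)+

lemma is_rooted_isoI:
  assumes "inj_on f (verts G)" "f ` verts G = verts H" "(`) f ` edges G = edges H" "f (base G) = base H"
    and "simple_edges G"
  shows "is_rooted_iso f G H"
proof -
  have "{f x, f y} \<in> edges H \<longleftrightarrow> {x, y} \<in> edges G" if "x \<in> verts G" "y \<in> verts G" for x y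
    unfolding assms(3)[symmetric]
    by (rule image_doubleton_mem_iff[OF assms(1) simple_edges_subset[OF assms(5)] that])
  then show ?thesis using assms by (simp add: is_rooted_iso_def bij_betw_def)
qed

lemma is_rooted_iso_inverse:
  assumes iso: "is_rooted_iso f G H" and "base G \<in> verts G"
  shows "is_rooted_iso (inv_into (verts G) f) H G"
proof -
  let ?g = "inv_into (verts G) f"
  have bij: "bij_betw f (verts G) (verts H)" using iso by (simp add: is_rooted_iso_def)
  have g: "?g q \<in> verts G" "f (?g q) = q" if "q \<in> verts H" for q
    using that bij by (auto simp: bij_betw_def inv_into_into f_inv_into_f)
  have "{?g p, ?g q} \<in> edges G \<longleftrightarrow> {p, q} \<in> edges H" if "p \<in> verts H" "q \<in> verts H" for p q
    using iso g(1)[OF that(1)] g(1)[OF that(2)] g(2)[OF that(1)] g(2)[OF that(2)] by (simp add: is_rooted_iso_def)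
  moreover have "?g (base H) = base G"
  proof -
    have "base H = f (base G)" using iso by (simp add: is_rooted_iso_def)
    then show ?thesis using assms(2) bij by (simp add: bij_betw_def inv_into_f_f)
  qed
  ultimately show ?thesis
    using bij_betw_inv_into[OF bij] by (simp add: is_rooted_iso_def)
qed

lemma simple_edges_star_prod:
  assumes "simple_edges G" "simple_edges H"
  shows "simple_edges (star_prod G H)"
  unfolding simple_edges_def
proof
  fix e assume "e \<in> edges (star_prod G H)"
  then consider x x' where "e = {(x, base H), (x', base H)}" "{x, x'} \<in> edges G"
    | y y' where "e = {(base G, y), (base G, y')}" "{y, y'} \<in> edges H"
    by (auto simp: star_prod_def)
  then show "\<exists>x y. e = {x, y} \<and> x \<noteq> y \<and> x \<in> verts (star_prod G H) \<and> y \<in> verts (star_prod G H)"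
  proof cases
    case 1
    then show ?thesis using simple_edgesD[OF assms(1) 1(2)]
      by (intro exI[of _ "(x, base H)"] exI[of _ "(x', base H)"]) (simp add: star_prod_def)
  next
    case 2
    then show ?thesis using simple_edgesD[OF assms(2) 2(2)]
      by (intro exI[of _ "(base G, y)"] exI[of _ "(base G, y')"]) (simp add: star_prod_def)
  qed
qed

lemma image_doubletons:
  "(`) h ` {{p x, p x'} | x x'. P x x'} = {{h (p x), h (p x')} | x x'. P x x'}"
proof (intro equalityI subsetI)
  fix e assume "e \<in> {{h (p x), h (p x')} | x x'. P x x'}"
  then obtain x x' where "e = h ` {p x, p x'}" "P x x'" by auto
  then show "e \<in> (`) h ` {{p x, p x'} | x x'. P x x'}" by blast
qed auto

text \<open>Recognises as a star product any graph that is the union of two copies meeting only in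
  the base point. Used once for the finite stages and once for the inductive limits.\<close>

lemma star_prod_iso_glue:
  assumes f: "inj_on f (verts G)" "f (base G) = o'" "base G \<in> verts G" "simple_edges G"
    and g: "inj_on g (verts H)" "g (base H) = o'" "base H \<in> verts H" "simple_edges H"
    and meet: "f ` verts G \<inter> g ` verts H \<subseteq> {o'}"
    and F: "verts F = f ` verts G \<union> g ` verts H" "edges F = (`) f ` edges G \<union> (`) g ` edges H" "base F = o'"
  shows "\<exists>h. is_rooted_iso h (star_prod G H) F"
proof -
  define h where "h = (\<lambda>(x, y). if y = base H then f x else g y)"
  have hf: "h (x, base H) = f x" and hg: "h (base G, y) = g y" for x y
    using f(2) g(2) by (auto simp: h_def)
  have meet': "y = base H" if "x \<in> verts G" "y \<in> verts H" "f x = g y" for x y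
  proof -
    have "g y \<in> f ` verts G \<inter> g ` verts H" using that by (auto intro: rev_image_eqI)
    then have "g y = g (base H)" using meet g(2) by auto
    then show ?thesis using inj_onD[OF g(1) _ that(2) g(3)] by simp
  qed
  have "is_rooted_iso h (star_prod G H) F"
  proof (rule is_rooted_isoI)
    show "inj_on h (verts (star_prod G H))"
    proof (rule inj_onI)
      fix p q assume pq: "p \<in> verts (star_prod G H)" "q \<in> verts (star_prod G H)" "h p = h q"
      obtain x y x' y' where p: "p = (x, y)" and q: "q = (x', y')" by (cases p; cases q)
      have p': "x \<in> verts G" "y \<in> verts H" "x = base G \<or> y = base H"
        and q': "x' \<in> verts G" "y' \<in> verts H" "x' = base G \<or> y' = base H"
        using pq(1,2) f(3) g(3) unfolding p q by (auto simp: star_prod_def)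
      have eq: "(if y = base H then f x else g y) = (if y' = base H then f x' else g y')"
        using pq(3) by (simp add: p q h_def)
      consider "y = base H" "y' = base H" | "y = base H" "y' \<noteq> base H" | "y \<noteq> base H" "y' = base H"
        | "y \<noteq> base H" "y' \<noteq> base H" by blast
      then show "p = q"
      proof cases
        case 1
        then show ?thesis using eq inj_onD[OF f(1) _ p'(1) q'(1)] by (simp add: p q)
      next
        case 2
        then show ?thesis using eq meet'[OF p'(1) q'(2)] by simp
      next
        case 3
        then show ?thesis using eq meet'[OF q'(1) p'(2)] by simp
      next
        case 4
        then show ?thesis using eq p'(3) q'(3) inj_onD[OF g(1) _ p'(2) q'(2)] by (simp add: p q)
      qed
    qed
    have "h ` verts (star_prod G H) = (\<lambda>x. h (x, base H)) ` verts G \<union> (\<lambda>y. h (base G, y)) ` verts H"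
      by (auto simp: star_prod_def image_Un image_iff)
    then show "h ` verts (star_prod G H) = verts F" by (simp add: hf hg F)
    have EG: "(`) f ` edges G = {{f x, f x'} | x x'. {x, x'} \<in> edges G}"
      if simple: "simple_edges G" for f and G :: "'x rgraph"
    proof (intro equalityI subsetI)
      fix e assume "e \<in> (`) f ` edges G"
      then obtain e' where "e' \<in> edges G" "e = f ` e'" by blast
      moreover from this obtain x x' where "e' = {x, x'}" using simple unfolding simple_edges_def by blast
      ultimately show "e \<in> {{f x, f x'} | x x'. {x, x'} \<in> edges G}" by auto
    next
      fix e assume "e \<in> {{f x, f x'} | x x'. {x, x'} \<in> edges G}"
      then obtain x x' where "e = f ` {x, x'}" "{x, x'} \<in> edges G" by auto
      then show "e \<in> (`) f ` edges G" by blast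
    qed
    have "(`) h ` edges (star_prod G H) = (`) h ` {{(x, base H), (x', base H)} | x x'. {x, x'} \<in> edges G}
        \<union> (`) h ` {{(base G, y), (base G, y')} | y y'. {y, y'} \<in> edges H}"
      by (simp add: star_prod_def image_Un)
    also have "(`) h ` {{(x, base H), (x', base H)} | x x'. {x, x'} \<in> edges G} = {{f x, f x'} | x x'. {x, x'} \<in> edges G}"
      unfolding image_doubletons hf ..
    also have "(`) h ` {{(base G, y), (base G, y')} | y y'. {y, y'} \<in> edges H} = {{g y, g y'} | y y'. {y, y'} \<in> edges H}"
      unfolding image_doubletons hg ..
    finally show "(`) h ` edges (star_prod G H) = edges F"
      by (simp only: F EG[OF f(4)] EG[OF g(4)])
    show "h (base (star_prod G H)) = base F" by (simp add: hf f(2) F(3))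
    show "simple_edges (star_prod G H)" by (rule simple_edges_star_prod[OF f(4) g(4)])
  qed
  then show ?thesis by blast
qed

text \<open>\<open>\<sigma>\<close> places all stages injectively in one set so that the transition
  maps become inclusions; the abstract inductive limit is then the union of the images.\<close>

locale embedded_chain =
  fixes X :: "nat \<Rightarrow> 'v rgraph" and j :: "nat \<Rightarrow> 'v \<Rightarrow> 'v" and \<sigma> :: "'v \<Rightarrow> 'w"
  assumes inj: "inj_on \<sigma> (verts (X m))"
    and emb: "x \<in> verts (X m) \<Longrightarrow> j m x \<in> verts (X (Suc m))"
    and compat: "x \<in> verts (X m) \<Longrightarrow> \<sigma> (j m x) = \<sigma> x"
    and simple: "simple_edges (X m)"
    and base_0: "base (X 0) \<in> verts (X 0)"
begin

lemma chain_map_verts: "x \<in> verts (X m) \<Longrightarrow> chain_map j m k x \<in> verts (X (m + k)) \<and> \<sigma> (chain_map j m k x) = \<sigma> x"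
  by (induction k) (auto simp: emb compat)

text \<open>For the converse both elements are moved to stage m + n, where they have the same image
  under \<open>\<sigma>\<close> and hence coincide by injectivity.\<close>

lemma limit_rel_iff:
  "((m, x), (n, y)) \<in> limit_rel X j \<longleftrightarrow> x \<in> verts (X m) \<and> y \<in> verts (X n) \<and> \<sigma> x = \<sigma> y"
proof
  assume "((m, x), (n, y)) \<in> limit_rel X j"
  then obtain p q where x: "x \<in> verts (X m)" and y: "y \<in> verts (X n)" and "chain_map j m p x = chain_map j n q y"
    by (auto simp: limit_rel_def)
  then show "x \<in> verts (X m) \<and> y \<in> verts (X n) \<and> \<sigma> x = \<sigma> y"
    using chain_map_verts[OF x, of p] chain_map_verts[OF y, of q] by simp
next
  assume *: "x \<in> verts (X m) \<and> y \<in> verts (X n) \<and> \<sigma> x = \<sigma> y"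
  have "chain_map j m n x = chain_map j n m y"
    using * chain_map_verts[of x m n] chain_map_verts[of y n m]
    by (intro inj_onD[OF inj[of "m + n"]]) (simp_all add: add.commute)
  moreover have "m + n = n + m" by simp
  ultimately show "((m, x), (n, y)) \<in> limit_rel X j"
    using * unfolding limit_rel_def by blast
qed

definition cls :: "nat \<Rightarrow> 'v \<Rightarrow> (nat \<times> 'v) set" where
  "cls m x = limit_rel X j `` {(m, x)}"

text \<open>Any representative may be chosen, as \<open>\<sigma>\<close> is constant on
  classes.\<close>

definition limit_map :: "(nat \<times> 'v) set \<Rightarrow> 'w" where
  "limit_map c = \<sigma> (snd (SOME p. p \<in> c))"

lemma in_cls_iff: "(n, y) \<in> cls m x \<longleftrightarrow> x \<in> verts (X m) \<and> y \<in> verts (X n) \<and> \<sigma> x = \<sigma> y"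
  by (simp add: cls_def limit_rel_iff)

lemma limit_map_cls: "x \<in> verts (X m) \<Longrightarrow> limit_map (cls m x) = \<sigma> x"
proof -
  assume x: "x \<in> verts (X m)"
  then have "(m, x) \<in> cls m x" by (simp add: in_cls_iff)
  then have "(SOME p. p \<in> cls m x) \<in> cls m x" by (rule someI)
  then show ?thesis
    by (cases "SOME p. p \<in> cls m x") (simp add: in_cls_iff limit_map_def)
qed

lemma cls_eq_iff:
  assumes "x \<in> verts (X m)" "y \<in> verts (X n)"
  shows "cls m x = cls n y \<longleftrightarrow> \<sigma> x = \<sigma> y"
proof
  assume "cls m x = cls n y" then show "\<sigma> x = \<sigma> y" using limit_map_cls assms by metis
next
  assume "\<sigma> x = \<sigma> y" then show "cls m x = cls n y"
    using assms by (simp add: set_eq_iff split_paired_all in_cls_iff)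
qed

abbreviation "L \<equiv> inductive_limit X j"

lemma verts_limit: "verts L = {cls m x | m x. x \<in> verts (X m)}"
  unfolding inductive_limit_def cls_def by (auto simp: quotient_def)

lemma edges_limit: "edges L = {{cls m x, cls m y} | m x y. {x, y} \<in> edges (X m)}"
  unfolding inductive_limit_def cls_def by simp

lemma base_limit: "base L = cls 0 (base (X 0))" "base L \<in> verts L"
  using base_0 unfolding verts_limit by (auto simp: inductive_limit_def cls_def)

lemma inj_on_limit_map: "inj_on limit_map (verts L)"
proof (rule inj_onI)
  fix c c' assume "c \<in> verts L" "c' \<in> verts L" "limit_map c = limit_map c'"
  moreover from this obtain m x n y where c: "c = cls m x" "x \<in> verts (X m)" "c' = cls n y" "y \<in> verts (X n)"
    unfolding verts_limit by blast
  ultimately have "\<sigma> x = \<sigma> y" by (simp add: limit_map_cls)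
  then show "c = c'" using cls_eq_iff[OF c(2,4)] c(1,3) by simp
qed

lemma limit_map_verts: "limit_map ` verts L = (\<Union>m. \<sigma> ` verts (X m))"
  unfolding verts_limit
proof (intro equalityI subsetI)
  fix w assume "w \<in> limit_map ` {cls m x | m x. x \<in> verts (X m)}"
  then obtain m x where "x \<in> verts (X m)" "w = \<sigma> x" by (auto simp: limit_map_cls)
  then show "w \<in> (\<Union>m. \<sigma> ` verts (X m))" by blast
next
  fix w assume "w \<in> (\<Union>m. \<sigma> ` verts (X m))"
  then obtain m x where "x \<in> verts (X m)" "w = limit_map (cls m x)" by (auto simp: limit_map_cls)
  then show "w \<in> limit_map ` {cls m x | m x. x \<in> verts (X m)}" by blast
qed

lemma limit_map_edges: "(`) limit_map ` edges L = (\<Union>m. (`) \<sigma> ` edges (X m))"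
proof (intro equalityI subsetI)
  fix e assume "e \<in> (`) limit_map ` edges L"
  then obtain m x y where e: "e = limit_map ` {cls m x, cls m y}" "{x, y} \<in> edges (X m)"
    unfolding edges_limit by blast
  then have "e = \<sigma> ` {x, y}" using simple_edgesD[OF simple e(2)] by (simp add: limit_map_cls)
  then show "e \<in> (\<Union>m. (`) \<sigma> ` edges (X m))" using e(2) by blast
next
  fix e assume "e \<in> (\<Union>m. (`) \<sigma> ` edges (X m))"
  then obtain m e' where e': "e = \<sigma> ` e'" "e' \<in> edges (X m)" by blast
  then obtain x y where xy: "e' = {x, y}" using simple[of m] unfolding simple_edges_def by blast
  then have "e = limit_map ` {cls m x, cls m y}"
    using simple_edgesD[OF simple, of x y m] e' by (simp add: limit_map_cls)
  moreover have "{cls m x, cls m y} \<in> edges L" using e' xy unfolding edges_limit by blast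
  ultimately show "e \<in> (`) limit_map ` edges L" by blast
qed

lemma simple_edges_limit: "simple_edges L"
  unfolding simple_edges_def
proof
  fix e assume "e \<in> edges L"
  then obtain m x y where e: "e = {cls m x, cls m y}" "{x, y} \<in> edges (X m)"
    unfolding edges_limit by blast
  note xy = simple_edgesD[OF simple e(2)]
  have "cls m x \<noteq> cls m y" using xy cls_eq_iff[OF xy(1,2)] inj_onD[OF inj _ xy(1,2)] by auto
  then show "\<exists>x y. e = {x, y} \<and> x \<noteq> y \<and> x \<in> verts L \<and> y \<in> verts L"
    using e(1) xy unfolding verts_limit by blast
qed

end

section \<open>Iterated orthogonal products as graphs of words\<close>

text \<open>In a vertex of an iterated orthogonal product the roots form a final block, because the
  root of the outer factor carries only the root of the inner one. Deleting them from a list of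
  known length therefore loses nothing.\<close>

definition strip :: "'c set \<Rightarrow> 'c list \<Rightarrow> 'c list" where
  "strip B = filter (\<lambda>x. x \<notin> B)"

lemma strip_simps [simp]:
  "strip B [] = []" "strip B (x # xs) = (if x \<in> B then strip B xs else x # strip B xs)"
  by (simp_all add: strip_def)

fun alt_word :: "'c rgraph \<Rightarrow> 'c rgraph \<Rightarrow> 'c list \<Rightarrow> bool" where
  "alt_word G H [] \<longleftrightarrow> True"
| "alt_word G H (x # w) \<longleftrightarrow> x \<in> verts G \<and> x \<noteq> base G \<and> alt_word H G w"

text \<open>Symmetric in the two graphs with \<open>B\<close> unchanged, since each level of the
  iterated product exchanges their roles.\<close>

definition disjoint_pair :: "'c set \<Rightarrow> 'c rgraph \<Rightarrow> 'c rgraph \<Rightarrow> bool" where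
  "disjoint_pair B G H \<longleftrightarrow> simple_edges G \<and> simple_edges H \<and> base G \<in> verts G \<and> base H \<in> verts H \<and>
     verts G \<inter> verts H = {} \<and> B = {base G, base H}"

lemma disjoint_pair_sym: "disjoint_pair B G H \<Longrightarrow> disjoint_pair B H G"
  by (auto simp: disjoint_pair_def)

lemma disjoint_pair_mem: "disjoint_pair B G H \<Longrightarrow> x \<in> verts G \<Longrightarrow> x \<in> B \<longleftrightarrow> x = base G"
  by (auto simp: disjoint_pair_def)

lemma disjoint_pair_simple: "disjoint_pair B G H \<Longrightarrow> simple_edges G"
  and disjoint_pair_base: "disjoint_pair B G H \<Longrightarrow> base G \<in> verts G"
  and disjoint_pair_base_mem: "disjoint_pair B G H \<Longrightarrow> base G \<in> B"
  by (auto simp: disjoint_pair_def)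

lemma orth_iter_0: "verts (orth_prod_iter 0 G H) = (\<lambda>x. [x]) ` verts G" "base (orth_prod_iter 0 G H) = [base G]"
  by (simp_all add: relabel_def)

lemma orth_iter_Suc_verts: "verts (orth_prod_iter (Suc m) G H) =
    {x # y | x y. x \<in> verts G \<and> x \<noteq> base G \<and> y \<in> verts (orth_prod_iter m H G)} \<union> {base G # base (orth_prod_iter m H G)}"
  by (auto simp: relabel_def orth_prod_def image_iff)

lemma orth_iter_Suc_base: "base (orth_prod_iter (Suc m) G H) = base G # base (orth_prod_iter m H G)"
  by (simp add: relabel_def)

lemma edges_eq_doubletons:
  assumes "simple_edges G" shows "edges G = {{x, x'} | x x'. {x, x'} \<in> edges G}"
proof (intro equalityI subsetI)
  fix e assume e: "e \<in> edges G"
  then obtain x x' where "e = {x, x'}" using assms unfolding simple_edges_def by blast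
  then show "e \<in> {{x, x'} | x x'. {x, x'} \<in> edges G}" using e by blast
qed auto

lemma inj_case_prod_Cons: "inj_on (\<lambda>(x, y). x # y) A"
  by (auto simp: inj_on_def)

text \<open>Proved jointly: edges of the outer factor are copied at the root of the inner one, which
  must be a vertex.\<close>

lemma simple_edges_orth_iter:
  assumes "disjoint_pair B G H"
  shows "simple_edges (orth_prod_iter m G H)" "base (orth_prod_iter m G H) \<in> verts (orth_prod_iter m G H)"
  using assms
proof (induction m arbitrary: G H)
  case 0
  {
    case 1
    show ?case using simple_edges_relabel[OF _ disjoint_pair_simple[OF 1], of "\<lambda>x. [x]"] by (simp add: inj_on_def)
  next
    case 2 then show ?case unfolding orth_iter_0 by (simp add: disjoint_pair_base)
  }
next
  case (Suc m)
  {
    case 1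
    note sym = disjoint_pair_sym[OF 1]
    have "simple_edges (orth_prod G (orth_prod_iter m H G))"
      by (rule simple_edges_orth_prod[OF disjoint_pair_simple[OF 1] Suc(1)[OF sym] Suc(2)[OF sym]])
    then show ?case by (simp add: simple_edges_relabel inj_case_prod_Cons)
  next
    case 2
    show ?case unfolding orth_iter_Suc_base orth_iter_Suc_verts by simp
  }
qed

lemma edges_orth_iter_Suc: "edges (orth_prod_iter (Suc m) G H) =
    {{x # base (orth_prod_iter m H G), x' # base (orth_prod_iter m H G)} | x x'. {x, x'} \<in> edges G} \<union>
    (\<Union>x\<in>verts G - {base G}. {{x # y, x # y'} | y y'. {y, y'} \<in> edges (orth_prod_iter m H G)})"
  (is "_ = ?A \<union> ?B")
proof -
  let ?K = "orth_prod_iter m H G" and ?c = "\<lambda>(x, y). x # y"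
  have "edges (orth_prod_iter (Suc m) G H) = (`) ?c ` {{(x, base ?K), (x', base ?K)} | x x'. {x, x'} \<in> edges G} \<union>
      (`) ?c ` {{(x, y), (x, y')} | x y y'. x \<in> verts G \<and> x \<noteq> base G \<and> {y, y'} \<in> edges ?K}"
    by (simp add: relabel_def orth_prod_def image_Un)
  also have "(`) ?c ` {{(x, base ?K), (x', base ?K)} | x x'. {x, x'} \<in> edges G} = ?A"
    unfolding image_doubletons by simp
  also have "{{(x, y), (x, y')} | x y y'. x \<in> verts G \<and> x \<noteq> base G \<and> {y, y'} \<in> edges ?K}
      = (\<Union>x\<in>verts G - {base G}. {{(x, y), (x, y')} | y y'. {y, y'} \<in> edges ?K})"
    by blast
  also have "(`) ?c ` \<dots> = ?B"
    unfolding image_UN image_doubletons by simp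
  finally show ?thesis .
qed

lemma strip_base:
  assumes "disjoint_pair B G H" shows "strip B (base (orth_prod_iter m G H)) = []"
  using assms
proof (induction m arbitrary: G H)
  case 0
  then show ?case unfolding orth_iter_0 by (simp add: disjoint_pair_base_mem)
next
  case (Suc m)
  then show ?case
    unfolding orth_iter_Suc_base using Suc.IH[OF disjoint_pair_sym[OF Suc.prems]] by (simp add: disjoint_pair_base_mem)
qed

lemma strip_letter:
  assumes "disjoint_pair B G H" "x \<in> verts G"
  shows "strip B [x] = (if x = base G then [] else [x])"
  using disjoint_pair_mem[OF assms] by simp

text \<open>Stage m consists of m + 1 nested factors, whence words of length up to
  \<open>Suc m\<close>; the letters alternate between the graphs, starting with the
  outermost.\<close>

lemma strip_verts:
  assumes "disjoint_pair B G H"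
  shows "strip B ` verts (orth_prod_iter m G H) = {w. alt_word G H w \<and> length w \<le> Suc m}"
  using assms
proof (induction m arbitrary: G H)
  case 0
  show ?case
  proof (intro equalityI subsetI)
    fix w assume "w \<in> strip B ` verts (orth_prod_iter 0 G H)"
    then obtain x where "x \<in> verts G" "w = strip B [x]" unfolding orth_iter_0 by auto
    then show "w \<in> {w. alt_word G H w \<and> length w \<le> Suc 0}" using strip_letter[OF 0] by auto
  next
    fix w assume w: "w \<in> {w. alt_word G H w \<and> length w \<le> Suc 0}"
    show "w \<in> strip B ` verts (orth_prod_iter 0 G H)"
    proof (cases w)
      case Nil
      then have "w = strip B [base G]" using disjoint_pair_base_mem[OF 0] by simp
      then show ?thesis unfolding orth_iter_0 image_image using disjoint_pair_base[OF 0] by blast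
    next
      case (Cons x u)
      then have "w = strip B [x]" "x \<in> verts G" using w strip_letter[OF 0, of x] by auto
      then show ?thesis unfolding orth_iter_0 image_image by blast
    qed
  qed
next
  case (Suc m)
  note sym = disjoint_pair_sym[OF Suc.prems]
  have Cons: "strip B (x # y) = x # strip B y" if "x \<in> verts G" "x \<noteq> base G" for x y
    using disjoint_pair_mem[OF Suc.prems that(1)] that(2) by simp
  have base: "strip B (base G # base (orth_prod_iter m H G)) = []"
    using strip_base[OF sym] disjoint_pair_base_mem[OF Suc.prems] by simp
  show ?case
  proof (intro equalityI subsetI)
    fix w assume "w \<in> strip B ` verts (orth_prod_iter (Suc m) G H)"
    then consider x y where "x \<in> verts G" "x \<noteq> base G" "y \<in> verts (orth_prod_iter m H G)" "w = strip B (x # y)"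
      | "w = []" unfolding orth_iter_Suc_verts using base by blast
    then show "w \<in> {w. alt_word G H w \<and> length w \<le> Suc (Suc m)}"
    proof cases
      case 1
      then have "strip B y \<in> {w. alt_word H G w \<and> length w \<le> Suc m}"
        unfolding Suc.IH[OF sym, symmetric] by blast
      then show ?thesis using 1 Cons by simp
    qed simp
  next
    fix w assume w: "w \<in> {w. alt_word G H w \<and> length w \<le> Suc (Suc m)}"
    show "w \<in> strip B ` verts (orth_prod_iter (Suc m) G H)"
    proof (cases w)
      case Nil
      then have "w = strip B (base G # base (orth_prod_iter m H G))" using base by simp
      then show ?thesis unfolding orth_iter_Suc_verts by blast
    next
      case w': (Cons x u)
      then have "u \<in> strip B ` verts (orth_prod_iter m H G)" using w unfolding Suc.IH[OF sym] by simp
      then obtain y where y: "y \<in> verts (orth_prod_iter m H G)" "u = strip B y" by blast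
      then have "w = strip B (x # y)" using w w' Cons[of x y] by simp
      moreover have "x # y \<in> verts (orth_prod_iter (Suc m) G H)"
        unfolding orth_iter_Suc_verts using w w' y by simp
      ultimately show ?thesis by blast
    qed
  qed
qed

lemma inj_on_strip:
  assumes "disjoint_pair B G H"
  shows "inj_on (strip B) (verts (orth_prod_iter m G H))"
  using assms
proof (induction m arbitrary: G H)
  case 0
  show ?case unfolding orth_iter_0
    by (rule inj_onI) (auto simp: disjoint_pair_mem[OF 0] split: if_splits)
next
  case (Suc m)
  note sym = disjoint_pair_sym[OF Suc.prems]
  have Cons: "strip B (x # y) = x # strip B y" if "x \<in> verts G" "x \<noteq> base G" for x y
    using disjoint_pair_mem[OF Suc.prems that(1)] that(2) by simp
  have base: "strip B (base G # base (orth_prod_iter m H G)) = []"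
    using strip_base[OF sym] disjoint_pair_base_mem[OF Suc.prems] by simp
  show ?case
  proof (rule inj_onI)
    fix w w' assume ww: "w \<in> verts (orth_prod_iter (Suc m) G H)" "w' \<in> verts (orth_prod_iter (Suc m) G H)"
      "strip B w = strip B w'"
    have *: "w = base G # base (orth_prod_iter m H G) \<and> strip B w = [] \<or>
      (\<exists>x y. w = x # y \<and> strip B w = x # strip B y \<and> y \<in> verts (orth_prod_iter m H G))"
      if "w \<in> verts (orth_prod_iter (Suc m) G H)" for w
      using that unfolding orth_iter_Suc_verts using base Cons by blast
    show "w = w'"
      using *[OF ww(1)] *[OF ww(2)]
    proof (elim disjE exE conjE)
      fix x y x' y' assume w: "w = x # y" "strip B w = x # strip B y" "y \<in> verts (orth_prod_iter m H G)"
        and w': "w' = x' # y'" "strip B w' = x' # strip B y'" "y' \<in> verts (orth_prod_iter m H G)"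
      then have "x = x'" "strip B y = strip B y'" using ww(3) by (simp_all only: list.inject)
      then show ?thesis using inj_onD[OF Suc.IH[OF sym] _ w(3) w'(3)] w(1) w'(1) by (simp only:)
    qed (use ww(3) in \<open>simp_all only: list.distinct\<close>)
  qed
qed

text \<open>An edge changes a single entry v behind a block u of non-root entries, all later entries
  being roots. Factors alternate, so the parity of the length of u tells which graph v belongs to,
  and length at most m leaves room for one more entry.\<close>

lemma strip_edges:
  assumes "disjoint_pair B G H"
  shows "(`) (strip B) ` edges (orth_prod_iter m G H) =
    {{u @ strip B [v], u @ strip B [v']} | u v v'. alt_word G H u \<and> length u \<le> m \<and>
       {v, v'} \<in> edges (if even (length u) then G else H)}"
  using assms
proof (induction m arbitrary: G H)
  case 0
  have E: "edges (orth_prod_iter 0 G H) = (`) (\<lambda>x. [x]) ` {{x, x'} | x x'. {x, x'} \<in> edges G}"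
    using edges_eq_doubletons[OF disjoint_pair_simple[OF 0]] by (simp add: relabel_def)
  have "(`) (strip B) ` edges (orth_prod_iter 0 G H) = {{strip B [v], strip B [v']} | v v'. {v, v'} \<in> edges G}"
    unfolding E image_doubletons ..
  then show ?case by (simp del: strip_simps orth_prod_iter.simps)
next
  case (Suc m)
  note sym = disjoint_pair_sym[OF Suc.prems]
  let ?K = "orth_prod_iter m H G"
  let ?E = "\<lambda>G H m. {{u @ strip B [v], u @ strip B [v']} | u v v'. alt_word G H u \<and> length u \<le> m \<and>
       {v, v'} \<in> edges (if even (length u) then G else H)}"
  have K: "(`) (strip B) ` edges ?K = {{strip B y, strip B y'} | y y'. {y, y'} \<in> edges ?K}"
    by (subst edges_eq_doubletons[OF simple_edges_orth_iter(1)[OF sym]]) (rule image_doubletons)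
  have base: "strip B (x # base ?K) = strip B [x]" for x
    using strip_base[OF sym] by simp
  have Cons: "strip B (x # y) = x # strip B y" if "x \<in> verts G - {base G}" for x y
    using disjoint_pair_mem[OF Suc.prems, of x] that by simp
  have "(`) (strip B) ` edges (orth_prod_iter (Suc m) G H)
      = {{strip B [x], strip B [x']} | x x'. {x, x'} \<in> edges G} \<union>
        (\<Union>x\<in>verts G - {base G}. {{x # strip B y, x # strip B y'} | y y'. {y, y'} \<in> edges ?K})"
    unfolding edges_orth_iter_Suc image_Un image_UN image_doubletons base
    by (intro arg_cong2[where f = "(\<union>)"] refl SUP_cong) (simp only: Cons)
  also have "\<dots> = {{strip B [x], strip B [x']} | x x'. {x, x'} \<in> edges G} \<union>
        (\<Union>x\<in>verts G - {base G}. (`) ((#) x) ` ?E H G m)"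
    unfolding Suc.IH[OF sym, symmetric] K image_doubletons ..
  also have "\<dots> = ?E G H (Suc m)"
  proof (intro equalityI subsetI)
    fix e assume "e \<in> {{strip B [x], strip B [x']} | x x'. {x, x'} \<in> edges G} \<union>
        (\<Union>x\<in>verts G - {base G}. (`) ((#) x) ` ?E H G m)"
    then consider x x' where "e = {[] @ strip B [x], [] @ strip B [x']}" "{x, x'} \<in> edges G"
      | x u v v' where "x \<in> verts G - {base G}" "e = {(x # u) @ strip B [v], (x # u) @ strip B [v']}"
        "alt_word H G u" "length u \<le> m" "{v, v'} \<in> edges (if even (length u) then H else G)"
      by (simp only: append_Nil append_Cons) blast
    then show "e \<in> ?E G H (Suc m)"
    proof cases
      case 1
      then show ?thesis unfolding mem_Collect_eq
        by (rule_tac x = "[]" in exI, rule_tac x = x in exI, rule_tac x = x' in exI) (simp del: strip_simps)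
    next
      case 2
      then show ?thesis unfolding mem_Collect_eq
        by (rule_tac x = "x # u" in exI, rule_tac x = v in exI, rule_tac x = v' in exI)
          (cases "even (length u)"; simp del: strip_simps)
    qed
  next
    fix e assume "e \<in> ?E G H (Suc m)"
    then obtain u v v' where u: "alt_word G H u" "length u \<le> Suc m"
      and v: "{v, v'} \<in> edges (if even (length u) then G else H)" and e: "e = {u @ strip B [v], u @ strip B [v']}"
      by blast
    show "e \<in> {{strip B [x], strip B [x']} | x x'. {x, x'} \<in> edges G} \<union>
        (\<Union>x\<in>verts G - {base G}. (`) ((#) x) ` ?E H G m)"
    proof (cases u)
      case Nil
      then have "e = {strip B [v], strip B [v']}" "{v, v'} \<in> edges G" using v e by auto
      then show ?thesis by blast
    next
      case (Cons x u')
      then have "{u' @ strip B [v], u' @ strip B [v']} \<in> ?E H G m" using u v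
        unfolding mem_Collect_eq by (rule_tac x = u' in exI, rule_tac x = v in exI, rule_tac x = v' in exI)
          (cases "even (length u)"; simp del: strip_simps)
      moreover have "e = (#) x ` {u' @ strip B [v], u' @ strip B [v']}" using Cons e by simp
      moreover have "x \<in> verts G - {base G}" using Cons u by simp
      ultimately show ?thesis by blast
    qed
  qed
  finally show ?case .
qed

lemma orth_emb_base: "orth_emb G H m (base (orth_prod_iter m G H)) = base (orth_prod_iter (Suc m) G H)"
proof (induction m arbitrary: G H)
  case 0
  then show ?case by (simp add: relabel_def)
next
  case (Suc m)
  then show ?case by (simp only: orth_iter_Suc_base orth_emb.simps list.sel)
qed

text \<open>The embedding appends one root at the innermost place, which \<open>strip\<close>
  deletes again.\<close>

lemma orth_emb_stage:
  assumes "disjoint_pair B G H" "xs \<in> verts (orth_prod_iter m G H)"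
  shows "orth_emb G H m xs \<in> verts (orth_prod_iter (Suc m) G H) \<and> strip B (orth_emb G H m xs) = strip B xs"
  using assms
proof (induction m arbitrary: G H xs)
  case 0
  note sym = disjoint_pair_sym[OF 0(1)]
  obtain x where x: "xs = [x]" "x \<in> verts G" using 0(2) unfolding orth_iter_0 by auto
  have "strip B (base (orth_prod_iter 0 H G)) = []" by (rule strip_base[OF sym])
  moreover have "x # base (orth_prod_iter 0 H G) \<in> verts (orth_prod_iter (Suc 0) G H)"
    unfolding orth_iter_Suc_verts using x simple_edges_orth_iter(2)[OF sym, of 0] by auto
  ultimately show ?case unfolding x(1) orth_emb.simps list.sel by simp
next
  case (Suc m)
  note sym = disjoint_pair_sym[OF Suc.prems(1)]
  have "xs = base G # base (orth_prod_iter m H G) \<or>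
      (\<exists>x y. xs = x # y \<and> x \<in> verts G \<and> x \<noteq> base G \<and> y \<in> verts (orth_prod_iter m H G))"
    using Suc.prems(2) unfolding orth_iter_Suc_verts by blast
  then show ?case
  proof (elim disjE exE conjE)
    assume xs: "xs = base G # base (orth_prod_iter m H G)"
    have "orth_emb G H (Suc m) xs = base G # base (orth_prod_iter (Suc m) H G)"
      unfolding xs orth_emb.simps list.sel orth_emb_base ..
    moreover have "strip B xs = []"
      using strip_base[OF sym] disjoint_pair_base_mem[OF Suc.prems(1)] by (simp add: xs)
    moreover have "strip B (base G # base (orth_prod_iter (Suc m) H G)) = []"
      using strip_base[OF sym, of "Suc m"] disjoint_pair_base_mem[OF Suc.prems(1)] by (simp del: orth_prod_iter.simps)
    ultimately show ?thesis unfolding orth_iter_Suc_verts[of "Suc m"] by simp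
  next
    fix x y assume xs: "xs = x # y" "x \<in> verts G" "x \<noteq> base G" "y \<in> verts (orth_prod_iter m H G)"
    have IH: "orth_emb H G m y \<in> verts (orth_prod_iter (Suc m) H G) \<and> strip B (orth_emb H G m y) = strip B y"
      by (rule Suc.IH[OF sym xs(4)])
    have "orth_emb G H (Suc m) xs = x # orth_emb H G m y" by (simp add: xs(1))
    moreover have "x # orth_emb H G m y \<in> verts (orth_prod_iter (Suc (Suc m)) G H)"
      unfolding orth_iter_Suc_verts[of "Suc m"] using IH xs by blast
    ultimately show ?thesis using IH by (simp only: strip_simps xs(1))
  qed
qed

lemma embedded_chain_orth_iter:
  assumes "disjoint_pair B G H"
  shows "embedded_chain (\<lambda>m. orth_prod_iter m G H) (orth_emb G H) (rev \<circ> strip B)"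
proof
  show "inj_on (rev \<circ> strip B) (verts (orth_prod_iter m G H))" for m
    using inj_on_strip[OF assms] by (intro comp_inj_on) (auto simp: inj_on_def)
qed (use orth_emb_stage[OF assms] simple_edges_orth_iter[OF assms] in \<open>auto simp del: orth_prod_iter.simps orth_emb.simps\<close>)

section \<open>The star-orthogonal decomposition\<close>

locale simple_word_pair = word_pair G H for G :: "'a rgraph" and H :: "'b rgraph" +
  assumes simple_left: "simple_edges G" and simple_right: "simple_edges H"
begin

abbreviation "GL \<equiv> relabel (Inl :: 'a \<Rightarrow> 'a + 'b) G"
abbreviation "HR \<equiv> relabel (Inr :: 'b \<Rightarrow> 'a + 'b) H"
abbreviation "roots \<equiv> {Inl (base G) :: 'a + 'b, Inr (base H)}"
abbreviation "words \<equiv> free_words G H"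

text \<open>A vertex of an iterated orthogonal product becomes a word by deleting the roots; the order is
  reversed because the inner factors come last in the tuple, whereas the edges of the free product
  change the first letter.\<close>

definition word_of :: "('a + 'b) list \<Rightarrow> ('a + 'b) list" where
  "word_of = rev \<circ> strip roots"

lemma relabel_simps [simp]: "base GL = Inl (base G)" "base HR = Inr (base H)"
  "verts GL = Inl ` verts G" "verts HR = Inr ` verts H"
  by (simp_all add: relabel_def)

lemma relabel_edges: "edges GL = {{Inl a, Inl a'} | a a'. {a, a'} \<in> edges G}"
  "edges HR = {{Inr b, Inr b'} | b b'. {b, b'} \<in> edges H}"
proof -
  have "edges GL = (`) Inl ` {{a, a'} | a a'. {a, a'} \<in> edges G}"
    unfolding edges_eq_doubletons[OF simple_left, symmetric] by (simp add: relabel_def)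
  then show "edges GL = {{Inl a, Inl a'} | a a'. {a, a'} \<in> edges G}" unfolding image_doubletons .
  have "edges HR = (`) Inr ` {{b, b'} | b b'. {b, b'} \<in> edges H}"
    unfolding edges_eq_doubletons[OF simple_right, symmetric] by (simp add: relabel_def)
  then show "edges HR = {{Inr b, Inr b'} | b b'. {b, b'} \<in> edges H}" unfolding image_doubletons .
qed

lemma pair: "disjoint_pair roots GL HR"
  using base_vertices simple_edges_relabel[OF _ simple_left, of Inl] simple_edges_relabel[OF _ simple_right, of Inr]
  by (auto simp: disjoint_pair_def)

lemmas pair' = disjoint_pair_sym[OF pair]

lemma alt_word_iff:
  "alt_word GL HR u \<longleftrightarrow> u \<in> words \<and> (u = [] \<or> isl (hd u))"
  "alt_word HR GL u \<longleftrightarrow> u \<in> words \<and> (u = [] \<or> \<not> isl (hd u))"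
proof (induction u)
  case (Cons x u)
  {
    case 1
    show ?case unfolding alt_word.simps Cons(2) free_words_Cons by (cases x) auto
  next
    case 2
    show ?case unfolding alt_word.simps Cons(1) free_words_Cons by (cases x) auto
  }
qed (simp_all add: free_words_Nil)

lemma rev_mem_words: "rev u \<in> words \<longleftrightarrow> u \<in> words"
proof -
  have sym: "(\<lambda>x y :: 'a + 'b. isl y \<noteq> isl x) = (\<lambda>x y. isl x \<noteq> isl y)" by (auto simp: fun_eq_iff)
  have "successively (\<lambda>x y. isl x \<noteq> isl y) (rev u) \<longleftrightarrow> successively (\<lambda>x y. isl x \<noteq> isl y) u"
    unfolding successively_rev sym ..
  then show ?thesis by (simp only: free_words_def mem_Collect_eq set_rev)
qed

text \<open>The last letter becomes the first one after reversal and so decides which graph may act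
  on the word.\<close>

lemma isl_last_alt_word:
  "alt_word GL HR u \<Longrightarrow> u \<noteq> [] \<Longrightarrow> isl (last u) \<longleftrightarrow> odd (length u)"
  "alt_word HR GL u \<Longrightarrow> u \<noteq> [] \<Longrightarrow> isl (last u) \<longleftrightarrow> even (length u)"
proof (induction u)
  case (Cons x u)
  {
    case 1
    then have "isl x" "alt_word HR GL u" by auto
    then show ?case using Cons(2) by (cases "u = []") auto
  next
    case 2
    then have "\<not> isl x" "alt_word GL HR u" by auto
    then show ?case using Cons(1) by (cases "u = []") auto
  }
qed simp_all

text \<open>Edges of the stages are sorted by the outer factor and a parity, edges of the free
  product by the first letter of the indexing word. This translates one into the other; the empty
  word is admissible for both graphs.\<close>

lemma alt_word_parity:
  "alt_word GL HR u \<and> even (length u) \<or> alt_word HR GL u \<and> odd (length u) \<longleftrightarrow>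
     rev u \<in> words \<and> (rev u = [] \<or> \<not> isl (hd (rev u)))"
  "alt_word GL HR u \<and> odd (length u) \<or> alt_word HR GL u \<and> even (length u) \<longleftrightarrow>
     rev u \<in> words \<and> (rev u = [] \<or> isl (hd (rev u)))"
proof -
  have "u \<in> words \<longleftrightarrow> alt_word GL HR u \<or> alt_word HR GL u"
    unfolding alt_word_iff by blast
  moreover have "\<not> (alt_word GL HR u \<and> alt_word HR GL u)" if "u \<noteq> []"
    using that unfolding alt_word_iff by blast
  moreover have "alt_word HR GL []" "alt_word GL HR []" by simp_all
  ultimately show
    "alt_word GL HR u \<and> even (length u) \<or> alt_word HR GL u \<and> odd (length u) \<longleftrightarrow>
       rev u \<in> words \<and> (rev u = [] \<or> \<not> isl (hd (rev u)))"
    "alt_word GL HR u \<and> odd (length u) \<or> alt_word HR GL u \<and> even (length u) \<longleftrightarrow>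
       rev u \<in> words \<and> (rev u = [] \<or> isl (hd (rev u)))"
    using isl_last_alt_word[of u] unfolding rev_mem_words by (cases "u = []"; auto simp: hd_rev)+
qed

lemma word_of_verts:
  "word_of ` verts (orth_prod_iter m GL HR) = {rev w | w. alt_word GL HR w \<and> length w \<le> Suc m}"
  "word_of ` verts (orth_prod_iter m HR GL) = {rev w | w. alt_word HR GL w \<and> length w \<le> Suc m}"
  unfolding word_of_def image_comp[symmetric] strip_verts[OF pair] strip_verts[OF pair'] by blast+

lemma verts_stages: "word_of ` verts (orth_prod_iter m GL HR) \<union> word_of ` verts (orth_prod_iter m HR GL)
    = {w \<in> words. length w \<le> Suc m}"
proof (intro equalityI subsetI)
  fix w assume "w \<in> word_of ` verts (orth_prod_iter m GL HR) \<union> word_of ` verts (orth_prod_iter m HR GL)"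
  then obtain u where "w = rev u" "u \<in> words" "length u \<le> Suc m"
    unfolding word_of_verts alt_word_iff by blast
  then show "w \<in> {w \<in> words. length w \<le> Suc m}" by (simp add: rev_mem_words)
next
  fix w assume "w \<in> {w \<in> words. length w \<le> Suc m}"
  then have "rev w \<in> words" "length (rev w) \<le> Suc m" "w = rev (rev w)" by (simp_all add: rev_mem_words)
  then show "w \<in> word_of ` verts (orth_prod_iter m GL HR) \<union> word_of ` verts (orth_prod_iter m HR GL)"
    unfolding word_of_verts alt_word_iff by blast
qed

text \<open>The reversed word would have to begin with a letter of each graph.\<close>

lemma word_of_verts_meet:
  assumes "w \<in> word_of ` verts (orth_prod_iter m GL HR)" "w \<in> word_of ` verts (orth_prod_iter n HR GL)"
  shows "w = []"
proof -
  have "alt_word GL HR (rev w)" "alt_word HR GL (rev w)"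
    using assms unfolding word_of_verts by auto
  then show ?thesis unfolding alt_word_iff by auto
qed

lemma inj_on_word_of:
  "inj_on word_of (verts (orth_prod_iter m GL HR))" "inj_on word_of (verts (orth_prod_iter m HR GL))"
  unfolding word_of_def
  by (rule comp_inj_on[OF inj_on_strip[OF pair] inj_on_rev], rule comp_inj_on[OF inj_on_strip[OF pair'] inj_on_rev])

lemma word_of_base: "word_of (base (orth_prod_iter m GL HR)) = []" "word_of (base (orth_prod_iter m HR GL)) = []"
  by (simp_all add: word_of_def strip_base[OF pair] strip_base[OF pair'])

definition left_edge :: "('a + 'b) list set \<Rightarrow> ('a + 'b) list \<Rightarrow> bool" where
  "left_edge e w \<longleftrightarrow> (\<exists>a a'. {a, a'} \<in> edges G \<and> e = {L.letter a @ w, L.letter a' @ w})"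

definition right_edge :: "('a + 'b) list set \<Rightarrow> ('a + 'b) list \<Rightarrow> bool" where
  "right_edge e w \<longleftrightarrow> (\<exists>b b'. {b, b'} \<in> edges H \<and> e = {R.letter b @ w, R.letter b' @ w})"

lemma rev_strip_letter:
  "rev (u @ strip roots [Inl a]) = L.letter a @ rev u" "rev (u @ strip roots [Inr b]) = R.letter b @ rev u"
  by (auto simp: L.letter_def R.letter_def)

lemma doubleton_edge_iff:
  "(\<exists>v v'. {v, v'} \<in> edges GL \<and> e = {rev (u @ strip roots [v]), rev (u @ strip roots [v'])}) \<longleftrightarrow> left_edge e (rev u)"
  "(\<exists>v v'. {v, v'} \<in> edges HR \<and> e = {rev (u @ strip roots [v]), rev (u @ strip roots [v'])}) \<longleftrightarrow> right_edge e (rev u)"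
proof -
  show "(\<exists>v v'. {v, v'} \<in> edges GL \<and> e = {rev (u @ strip roots [v]), rev (u @ strip roots [v'])}) \<longleftrightarrow> left_edge e (rev u)"
  proof
    assume "\<exists>v v'. {v, v'} \<in> edges GL \<and> e = {rev (u @ strip roots [v]), rev (u @ strip roots [v'])}"
    then obtain v v' where v: "{v, v'} \<in> edges GL" and e: "e = {rev (u @ strip roots [v]), rev (u @ strip roots [v'])}"
      by blast
    from v obtain a a' where a: "{v, v'} = {Inl a, Inl a'}" "{a, a'} \<in> edges G" unfolding relabel_edges by blast
    have "e = (\<lambda>v. rev (u @ strip roots [v])) ` {v, v'}" using e by (simp del: strip_simps rev_append)
    then have "e = {L.letter a @ rev u, L.letter a' @ rev u}"
      unfolding a(1) by (simp only: image_insert image_empty rev_strip_letter)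
    then show "left_edge e (rev u)" using a(2) unfolding left_edge_def by blast
  next
    assume "left_edge e (rev u)"
    then obtain a a' where "{a, a'} \<in> edges G" "e = {rev (u @ strip roots [Inl a]), rev (u @ strip roots [Inl a'])}"
      unfolding left_edge_def rev_strip_letter by blast
    moreover from this(1) have "{Inl a, Inl a'} \<in> edges GL" unfolding relabel_edges by blast
    ultimately show "\<exists>v v'. {v, v'} \<in> edges GL \<and> e = {rev (u @ strip roots [v]), rev (u @ strip roots [v'])}"
      by blast
  qed
  show "(\<exists>v v'. {v, v'} \<in> edges HR \<and> e = {rev (u @ strip roots [v]), rev (u @ strip roots [v'])}) \<longleftrightarrow> right_edge e (rev u)"
  proof
    assume "\<exists>v v'. {v, v'} \<in> edges HR \<and> e = {rev (u @ strip roots [v]), rev (u @ strip roots [v'])}"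
    then obtain v v' where v: "{v, v'} \<in> edges HR" and e: "e = {rev (u @ strip roots [v]), rev (u @ strip roots [v'])}"
      by blast
    from v obtain b b' where b: "{v, v'} = {Inr b, Inr b'}" "{b, b'} \<in> edges H" unfolding relabel_edges by blast
    have "e = (\<lambda>v. rev (u @ strip roots [v])) ` {v, v'}" using e by (simp del: strip_simps rev_append)
    then have "e = {R.letter b @ rev u, R.letter b' @ rev u}"
      unfolding b(1) by (simp only: image_insert image_empty rev_strip_letter)
    then show "right_edge e (rev u)" using b(2) unfolding right_edge_def by blast
  next
    assume "right_edge e (rev u)"
    then obtain b b' where "{b, b'} \<in> edges H" "e = {rev (u @ strip roots [Inr b]), rev (u @ strip roots [Inr b'])}"
      unfolding right_edge_def rev_strip_letter by blast
    moreover from this(1) have "{Inr b, Inr b'} \<in> edges HR" unfolding relabel_edges by blast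
    ultimately show "\<exists>v v'. {v, v'} \<in> edges HR \<and> e = {rev (u @ strip roots [v]), rev (u @ strip roots [v'])}"
      by blast
  qed
qed

lemma word_of_edges_iff:
  "e \<in> (`) word_of ` edges (orth_prod_iter m GL HR) \<longleftrightarrow> (\<exists>u. alt_word GL HR u \<and> length u \<le> m \<and>
     (if even (length u) then left_edge e (rev u) else right_edge e (rev u)))"
  "e \<in> (`) word_of ` edges (orth_prod_iter m HR GL) \<longleftrightarrow> (\<exists>u. alt_word HR GL u \<and> length u \<le> m \<and>
     (if even (length u) then right_edge e (rev u) else left_edge e (rev u)))"
proof -
  have *: "e \<in> (`) word_of ` edges (orth_prod_iter m A B) \<longleftrightarrow> (\<exists>u. alt_word A B u \<and> length u \<le> m \<and>
     (\<exists>v v'. {v, v'} \<in> edges (if even (length u) then A else B) \<and> e = {rev (u @ strip roots [v]), rev (u @ strip roots [v'])}))"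
    (is "?L \<longleftrightarrow> ?R") if AB: "disjoint_pair roots A B" for A B
  proof -
    have eq: "(`) word_of ` edges (orth_prod_iter m A B) = (`) rev ` ((`) (strip roots) ` edges (orth_prod_iter m A B))"
      by (simp add: word_of_def image_image image_comp)
    show ?thesis
    proof
      assume ?L
      then obtain e' where e': "e' \<in> (`) (strip roots) ` edges (orth_prod_iter m A B)" "e = rev ` e'" unfolding eq by blast
      from e'(1) obtain u v v' where "e' = {u @ strip roots [v], u @ strip roots [v']}" "alt_word A B u" "length u \<le> m"
        "{v, v'} \<in> edges (if even (length u) then A else B)" unfolding strip_edges[OF AB] by blast
      moreover from this(1) e'(2) have "e = {rev (u @ strip roots [v]), rev (u @ strip roots [v'])}"
        by (simp only: image_insert image_empty)
      ultimately show ?R by blast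
    next
      assume ?R
      then obtain u v v' where u: "alt_word A B u" "length u \<le> m" "{v, v'} \<in> edges (if even (length u) then A else B)"
        "e = rev ` {u @ strip roots [v], u @ strip roots [v']}" by (simp only: image_insert image_empty) blast
      then have "{u @ strip roots [v], u @ strip roots [v']} \<in> (`) (strip roots) ` edges (orth_prod_iter m A B)"
        unfolding strip_edges[OF AB] by blast
      then show ?L unfolding eq u(4) by (rule imageI)
    qed
  qed
  show "e \<in> (`) word_of ` edges (orth_prod_iter m GL HR) \<longleftrightarrow> (\<exists>u. alt_word GL HR u \<and> length u \<le> m \<and>
     (if even (length u) then left_edge e (rev u) else right_edge e (rev u)))"
    unfolding *[OF pair] by (intro arg_cong[where f = Ex] ext conj_cong refl) (simp add: doubleton_edge_iff del: strip_simps rev_append)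
  show "e \<in> (`) word_of ` edges (orth_prod_iter m HR GL) \<longleftrightarrow> (\<exists>u. alt_word HR GL u \<and> length u \<le> m \<and>
     (if even (length u) then right_edge e (rev u) else left_edge e (rev u)))"
    unfolding *[OF pair'] by (intro arg_cong[where f = Ex] ext conj_cong refl) (simp add: doubleton_edge_iff del: strip_simps rev_append)
qed

text \<open>Apart from the length bound this is the description of the edges of the free product
  given next, so the stages are increasing subgraphs that exhaust it.\<close>

lemma edges_stages_iff:
  "e \<in> (`) word_of ` edges (orth_prod_iter m GL HR) \<union> (`) word_of ` edges (orth_prod_iter m HR GL) \<longleftrightarrow>
   (\<exists>w\<in>words. length w \<le> m \<and> ((w = [] \<or> \<not> isl (hd w)) \<and> left_edge e w \<or> (w = [] \<or> isl (hd w)) \<and> right_edge e w))"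
proof -
  have ex_rev: "(\<exists>u. P (rev u)) \<longleftrightarrow> (\<exists>w. P w)" for P :: "('a + 'b) list \<Rightarrow> bool"
    by (metis rev_rev_ident)
  have "e \<in> (`) word_of ` edges (orth_prod_iter m GL HR) \<union> (`) word_of ` edges (orth_prod_iter m HR GL) \<longleftrightarrow>
    (\<exists>u. length u \<le> m \<and> ((alt_word GL HR u \<and> even (length u) \<or> alt_word HR GL u \<and> odd (length u)) \<and> left_edge e (rev u)
       \<or> (alt_word GL HR u \<and> odd (length u) \<or> alt_word HR GL u \<and> even (length u)) \<and> right_edge e (rev u)))"
    unfolding Un_iff word_of_edges_iff by (simp only: if_bool_eq_disj) blast
  also have "\<dots> \<longleftrightarrow> (\<exists>u. length (rev u) \<le> m \<and> ((rev u \<in> words \<and> (rev u = [] \<or> \<not> isl (hd (rev u)))) \<and> left_edge e (rev u)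
       \<or> (rev u \<in> words \<and> (rev u = [] \<or> isl (hd (rev u)))) \<and> right_edge e (rev u)))"
    unfolding alt_word_parity length_rev ..
  also have "\<dots> \<longleftrightarrow> (\<exists>w. length w \<le> m \<and> ((w \<in> words \<and> (w = [] \<or> \<not> isl (hd w))) \<and> left_edge e w
       \<or> (w \<in> words \<and> (w = [] \<or> isl (hd w))) \<and> right_edge e w))"
    by (rule ex_rev)
  finally show ?thesis by blast
qed

lemma edges_free_prod_iff:
  "e \<in> edges (free_prod G H) \<longleftrightarrow>
   (\<exists>w\<in>words. (w = [] \<or> \<not> isl (hd w)) \<and> left_edge e w \<or> (w = [] \<or> isl (hd w)) \<and> right_edge e w)"
proof -
  have "e \<in> L.word_edges \<longleftrightarrow> (\<exists>w\<in>words. (w = [] \<or> \<not> isl (hd w)) \<and> left_edge e w)"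
    unfolding L.word_edges_eq left_edge_def range_Inl_iff mem_Collect_eq Bex_def by metis
  moreover have "e \<in> R.word_edges \<longleftrightarrow> (\<exists>w\<in>words. (w = [] \<or> isl (hd w)) \<and> right_edge e w)"
    unfolding R.word_edges_eq right_edge_def range_Inr_iff mem_Collect_eq Bex_def not_not by metis
  ultimately show ?thesis unfolding edges_free_prod by blast
qed

text \<open>The star product of the m-th iterates, realised inside the free product; with all stages
  on one set of words their walk counts can be compared directly.\<close>

definition stage :: "nat \<Rightarrow> ('a + 'b) list rgraph" where
  "stage m = \<lparr>verts = word_of ` verts (orth_prod_iter m GL HR) \<union> word_of ` verts (orth_prod_iter m HR GL),
     edges = (`) word_of ` edges (orth_prod_iter m GL HR) \<union> (`) word_of ` edges (orth_prod_iter m HR GL), base = []\<rparr>"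

lemma edges_stage_subset: "edges (stage m) \<subseteq> edges (free_prod G H)"
  by (rule subsetI) (auto simp: stage_def edges_stages_iff[unfolded Un_iff] edges_free_prod_iff)

lemma eventually_edges_stage:
  assumes "e \<in> edges (free_prod G H)" shows "\<forall>\<^sub>F m in sequentially. e \<in> edges (stage m)"
proof -
  obtain w where w: "w \<in> words"
    "(w = [] \<or> \<not> isl (hd w)) \<and> left_edge e w \<or> (w = [] \<or> isl (hd w)) \<and> right_edge e w"
    using assms unfolding edges_free_prod_iff by (elim bexE) (rule that)
  show ?thesis
    using eventually_ge_at_top[of "length w"]
  proof eventually_elim
    case (elim m)
    then have "e \<in> (`) word_of ` edges (orth_prod_iter m GL HR) \<union> (`) word_of ` edges (orth_prod_iter m HR GL)"
      unfolding edges_stages_iff using w by blast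
    then show ?case by (simp add: stage_def)
  qed
qed

lemma edges_free_prod_eq_UN: "edges (free_prod G H) = (\<Union>m. edges (stage m))"
proof (intro equalityI subsetI)
  fix e assume "e \<in> edges (free_prod G H)"
  from eventually_happens'[OF sequentially_bot eventually_edges_stage[OF this]]
  show "e \<in> (\<Union>m. edges (stage m))" by blast
next
  fix e assume "e \<in> (\<Union>m. edges (stage m))"
  then obtain m where "e \<in> edges (stage m)" by blast
  then show "e \<in> edges (free_prod G H)" using edges_stage_subset[of m] by blast
qed

lemma star_stage_iso:
  "\<exists>h. is_rooted_iso h (star_prod (orth_prod_iter m GL HR) (orth_prod_iter m HR GL)) (stage m)"
proof (rule star_prod_iso_glue[where f = word_of and g = word_of and o' = "[]"])
  show "word_of ` verts (orth_prod_iter m GL HR) \<inter> word_of ` verts (orth_prod_iter m HR GL) \<subseteq> {[]}"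
    using word_of_verts_meet by blast
qed (simp_all only: inj_on_word_of word_of_base simple_edges_orth_iter[OF pair] simple_edges_orth_iter[OF pair'],
  simp_all add: stage_def)

sublocale left: embedded_chain "\<lambda>m. orth_prod_iter m GL HR" "orth_emb GL HR" word_of
  unfolding word_of_def by (rule embedded_chain_orth_iter[OF pair])

sublocale right: embedded_chain "\<lambda>m. orth_prod_iter m HR GL" "orth_emb HR GL" word_of
  unfolding word_of_def by (rule embedded_chain_orth_iter[OF pair'])

theorem rooted_iso_free_prod_star_limits: "rooted_iso (free_prod G H) (star_prod (limit1 G H) (limit2 G H))"
proof -
  have base: "left.limit_map (base left.L) = []" "right.limit_map (base right.L) = []"
    unfolding left.base_limit right.base_limit
    using left.limit_map_cls[OF left.base_0] right.limit_map_cls[OF right.base_0] by (simp_all only: word_of_base)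
  have "\<exists>h. is_rooted_iso h (star_prod left.L right.L) (free_prod G H)"
  proof (rule star_prod_iso_glue[where f = left.limit_map and g = right.limit_map and o' = "[]"])
    show "left.limit_map ` verts left.L \<inter> right.limit_map ` verts right.L \<subseteq> {[]}"
      unfolding left.limit_map_verts right.limit_map_verts using word_of_verts_meet by blast
    have "verts (free_prod G H) = words" by (simp add: free_prod_def)
    also have "\<dots> = (\<Union>m. {w \<in> words. length w \<le> Suc m})" by (auto intro: le_SucI)
    also have "\<dots> = left.limit_map ` verts left.L \<union> right.limit_map ` verts right.L"
      unfolding left.limit_map_verts right.limit_map_verts verts_stages[symmetric] by blast
    finally show "verts (free_prod G H) = left.limit_map ` verts left.L \<union> right.limit_map ` verts right.L" .
    show "edges (free_prod G H) = (`) left.limit_map ` edges left.L \<union> (`) right.limit_map ` edges right.L"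
      unfolding left.limit_map_edges right.limit_map_edges edges_free_prod_eq_UN stage_def by (simp add: UN_Un_distrib)
    show "base (free_prod G H) = []" by (simp add: free_prod_def)
  qed (rule left.inj_on_limit_map right.inj_on_limit_map left.simple_edges_limit right.simple_edges_limit
      left.base_limit(2) right.base_limit(2) base)+
  then obtain h where h: "is_rooted_iso h (star_prod left.L right.L) (free_prod G H)" ..
  have "base (star_prod left.L right.L) \<in> verts (star_prod left.L right.L)"
    using left.base_limit(2) by (simp add: star_prod_def)
  from is_rooted_iso_inverse[OF h this] show ?thesis
    unfolding rooted_iso_iff limit1_def limit2_def orth_limit_def by blast
qed

end

section \<open>Convergence of moments along the stages\<close>

lemma eventually_root_walks_eq:
  assumes F: "bounded_degree_graph F D" and sub: "\<And>m. edges (X m) \<subseteq> edges F" and base: "\<And>m. base (X m) = base F"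
    and ev: "\<And>e. e \<in> edges F \<Longrightarrow> \<forall>\<^sub>F m in sequentially. e \<in> edges (X m)"
  shows "\<forall>\<^sub>F m in sequentially. root_walks (X m) k x = root_walks F k x"
proof (induction k arbitrary: x)
  case 0
  show ?case by (simp add: base)
next
  case (Suc k)
  interpret bounded_degree_graph F D by fact
  \<comment> \<open>Local finiteness makes this a finite conjunction: walks of bounded length use
    finitely many edges, all of which are eventually present.\<close>
  have "\<forall>\<^sub>F m in sequentially. \<forall>y\<in>nbrs F x. {x, y} \<in> edges (X m)"
    by (intro eventually_ball_finite finite_nbrs ballI ev) (simp add: nbrs_def)
  moreover have "\<forall>\<^sub>F m in sequentially. \<forall>y\<in>nbrs F x. root_walks (X m) k y = root_walks F k y"
    by (intro eventually_ball_finite finite_nbrs ballI Suc.IH)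
  ultimately show ?case
  proof eventually_elim
    case (elim m)
    then have "nbrs (X m) x = nbrs F x" using sub[of m] by (auto simp: nbrs_def)
    then have "(\<Sum>y\<in>nbrs (X m) x. root_walks (X m) k y) = (\<Sum>y\<in>nbrs F x. root_walks F k y)"
      using elim(2) by simp
    then show ?case
      by (simp add: adj_op_apply[of F "root_walks F k"] adj_op_apply[of "X m" "root_walks (X m) k"])
  qed
qed

text \<open>The bound \<open>D\<close> depends on \<open>m\<close>, since every orthogonal product
  adds the degree bounds of its factors; it only makes the product lemmas applicable.\<close>

lemma spectral_distribution_orth_iter:
  assumes "disjoint_pair B G H" "bounded_degree_graph G d" "bounded_degree_graph H d'"
    and "spectral_distribution G \<mu>" "spectral_distribution H \<nu>"
  shows "\<exists>D. bounded_degree_graph (orth_prod_iter m G H) D \<and>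
    spectral_distribution (orth_prod_iter m G H) (orth_conv_iter m \<mu> \<nu>)"
  using assms
proof (induction m arbitrary: G H d d' \<mu> \<nu>)
  case 0
  have "inj_on (\<lambda>x. [x]) (verts G)" by (simp add: inj_on_def)
  note rel = this 0(2) disjoint_pair_simple[OF 0(1)]
  show ?case
    using bounded_degree_graph_relabel[OF rel] spectral_distribution_relabel[OF rel] 0(4)
    by (intro exI[of _ d]) simp
next
  case (Suc m)
  note sym = disjoint_pair_sym[OF Suc.prems(1)]
  obtain D where D: "bounded_degree_graph (orth_prod_iter m H G) D"
    "spectral_distribution (orth_prod_iter m H G) (orth_conv_iter m \<nu> \<mu>)"
    using Suc.IH[OF sym Suc.prems(3,2,5,4)] by blast
  interpret two_graphs G d "orth_prod_iter m H G" D
    by (intro two_graphs.intro Suc.prems(2) D(1))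
  have "simple_edges (orth_prod G (orth_prod_iter m H G))"
    by (rule simple_edges_orth_prod[OF disjoint_pair_simple[OF Suc.prems(1)] simple_edges_orth_iter[OF sym]])
  note rel = inj_case_prod_Cons bounded_degree_graph_orth_prod this
  show ?case
    using bounded_degree_graph_relabel[OF rel] spectral_distribution_relabel[OF rel]
      spectral_distribution_orth_prod[OF Suc.prems(4) D(2)] by (intro exI[of _ "d + D"]) simp
qed

theorem theorem8p5:
  fixes G1 :: "'a rgraph" and G2 :: "'b rgraph" and \<mu> \<nu> :: "real measure"
  assumes "rooted_graph G1" and "rooted_graph G2"
  shows "rooted_iso (free_prod G1 G2) (star_prod (limit1 G1 G2) (limit2 G1 G2)) \<and>
    (spectral_distribution G1 \<mu> \<and> spectral_distribution G2 \<nu> \<and>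
     uniformly_locally_finite G1 \<and> uniformly_locally_finite G2 \<longrightarrow>
       spectral_distribution (free_prod G1 G2) (free_conv \<mu> \<nu>) \<and>
       weak_conv_m (\<lambda>m. boolean_conv (orth_conv_iter m \<mu> \<nu>) (orth_conv_iter m \<nu> \<mu>))
         (free_conv \<mu> \<nu>))"
proof -
  note s1 = simple_edges_rooted_graph[OF assms(1)] and s2 = simple_edges_rooted_graph[OF assms(2)]
  interpret simple_word_pair G1 G2
    by unfold_locales (rule s1(2), rule s2(2), use simple_edgesD[OF s1(1)] in blast,
      use simple_edgesD[OF s2(1)] in blast, rule s1(1), rule s2(1))
  have "spectral_distribution (free_prod G1 G2) (free_conv \<mu> \<nu>) \<and>
      weak_conv_m (\<lambda>m. boolean_conv (orth_conv_iter m \<mu> \<nu>) (orth_conv_iter m \<nu> \<mu>)) (free_conv \<mu> \<nu>)"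
    if \<mu>: "spectral_distribution G1 \<mu>" and \<nu>: "spectral_distribution G2 \<nu>"
      and ulf: "uniformly_locally_finite G1" "uniformly_locally_finite G2"
  proof
    obtain d where d: "bounded_degree_graph G1 d" by (rule bounded_degree_graphI[OF assms(1) ulf(1)])
    obtain d' where d': "bounded_degree_graph G2 d'" by (rule bounded_degree_graphI[OF assms(2) ulf(2)])
    interpret P: two_graphs G1 d G2 d' by (intro two_graphs.intro d d')
    let ?F = "free_prod G1 G2" and ?D = "d + d'"
    let ?\<rho> = "\<lambda>m. boolean_conv (orth_conv_iter m \<mu> \<nu>) (orth_conv_iter m \<nu> \<mu>)"
    note F = P.bounded_degree_graph_free_prod
    interpret F: bounded_degree_graph ?F ?D by (rule F)
    show free: "spectral_distribution ?F (free_conv \<mu> \<nu>)"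
      by (rule P.spectral_distribution_free_prod[OF \<mu> \<nu>])
    \<comment> \<open>As a subgraph of the free product each stage inherits the degree bound d + d',
      independent of \<open>m\<close>; this supplies the common support interval for the weak
      limit.\<close>
    have stage: "bounded_degree_graph (stage m) ?D" for m
    proof (rule bounded_degree_graph_subgraph[OF F])
      show "base (stage m) = base ?F" by (simp add: stage_def free_prod_def)
      have "[] \<in> {w \<in> words. length w \<le> Suc m}" by (simp add: free_words_Nil)
      then show "base (stage m) \<in> verts (stage m)" unfolding verts_stages[symmetric] by (simp add: stage_def)
      show "edges (stage m) \<subseteq> edges ?F" by (rule edges_stage_subset)
      fix x y assume "{x, y} \<in> edges (stage m)"
      then consider e where "{x, y} = word_of ` e" "e \<in> edges (orth_prod_iter m GL HR)"
        | e where "{x, y} = word_of ` e" "e \<in> edges (orth_prod_iter m HR GL)"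
        by (auto simp: stage_def)
      then have "{x, y} \<subseteq> verts (stage m)"
      proof cases
        case 1
        then show ?thesis using simple_edges_subset[OF simple_edges_orth_iter(1)[OF pair] 1(2)]
          by (auto simp: stage_def)
      next
        case 2
        then show ?thesis using simple_edges_subset[OF simple_edges_orth_iter(1)[OF pair'] 2(2)]
          by (auto simp: stage_def)
      qed
      then show "x \<in> verts (stage m)" by simp
    qed
    have GL: "bounded_degree_graph GL d" "spectral_distribution GL \<mu>"
      using bounded_degree_graph_relabel[OF _ d s1(1), of Inl] spectral_distribution_relabel[OF _ d s1(1), of Inl \<mu>] \<mu>
      by simp_all
    have HR: "bounded_degree_graph HR d'" "spectral_distribution HR \<nu>"
      using bounded_degree_graph_relabel[OF _ d' s2(1), of Inr] spectral_distribution_relabel[OF _ d' s2(1), of Inr \<nu>] \<nu>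
      by simp_all
    have \<rho>: "spectral_distribution (stage m) (?\<rho> m)" for m
    proof -
      obtain D1 where D1: "bounded_degree_graph (orth_prod_iter m GL HR) D1"
        "spectral_distribution (orth_prod_iter m GL HR) (orth_conv_iter m \<mu> \<nu>)"
        using spectral_distribution_orth_iter[OF pair GL(1) HR(1) GL(2) HR(2)] by blast
      obtain D2 where D2: "bounded_degree_graph (orth_prod_iter m HR GL) D2"
        "spectral_distribution (orth_prod_iter m HR GL) (orth_conv_iter m \<nu> \<mu>)"
        using spectral_distribution_orth_iter[OF pair' HR(1) GL(1) HR(2) GL(2)] by blast
      interpret S: two_graphs "orth_prod_iter m GL HR" D1 "orth_prod_iter m HR GL" D2
        by (intro two_graphs.intro D1(1) D2(1))
      obtain h where "is_rooted_iso h (star_prod (orth_prod_iter m GL HR) (orth_prod_iter m HR GL)) (stage m)"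
        using star_stage_iso by blast
      from spectral_distribution_iso[OF this S.bounded_degree_graph_star_prod stage]
      show ?thesis using S.spectral_distribution_star_prod[OF D1(2) D2(2)] by blast
    qed
    show "weak_conv_m ?\<rho> (free_conv \<mu> \<nu>)"
    proof (rule moments_tendsto_imp_weak_conv)
      show "bounded_distribution (?\<rho> m) ?D" for m
        by (rule bounded_degree_graph.spectral_distribution_bounded[OF stage \<rho>])
      show "bounded_distribution (free_conv \<mu> \<nu>) ?D"
        by (rule F.spectral_distribution_bounded[OF free])
      show "(\<lambda>m. moment (?\<rho> m) k) \<longlonglongrightarrow> moment (free_conv \<mu> \<nu>) k" for k
      \<comment> \<open>Each moment is eventually constant in \<open>m\<close>, not merely
        convergent, because it counts closed walks of a fixed length.\<close>
      proof (rule tendsto_eventually)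
        have "\<forall>\<^sub>F m in sequentially. root_walks (stage m) k (base ?F) = root_walks ?F k (base ?F)"
          by (rule eventually_root_walks_eq[OF F edges_stage_subset _ eventually_edges_stage])
            (simp add: stage_def free_prod_def)
        moreover have "moment (?\<rho> m) k = root_walks (stage m) k (base (stage m))" for m
          using \<rho>[of m] by (simp add: bounded_degree_graph.spectral_distribution_iff[OF stage])
        moreover have "base (stage m) = base ?F" for m by (simp add: stage_def free_prod_def)
        moreover have "moment (free_conv \<mu> \<nu>) k = root_walks ?F k (base ?F)"
          using free by (simp add: F.spectral_distribution_iff)
        ultimately show "\<forall>\<^sub>F m in sequentially. moment (?\<rho> m) k = moment (free_conv \<mu> \<nu>) k"
          by simp
      qed
    qed
  qed
  then show ?thesis using rooted_iso_free_prod_star_limits by blast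
qed

end
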